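(* Let $0<\alpha<1$, $T>0$, $0<\nu<\mu$, $Y=(0,\ell_1)$ with $\ell_1>0$, and let $\Omega\subset\mathbb{R}$ be a bounded open interval. Let $x_0\in\Omega$ and $t_0\in(0,T)$ be arbitrarily chosen. Assume that $u_0\in H^2(\Omega)\cap H_0^1(\Omega)$ satisfies $u_0\not\equiv0$ in $\Omega$ and $\Delta u_0(x)\ge0$ for a.e. $x\in\Omega$. Then there exists a constant $C=C(\nu,\mu,Y)>0$ such that the following holds. Let $a_1,a_2\in L^\infty(Y)$ be $Y$-periodic with $\nu\le a_k\le\mu$ on $\overline Y$ ($k=1,2$) and $a_1(y)\ge a_2(y)$ for $y\in\overline Y$, let $a_k^0=1/\mathcal{M}_Y(1/a_k)$, and let $u_k^0$ be the weak solution of the homogenized problem $$\partial_t^\alpha u_k^0-\partial_x(a_k^0\partial_xu_k^0)=0\ \text{in }\Omega\times(0,T),\quad u_k^0=0\ \text{on }\partial\Omega\times(0,T),\quad u_k^0(\cdot,0)=u_0\ \text{in }\Omega.$$ Then $$\|a_1-a_2\|_{L^1(Y)}\le C\,|u_1^0(x_0,t_0)-u_2^0(x_0,t_0)|.$$ (Here $\alpha,\Omega,T,x_0,t_0,u_0$ are fixed; $C$ is independent of $a_1,a_2$.)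
   Context: $\mathcal{M}_Y(g)=\frac1{|Y|}\int_Yg\,dy$; $Y$-periodic means $\ell_1$-periodic on $\mathbb{R}$. The problem for $u_k^0$ is the homogenization limit, as $\varepsilon\to0$, of the problems with coefficient $a_k(x/\varepsilon)$ and initial values converging weakly in $L^2(\Omega)$ to $u_0$. Fractional derivative: for a Hilbert space $X$ and $\beta>0$, $J^\beta v(t)=\frac1{\Gamma(\beta)}\int_0^t(t-s)^{\beta-1}v(s)\,ds$. $H^\alpha(0,T;X)$ is the Sobolev–Slobodeckij space; $H_\alpha(0,T;X)$ is $H^\alpha(0,T;X)$ if $\alpha<\frac12$; $\{u\in H^{1/2}(0,T;X):\int_0^T\|u(t)\|_X^2t^{-1}dt<\infty\}$ if $\alpha=\frac12$; $\{u\in H^\alpha(0,T;X):u(0)=0\}$ if $\alpha>\frac12$. The map $J^\alpha:L^2(0,T;X)\to H_\alpha(0,T;X)$ is an isomorphism and $\partial_t^\alpha:=(J^\alpha)^{-1}$ (generalized Caputo derivative). Weak solution: $u_k^0$ is the unique function in $L^2(0,T;H_0^1(\Omega))$ with $u_k^0-u_0\in H_\alpha(0,T;H^{-1}(\Omega))$ such that for a.e. $t$ and all $\Phi\in H_0^1(\Omega)$, $\langle\partial_t^\alpha(u_k^0-u_0),\Phi\rangle_{H^{-1},H_0^1}+a_k^0(\partial_xu_k^0,\partial_x\Phi)_{L^2(\Omega)}=0$. For $t>0$, $u_k^0(\cdot,t)\in H^2(\Omega)\subset C(\overline\Omega)$, so point values are those of the continuous representative. *)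

theory Defs
  imports "HOL-Analysis.Analysis"
begin

section \<open>Sobolev spaces on an open set of the real line\<close>

text \<open>Elements of \<open>L\<^sup>2\<close>, \<open>H\<^sup>1\<close>, ... are represented by functions
  \<open>real \<Rightarrow> real\<close>; only their values almost everywhere on the open set \<open>S\<close> matter.\<close>

definition test_functions :: "real set \<Rightarrow> (real \<Rightarrow> real) set" where
  "test_functions S = {\<phi>. (\<forall>n x. (deriv ^^ n) \<phi> field_differentiable at x) \<and>
     (\<exists>K. compact K \<and> K \<subseteq> S \<and> (\<forall>x. x \<notin> K \<longrightarrow> \<phi> x = 0))}"

definition L2 :: "real set \<Rightarrow> (real \<Rightarrow> real) set" where
  "L2 S = {f. f \<in> borel_measurable (lebesgue_on S) \<and> integrable (lebesgue_on S) (\<lambda>x. (f x)\<^sup>2)}"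

definition is_weak_deriv :: "real set \<Rightarrow> (real \<Rightarrow> real) \<Rightarrow> (real \<Rightarrow> real) \<Rightarrow> bool" where
  "is_weak_deriv S f g \<longleftrightarrow> f \<in> L2 S \<and> g \<in> L2 S \<and>
     (\<forall>\<phi>\<in>test_functions S.
        (LINT x|lebesgue_on S. f x * deriv \<phi> x) = - (LINT x|lebesgue_on S. g x * \<phi> x))"

text \<open>Determined up to null sets for \<open>f \<in> H1 S\<close>.\<close>

definition weak_deriv :: "real set \<Rightarrow> (real \<Rightarrow> real) \<Rightarrow> real \<Rightarrow> real" where
  "weak_deriv S f = (SOME g. is_weak_deriv S f g)"

definition H1 :: "real set \<Rightarrow> (real \<Rightarrow> real) set" where
  "H1 S = {f. \<exists>g. is_weak_deriv S f g}"

definition H2 :: "real set \<Rightarrow> (real \<Rightarrow> real) set" where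
  "H2 S = {f \<in> H1 S. weak_deriv S f \<in> H1 S}"

definition H1_norm :: "real set \<Rightarrow> (real \<Rightarrow> real) \<Rightarrow> real" where
  "H1_norm S f = sqrt ((LINT x|lebesgue_on S. (f x)\<^sup>2) + (LINT x|lebesgue_on S. (weak_deriv S f x)\<^sup>2))"

definition H10 :: "real set \<Rightarrow> (real \<Rightarrow> real) set" where
  "H10 S = {f \<in> H1 S. \<exists>\<phi>. (\<forall>n::nat. \<phi> n \<in> test_functions S) \<and>
     (\<lambda>n. H1_norm S (\<lambda>x. f x - \<phi> n x)) \<longlonglongrightarrow> 0}"

text \<open>The dual \<open>H\<^sup>-\<^sup>1\<close> of \<open>H10 S\<close>. The values of a functional outside \<open>H10 S\<close> are irrelevant.\<close>

definition Hm1 :: "real set \<Rightarrow> ((real \<Rightarrow> real) \<Rightarrow> real) set" where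
  "Hm1 S = {F. (\<forall>\<Phi>\<in>H10 S. \<forall>\<Psi>\<in>H10 S. \<forall>a b. F (\<lambda>x. a * \<Phi> x + b * \<Psi> x) = a * F \<Phi> + b * F \<Psi>) \<and>
     (\<exists>B. \<forall>\<Phi>\<in>H10 S. \<bar>F \<Phi>\<bar> \<le> B * H1_norm S \<Phi>)}"

definition Hm1_norm :: "real set \<Rightarrow> ((real \<Rightarrow> real) \<Rightarrow> real) \<Rightarrow> real" where
  "Hm1_norm S F = (SUP \<Phi>\<in>{\<Phi> \<in> H10 S. H1_norm S \<Phi> \<le> 1}. \<bar>F \<Phi>\<bar>)"

definition L2_into_Hm1 :: "real set \<Rightarrow> (real \<Rightarrow> real) \<Rightarrow> (real \<Rightarrow> real) \<Rightarrow> real" where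
  "L2_into_Hm1 S f = (\<lambda>\<Phi>. LINT x|lebesgue_on S. f x * \<Phi> x)"


section \<open>Functions of time with values in a Hilbert space\<close>

text \<open>The spaces \<open>H10 S\<close> and \<open>Hm1 S\<close> depend on the set \<open>S\<close> and hence are not types, so the
  Bochner integral of the library, which works on types, does not apply to them. Here a Hilbert
  space is given by a carrier \<open>X\<close> of real-valued functions, with the pointwise vector space
  operations, and a seminorm \<open>N\<close> on \<open>X\<close>; two elements are identified if their difference
  has seminorm \<open>0\<close>. For \<open>H10 S\<close> the arguments \<open>d\<close> of these functions are points, for \<open>Hm1 S\<close>
  they are elements of \<open>H10 S\<close>. The time set \<open>I\<close> is always a bounded interval.\<close>

definition simple_fun :: "real set \<Rightarrow> ('d \<Rightarrow> real) set \<Rightarrow> (real \<Rightarrow> 'd \<Rightarrow> real) \<Rightarrow> bool" where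
  "simple_fun I X s \<longleftrightarrow> finite (s ` I) \<and> s ` I \<subseteq> X \<and> (\<forall>c. {t \<in> I. s t = c} \<in> sets lebesgue)"

definition simple_int :: "real set \<Rightarrow> (real \<Rightarrow> 'd \<Rightarrow> real) \<Rightarrow> 'd \<Rightarrow> real" where
  "simple_int I s = (\<lambda>d. \<Sum>c\<in>s ` I. measure lebesgue {t \<in> I. s t = c} * c d)"

definition strongly_measurable ::
  "real set \<Rightarrow> ('d \<Rightarrow> real) set \<Rightarrow> (('d \<Rightarrow> real) \<Rightarrow> real) \<Rightarrow> (real \<Rightarrow> 'd \<Rightarrow> real) \<Rightarrow> bool" where
  "strongly_measurable I X N v \<longleftrightarrow> (AE t in lebesgue_on I. v t \<in> X) \<and>
     (\<exists>s. (\<forall>n::nat. simple_fun I X (s n)) \<and>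
        (AE t in lebesgue_on I. (\<lambda>n. N (\<lambda>d. v t d - s n t d)) \<longlonglongrightarrow> 0))"

definition bochner_integral_is ::
  "real set \<Rightarrow> ('d \<Rightarrow> real) set \<Rightarrow> (('d \<Rightarrow> real) \<Rightarrow> real) \<Rightarrow> (real \<Rightarrow> 'd \<Rightarrow> real) \<Rightarrow> ('d \<Rightarrow> real) \<Rightarrow> bool"
  where
  "bochner_integral_is I X N v y \<longleftrightarrow> strongly_measurable I X N v \<and> y \<in> X \<and>
     (\<exists>s. (\<forall>n::nat. simple_fun I X (s n)) \<and>
        (\<lambda>n. \<integral>\<^sup>+t. ennreal (N (\<lambda>d. v t d - s n t d)) \<partial>lebesgue_on I) \<longlonglongrightarrow> 0 \<and>
        (\<lambda>n. N (\<lambda>d. simple_int I (s n) d - y d)) \<longlonglongrightarrow> 0)"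

definition L2_time ::
  "real \<Rightarrow> ('d \<Rightarrow> real) set \<Rightarrow> (('d \<Rightarrow> real) \<Rightarrow> real) \<Rightarrow> (real \<Rightarrow> 'd \<Rightarrow> real) set" where
  "L2_time T X N = {v. strongly_measurable {0<..<T} X N v \<and>
     (\<integral>\<^sup>+t. ennreal ((N (v t))\<^sup>2) \<partial>lebesgue_on {0<..<T}) < \<infinity>}"

text \<open>The Sobolev--Slobodeckij space \<open>H\<^sup>\<alpha>(0,T;X)\<close> for \<open>0 < \<alpha> < 1\<close>.\<close>

definition Slobodeckij ::
  "real \<Rightarrow> real \<Rightarrow> ('d \<Rightarrow> real) set \<Rightarrow> (('d \<Rightarrow> real) \<Rightarrow> real) \<Rightarrow> (real \<Rightarrow> 'd \<Rightarrow> real) set" where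
  "Slobodeckij \<alpha> T X N = {v \<in> L2_time T X N.
     (\<integral>\<^sup>+t. (\<integral>\<^sup>+s. ennreal ((N (\<lambda>d. v t d - v s d))\<^sup>2 / \<bar>t - s\<bar> powr (1 + 2 * \<alpha>))
        \<partial>lebesgue_on {0<..<T}) \<partial>lebesgue_on {0<..<T}) < \<infinity>}"

text \<open>\<open>v(0) = 0\<close> for an almost everywhere defined \<open>v\<close>, in the sense of its continuous
  representative \<open>w\<close> (which exists for \<open>v \<in> H\<^sup>\<alpha>(0,T;X)\<close> with \<open>\<alpha> > 1/2\<close>).\<close>

definition zero_initial_value ::
  "real \<Rightarrow> ('d \<Rightarrow> real) set \<Rightarrow> (('d \<Rightarrow> real) \<Rightarrow> real) \<Rightarrow> (real \<Rightarrow> 'd \<Rightarrow> real) \<Rightarrow> bool" where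
  "zero_initial_value T X N v \<longleftrightarrow> (\<exists>w. (\<forall>t\<in>{0..T}. w t \<in> X) \<and>
     (\<forall>t\<in>{0..T}. ((\<lambda>s. N (\<lambda>d. w s d - w t d)) \<longlongrightarrow> 0) (at t within {0..T})) \<and>
     (AE t in lebesgue_on {0<..<T}. N (\<lambda>d. v t d - w t d) = 0) \<and>
     N (w 0) = 0)"

definition H_sub ::
  "real \<Rightarrow> real \<Rightarrow> ('d \<Rightarrow> real) set \<Rightarrow> (('d \<Rightarrow> real) \<Rightarrow> real) \<Rightarrow> (real \<Rightarrow> 'd \<Rightarrow> real) set" where
  "H_sub \<alpha> T X N = {v \<in> Slobodeckij \<alpha> T X N.
     (\<alpha> = 1/2 \<longrightarrow> (\<integral>\<^sup>+t. ennreal ((N (v t))\<^sup>2 / t) \<partial>lebesgue_on {0<..<T}) < \<infinity>) \<and>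
     (\<alpha> > 1/2 \<longrightarrow> zero_initial_value T X N v)}"

text \<open>\<open>v = J\<^sup>\<beta> w\<close> in \<open>L\<^sup>2(0,T;X)\<close>. For \<open>w \<in> L\<^sup>2(0,T;X)\<close> and \<open>\<beta> \<le> 1/2\<close> the integral
  need only exist for almost every \<open>t\<close>.\<close>

definition is_frac_integral ::
  "real \<Rightarrow> real \<Rightarrow> ('d \<Rightarrow> real) set \<Rightarrow> (('d \<Rightarrow> real) \<Rightarrow> real) \<Rightarrow>
    (real \<Rightarrow> 'd \<Rightarrow> real) \<Rightarrow> (real \<Rightarrow> 'd \<Rightarrow> real) \<Rightarrow> bool" where
  "is_frac_integral \<beta> T X N w v \<longleftrightarrow> (AE t in lebesgue_on {0<..<T}.
     bochner_integral_is {0<..<t} X N (\<lambda>s d. (t - s) powr (\<beta> - 1) / Gamma \<beta> * w s d) (v t))"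

text \<open>\<open>w = \<partial>\<^sub>t\<^sup>\<alpha> v\<close> with \<open>\<partial>\<^sub>t\<^sup>\<alpha> = (J\<^sup>\<alpha>)\<^sup>-\<^sup>1\<close>, the inverse of
  \<open>J\<^sup>\<alpha> : L\<^sup>2(0,T;X) \<rightarrow> H\<^sub>\<alpha>(0,T;X)\<close>.\<close>

definition is_caputo_deriv ::
  "real \<Rightarrow> real \<Rightarrow> ('d \<Rightarrow> real) set \<Rightarrow> (('d \<Rightarrow> real) \<Rightarrow> real) \<Rightarrow>
    (real \<Rightarrow> 'd \<Rightarrow> real) \<Rightarrow> (real \<Rightarrow> 'd \<Rightarrow> real) \<Rightarrow> bool" where
  "is_caputo_deriv \<alpha> T X N v w \<longleftrightarrow>
     v \<in> H_sub \<alpha> T X N \<and> w \<in> L2_time T X N \<and> is_frac_integral \<alpha> T X N w v"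


section \<open>The homogenized problem\<close>

definition mean :: "real set \<Rightarrow> (real \<Rightarrow> real) \<Rightarrow> real" where
  "mean Y g = 1 / measure lebesgue Y * (LINT y|lebesgue_on Y. g y)"

definition homogenized_coeff :: "real set \<Rightarrow> (real \<Rightarrow> real) \<Rightarrow> real" where
  "homogenized_coeff Y a = 1 / mean Y (\<lambda>y. 1 / a y)"

definition Linfty :: "real set \<Rightarrow> (real \<Rightarrow> real) set" where
  "Linfty Y = {f. f \<in> borel_measurable (lebesgue_on Y) \<and> (\<exists>B. AE y in lebesgue_on Y. \<bar>f y\<bar> \<le> B)}"

text \<open>Weak solutions for the constant coefficient \<open>a\<close>; the time variable is the first argument
  of \<open>u\<close>, the space variable the second.\<close>

definition weak_solution ::
  "real \<Rightarrow> real \<Rightarrow> real set \<Rightarrow> real \<Rightarrow> (real \<Rightarrow> real) \<Rightarrow> (real \<Rightarrow> real \<Rightarrow> real) \<Rightarrow> bool" where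
  "weak_solution \<alpha> T S a u0 u \<longleftrightarrow>
     u \<in> L2_time T (H10 S) (H1_norm S) \<and>
     (\<lambda>t. L2_into_Hm1 S (\<lambda>x. u t x - u0 x)) \<in> H_sub \<alpha> T (Hm1 S) (Hm1_norm S) \<and>
     (\<exists>w. is_caputo_deriv \<alpha> T (Hm1 S) (Hm1_norm S) (\<lambda>t. L2_into_Hm1 S (\<lambda>x. u t x - u0 x)) w \<and>
        (AE t in lebesgue_on {0<..<T}. \<forall>\<Phi>\<in>H10 S.
           w t \<Phi> + a * (LINT x|lebesgue_on S. weak_deriv S (u t) x * weak_deriv S \<Phi> x) = 0))"

end

theory Submission
  imports Defs
begin

text \<open>For the constant coefficient \<open>a\<close> the solution is
  \<open>u(t, x) = 2/L \<Sum>\<^sub>n c\<^sub>n E\<^sub>\<alpha>(- a \<lambda>\<^sub>n t\<^sup>\<alpha>) \<phi>\<^sub>n(x)\<close>, where \<open>\<phi>\<^sub>n\<close>, \<open>\<lambda>\<^sub>n\<close> are the Dirichlet sine modes of the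
  interval of length \<open>L\<close> and their eigenvalues, \<open>c\<^sub>n\<close> are the coefficients of \<open>u\<^sub>0\<close>, and \<open>E\<^sub>\<alpha>\<close> is the
  Mittag-Leffler function. The function \<open>E\<^sub>\<alpha>(- z)\<close> is the Laplace transform of a probability measure on
  \<open>(0, \<infinity>)\<close>; hence \<open>u(t, x)\<close> is an average over \<open>\<theta>\<close> of the heat solution at the times
  \<open>a t\<^sup>\<alpha> \<theta>\<close>. Since \<open>u\<^sub>0'' \<ge> 0\<close>, the time derivative of the heat solution at \<open>x\<^sub>0\<close> is the integral of
  \<open>u\<^sub>0''\<close> against the Dirichlet heat kernel, which is bounded below by a positive multiple of
  \<open>\<phi>\<^sub>1(x) \<phi>\<^sub>1(y)\<close>: by the Jacobi triple product the theta function is a product of positive factors that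
  decrease on \<open>[0, \<pi>]\<close>. So \<open>u(t\<^sub>0, x\<^sub>0)\<close> increases in \<open>a\<close> with derivative bounded below on \<open>[\<nu>, \<mu>]\<close>,
  and the harmonic mean \<open>a\<^sup>0\<close> controls the \<open>L\<^sup>1\<close> distance of the ordered coefficients.\<close>

section \<open>A random time with Mittag-Leffler Laplace transform\<close>

text \<open>The mixing measure is never constructed. The Mittag-Leffler law is the limit law of the
  number of tables in the Chinese restaurant process with parameters (\<alpha>, 0), scaled by
  \<open>n powr (- \<alpha>)\<close>; \<open>chain_prob\<close> is the law of that number minus one
  after \<open>n + 1\<close> customers. Its rising-factorial moments are explicit products, so two
  facts about the finite laws carry the argument: their Laplace transforms converge, and they keep a
  fixed mass on a compact part of (0, \<infinity>). The second makes an average of increasing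
  functions increase at a definite rate. Likewise the triple product enters only in its finite form,
  an exact polynomial identity; the kernel bound holds for every truncation with one constant, and
  the limit is taken after integration against \<open>u0''\<close>. About the weak solutions only
  the definition and continuity are available: they are identified by testing with one mode at a
  time, which turns the equation into a scalar Volterra equation with a unique solution. Continuity
  and completeness of the sine system then give the value at \<open>(t0, x0)\<close>.\<close>

lemma binomial_Suc_add:
  "real (Suc j + k choose k) * (real j + 1) = real (j + k choose k) * (real j + real k + 1)"
proof -
  have a: "j + k choose k = j + k choose j"
    using binomial_symmetric[of k "j + k"] by simp
  have b: "Suc j + k choose k = Suc (j + k) choose Suc j"
    using binomial_symmetric[of k "Suc j + k"] by (simp del: binomial_Suc_Suc)
  have "(Suc j + k choose k) * Suc j = (j + k choose k) * Suc (j + k)"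
    using Suc_times_binomial_eq[of "j + k" j] unfolding a b by (simp only: mult.commute)
  then show ?thesis
    by (metis of_nat_Suc of_nat_add of_nat_mult add.commute)
qed

lemma rGamma_real_pos: "0 < x \<Longrightarrow> 0 < (rGamma x :: real)"
  by (simp add: rGamma_inverse_Gamma Gamma_real_pos)

text \<open>The law after \<open>n\<close> steps of the chain that moves from \<open>j\<close> to \<open>j + 1\<close> at step \<open>n + 1\<close> with
  probability \<open>\<alpha> (j + 1) / (n + 1)\<close>. This probability is chosen so that the expectation of
  \<open>(j + k) choose k\<close> gets multiplied by \<open>1 + \<alpha> k / (n + 1)\<close> in each step; after scaling \<open>j\<close> by
  \<open>n powr (- \<alpha>)\<close> these moments tend to the coefficients of the Mittag-Leffler function.\<close>

fun chain_prob :: "real \<Rightarrow> nat \<Rightarrow> nat \<Rightarrow> real" where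
  "chain_prob \<alpha> 0 j = (if j = 0 then 1 else 0)"
| "chain_prob \<alpha> (Suc n) j = chain_prob \<alpha> n j * (1 - \<alpha> * (real j + 1) / (real n + 1)) +
     (if j = 0 then 0 else chain_prob \<alpha> n (j - 1) * (\<alpha> * real j / (real n + 1)))"

lemma chain_prob_eq_0: "n < j \<Longrightarrow> chain_prob \<alpha> n j = 0"
  by (induction n arbitrary: j) auto

text \<open>The staying probability can be negative only for \<open>j > n\<close>, where the law
  carries no mass.\<close>

lemma chain_prob_nonneg:
  assumes "0 \<le> \<alpha>" "\<alpha> \<le> 1"
  shows "0 \<le> chain_prob \<alpha> n j"
proof (induction n arbitrary: j)
  case (Suc n)
  have "0 \<le> chain_prob \<alpha> n j * (1 - \<alpha> * (real j + 1) / (real n + 1))"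
  proof (cases "j \<le> n")
    case True
    have "\<alpha> * (real j + 1) \<le> 1 * (real n + 1)"
      using assms True by (intro mult_mono) auto
    then show ?thesis
      using Suc by (intro mult_nonneg_nonneg) (auto simp: field_simps)
  qed (simp add: chain_prob_eq_0)
  then show ?case
    using Suc assms by (auto intro!: add_nonneg_nonneg mult_nonneg_nonneg)
qed auto

text \<open>Summation by parts moves the step from the law to the observable: \<open>F j\<close> is
  replaced by its conditional expectation after one step.\<close>

lemma chain_prob_sum_Suc:
  "(\<Sum>j\<le>Suc n. chain_prob \<alpha> (Suc n) j * F j) =
   (\<Sum>j\<le>n. chain_prob \<alpha> n j * (F j + \<alpha> * (real j + 1) / (real n + 1) * (F (Suc j) - F j)))"
proof -
  have "(\<Sum>j\<le>Suc n. chain_prob \<alpha> (Suc n) j * F j) =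
     (\<Sum>j\<le>Suc n. chain_prob \<alpha> n j * (1 - \<alpha> * (real j + 1) / (real n + 1)) * F j) +
     (\<Sum>j\<le>Suc n. (if j = 0 then 0 else chain_prob \<alpha> n (j - 1) * (\<alpha> * real j / (real n + 1))) * F j)"
    by (simp only: chain_prob.simps distrib_right sum.distrib)
  also have "(\<Sum>j\<le>Suc n. chain_prob \<alpha> n j * (1 - \<alpha> * (real j + 1) / (real n + 1)) * F j) =
     (\<Sum>j\<le>n. chain_prob \<alpha> n j * (1 - \<alpha> * (real j + 1) / (real n + 1)) * F j)"
    by (simp add: chain_prob_eq_0)
  also have "(\<Sum>j\<le>Suc n. (if j = 0 then 0 else chain_prob \<alpha> n (j - 1) * (\<alpha> * real j / (real n + 1))) * F j)
     = (\<Sum>j\<le>n. chain_prob \<alpha> n j * (\<alpha> * (real j + 1) / (real n + 1)) * F (Suc j))"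
    by (subst sum.atMost_Suc_shift) (simp add: add.commute)
  also have "(\<Sum>j\<le>n. chain_prob \<alpha> n j * (1 - \<alpha> * (real j + 1) / (real n + 1)) * F j) +
     (\<Sum>j\<le>n. chain_prob \<alpha> n j * (\<alpha> * (real j + 1) / (real n + 1)) * F (Suc j)) =
     (\<Sum>j\<le>n. chain_prob \<alpha> n j * (F j + \<alpha> * (real j + 1) / (real n + 1) * (F (Suc j) - F j)))"
    unfolding sum.distrib[symmetric] by (intro sum.cong refl) (simp only: algebra_simps)
  finally show ?thesis .
qed

text \<open>This is Gamma(n + 1 + \<alpha>k) / (n! Gamma(1 + \<alpha>k)), which grows like
  \<open>n powr (\<alpha> * k)\<close>; hence the scaling in \<open>scaled_moment\<close>.\<close>

definition rising_moment :: "real \<Rightarrow> nat \<Rightarrow> nat \<Rightarrow> real" where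
  "rising_moment \<alpha> n k = (\<Prod>i=1..n. 1 + \<alpha> * real k / real i)"

text \<open>As a function of \<open>j\<close>, \<open>(j + k) choose k\<close> is an eigenfunction
  of the step: \<open>j + 1\<close> times its forward difference is \<open>k\<close> times itself,
  so each step contributes one factor of the product.\<close>

lemma chain_prob_moment:
  "(\<Sum>j\<le>n. chain_prob \<alpha> n j * real ((j + k) choose k)) = rising_moment \<alpha> n k"
proof (induction n)
  case (Suc n)
  have *: "real ((j + k) choose k) + \<alpha> * (real j + 1) / (real n + 1) *
      (real ((Suc j + k) choose k) - real ((j + k) choose k)) =
      real ((j + k) choose k) * (1 + \<alpha> * real k / (real n + 1))" for j
  proof -
    have "(real j + 1) * (real ((Suc j + k) choose k) - real ((j + k) choose k))
       = real k * real (j + k choose k)"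
      using binomial_Suc_add[of j k] by (simp add: algebra_simps del: binomial_Suc_Suc)
    then have "\<alpha> * (real j + 1) / (real n + 1) * (real ((Suc j + k) choose k) - real ((j + k) choose k)) =
      \<alpha> / (real n + 1) * (real k * real (j + k choose k))"
      by (metis (no_types, lifting) mult.assoc times_divide_eq_left)
    then show ?thesis by (simp add: algebra_simps)
  qed
  show ?case
    unfolding chain_prob_sum_Suc * using Suc
    by (simp add: rising_moment_def mult.assoc[symmetric] sum_distrib_right[symmetric] add.commute)
qed (simp add: rising_moment_def)

lemma chain_prob_sum: "(\<Sum>j\<le>n. chain_prob \<alpha> n j) = 1"
  using chain_prob_moment[of \<alpha> n 0] by (simp add: rising_moment_def)

definition scaled_moment :: "real \<Rightarrow> nat \<Rightarrow> nat \<Rightarrow> real" where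
  "scaled_moment \<alpha> n k = rising_moment \<alpha> n k * real n powr (- (\<alpha> * real k))"

lemma scaled_moment_tendsto:
  assumes "0 < \<alpha>"
  shows "(\<lambda>n. scaled_moment \<alpha> n k) \<longlonglongrightarrow> rGamma (1 + \<alpha> * real k)"
proof -
  define x where "x = \<alpha> * real k"
  have x: "0 \<le> x" using assms by (simp add: x_def)
  \<comment> \<open>The library series has \<open>n + 1\<close> factors and the power
    \<open>n powr (1 + x)\<close>, whereas \<open>scaled_moment\<close> has \<open>n\<close> factors
    and \<open>n powr x\<close>; the quotient \<open>n / (1 + x + n)\<close> corrects both.\<close>
  have "(\<lambda>n. rGamma_series (1 + x) n * (real n / (1 + x + real n))) \<longlonglongrightarrow> rGamma (1 + x) * 1"
  proof (intro tendsto_mult rGamma_series_LIMSEQ)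
    show "(\<lambda>n. real n / (1 + x + real n)) \<longlonglongrightarrow> 1" by real_asymp
  qed
  moreover have "eventually (\<lambda>n. rGamma_series (1 + x) n * (real n / (1 + x + real n)) =
      scaled_moment \<alpha> n k) sequentially"
    using eventually_gt_at_top[of 0]
  proof eventually_elim
    case (elim n)
    have p: "rising_moment \<alpha> n k = pochhammer (1 + x) n / fact n"
    proof -
      have "rising_moment \<alpha> n k = (\<Prod>i=1..n. (x + real i) / real i)"
        unfolding rising_moment_def x_def by (intro prod.cong) (auto simp: field_simps)
      also have "\<dots> = (\<Prod>i=1..n. (x + real i)) / fact n"
        by (simp add: prod_dividef fact_prod)
      also have "(\<Prod>i=1..n. (x + real i)) = (\<Prod>i=0..<n. (x + real (Suc i)))"
        by (simp only: prod.atLeast1_atMost_eq One_nat_def atLeast0LessThan)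
      also have "\<dots> = pochhammer (1 + x) n"
        by (simp add: pochhammer_prod add_ac)
      finally show ?thesis .
    qed
    have e: "exp ((1 + x) * of_real (ln (of_nat n))) = real n * real n powr x"
      using elim by (simp add: distrib_right exp_add powr_def)
    show ?case
      unfolding scaled_moment_def p rGamma_series_def e x_def[symmetric]
      using elim x by (simp add: pochhammer_Suc powr_minus divide_simps)
  qed
  ultimately show ?thesis
    unfolding x_def[symmetric] mult_1_right by (rule Lim_transform_eventually)
qed

text \<open>The exponent \<open>\<alpha> * k\<close> splits into its integer part \<open>f\<close>
  and a rest \<open>d < 1\<close>. The factors \<open>1 + f / i\<close> multiply to a binomial
  coefficient, and the factors \<open>1 + d / i\<close> are bounded through the harmonic sum by
  \<open>exp 1 * n powr d\<close>.\<close>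

lemma rising_moment_le:
  fixes k :: nat
  assumes "0 < \<alpha>" "0 < n"
  defines "f \<equiv> nat \<lfloor>\<alpha> * real k\<rfloor>"
  shows "rising_moment \<alpha> n k \<le> real (n + f choose f) * (exp 1 * real n powr (\<alpha> * real k - real f))"
proof -
  define x where "x = \<alpha> * real k"
  have x: "0 \<le> x" using assms by (simp add: x_def)
  have f: "real f \<le> x" "x < real f + 1" using x by (auto simp: f_def x_def)
  define d where "d = x - real f"
  have d: "0 \<le> d" "d < 1" using f by (auto simp: d_def)
  have "rising_moment \<alpha> n k \<le> (\<Prod>i=1..n. (1 + real f / real i) * exp (d / real i))"
    unfolding rising_moment_def x_def[symmetric]
  proof (intro prod_mono conjI)
    fix i assume i: "i \<in> {1..n}"
    show "0 \<le> 1 + x / real i" using x by simp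
    have "(1 + real f / real i) * (1 + d / real i) = 1 + x / real i + real f / real i * (d / real i)"
      by (simp add: d_def algebra_simps add_divide_distrib diff_divide_distrib)
    moreover have "0 \<le> real f / real i * (d / real i)" using d by simp
    ultimately have "1 + x / real i \<le> (1 + real f / real i) * (1 + d / real i)" by linarith
    also have "\<dots> \<le> (1 + real f / real i) * exp (d / real i)"
      by (intro mult_left_mono exp_ge_add_one_self) auto
    finally show "1 + x / real i \<le> \<dots>" .
  qed
  also have "\<dots> = (\<Prod>i=1..n. (1 + real f / real i)) * exp (\<Sum>i=1..n. d / real i)"
    by (simp add: prod.distrib exp_sum)
  also have "(\<Prod>i=1..n. (1 + real f / real i)) = real (n + f choose f)"
  proof (induction n)
    case (Suc n)
    have "real (Suc n + f choose f) = real (n + f choose f) * ((real n + real f + 1) / (real n + 1))"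
      using binomial_Suc_add[of n f] by (simp add: field_simps del: binomial_Suc_Suc)
    also have "(real n + real f + 1) / (real n + 1) = 1 + real f / real (Suc n)"
      by (simp add: field_simps)
    finally show ?case using Suc by (simp del: binomial_Suc_Suc of_nat_Suc)
  qed auto
  also have "exp (\<Sum>i=1..n. d / real i) \<le> exp 1 * real n powr d"
  proof -
    have "(\<Sum>i=1..n. d / real i) = d * harm n"
      by (simp add: harm_def sum_distrib_left divide_inverse)
    also have "\<dots> \<le> d * (ln (real n) + 1)"
      using d assms(2) euler_mascheroni_sequence_decreasing[of 1 n]
      by (intro mult_left_mono) (auto simp: harm_def)
    also have "\<dots> \<le> 1 + d * ln (real n)"
      using d by (simp add: algebra_simps)
    finally have "exp (\<Sum>i=1..n. d / real i) \<le> exp (1 + d * ln (real n))" by simp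
    then show ?thesis using assms by (simp add: exp_add powr_def)
  qed
  finally show ?thesis unfolding d_def x_def by (simp add: mult_left_mono)
qed


lemma scaled_moment_nonneg: "0 < \<alpha> \<Longrightarrow> 0 \<le> scaled_moment \<alpha> n k"
  unfolding scaled_moment_def rising_moment_def
  by (intro mult_nonneg_nonneg prod_nonneg) auto

text \<open>From \<open>y ^ f / f! \<le> exp y\<close> with \<open>y = (1 + f / n) / \<rho>\<close>: a geometric bound of arbitrarily small
  ratio, uniform in large \<open>n\<close>.\<close>

lemma scaled_moment_le:
  fixes k :: nat
  assumes "0 < \<alpha>" "0 < \<rho>" "1 / \<rho> \<le> real n" "exp 1 * \<rho> \<le> 1"
  shows "scaled_moment \<alpha> n k \<le> exp (1 + 1 / \<rho>) * (exp 1 * \<rho>) powr (\<alpha> * real k - 1)"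
proof -
  define f where "f = nat \<lfloor>\<alpha> * real k\<rfloor>"
  have f: "real f \<le> \<alpha> * real k" "\<alpha> * real k < real f + 1" using assms by (auto simp: f_def)
  have n: "0 < real n" using assms by (smt (verit) divide_pos_pos)
  have "real ((n + f choose f) * fact f) \<le> real ((n + f) ^ f)"
    using binomial_fact_pow[of "n + f" f] by (simp only: of_nat_le_iff)
  then have b: "real (n + f choose f) \<le> real (n + f) ^ f / fact f"
    by (simp only: of_nat_mult of_nat_power of_nat_fact pos_le_divide_eq[OF fact_gt_zero])
  have "rising_moment \<alpha> n k \<le> real (n + f choose f) * (exp 1 * real n powr (\<alpha> * real k - real f))"
    using rising_moment_le[of \<alpha> n k] assms(1) n unfolding f_def[symmetric] by simp
  also have "\<dots> \<le> real (n + f) ^ f / fact f * (exp 1 * real n powr (\<alpha> * real k - real f))"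
    by (intro mult_right_mono b) simp
  finally have rm: "rising_moment \<alpha> n k \<le> real (n + f) ^ f / fact f * (exp 1 * real n powr (\<alpha> * real k - real f))" .
  have "scaled_moment \<alpha> n k \<le> real (n + f) ^ f / fact f * (exp 1 * real n powr (\<alpha> * real k - real f))
      * real n powr (- (\<alpha> * real k))"
    unfolding scaled_moment_def
    using n by (intro mult_right_mono order_trans[OF rm]) auto
  also have "\<dots> = exp 1 * (real (n + f) ^ f / fact f * real n powr (- real f))"
    by (simp add: powr_add[symmetric] mult.assoc)
  also have "real (n + f) ^ f / fact f * real n powr (- real f) = (1 + real f / real n) ^ f / fact f"
    using n by (simp add: powr_minus powr_realpow field_simps flip: power_mult_distrib)
  also have "(1 + real f / real n) ^ f / fact f = \<rho> ^ f * (((1 + real f / real n) / \<rho>) ^ f / fact f)"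
    using assms by (simp add: power_divide)
  also have "((1 + real f / real n) / \<rho>) ^ f / fact f \<le> exp ((1 + real f / real n) / \<rho>)"
  proof -
    have "((1 + real f / real n) / \<rho>) ^ f / fact f = (\<Sum>i\<in>{f}. ((1 + real f / real n) / \<rho>) ^ i /\<^sub>R fact i)"
      by (simp add: divide_inverse)
    also have "\<dots> \<le> (\<Sum>i. ((1 + real f / real n) / \<rho>) ^ i /\<^sub>R fact i)"
      using assms n by (intro sum_le_suminf summable_exp_generic) auto
    finally show ?thesis by (simp add: exp_def)
  qed
  \<comment> \<open>\<open>1 / \<rho> \<le> n\<close> gives \<open>f / (n * \<rho>) \<le> f\<close>;
    the resulting \<open>exp f\<close> turns \<open>\<rho> ^ f\<close> into
    \<open>(exp 1 * \<rho>) ^ f\<close>.\<close>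
  also have "(1 + real f / real n) / \<rho> \<le> 1 / \<rho> + real f"
  proof -
    have "real f / (real n * \<rho>) \<le> real f / 1"
      using assms n by (intro divide_left_mono) (auto simp: field_simps)
    then show ?thesis by (simp add: add_divide_distrib)
  qed
  finally have "scaled_moment \<alpha> n k \<le> exp 1 * (\<rho> ^ f * exp (1 / \<rho> + real f))"
    using assms by (simp add: mult_left_mono)
  also have "\<dots> = exp (1 + 1 / \<rho>) * (exp 1 * \<rho>) ^ f"
    by (simp add: exp_add power_mult_distrib exp_of_nat_mult[of f 1, simplified])
  also have "(exp 1 * \<rho>) ^ f = (exp 1 * \<rho>) powr (real f)"
    using assms by (simp add: powr_realpow)
  also have "\<dots> \<le> (exp 1 * \<rho>) powr (\<alpha> * real k - 1)"
    using f assms by (intro powr_mono') auto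
  finally show ?thesis by (simp add: mult_left_mono)
qed

text \<open>A summable majorant in \<open>k\<close>, uniform in large \<open>n\<close>, for
  exchanging the limit in \<open>n\<close> with the power series.\<close>

lemma scaled_moment_dominated:
  assumes "0 < \<alpha>" "0 \<le> w"
  shows "\<exists>C. eventually (\<lambda>n. \<forall>k. scaled_moment \<alpha> n k * w ^ k \<le> C * (1/2) ^ k) sequentially"
proof -
  \<comment> \<open>Chosen so that \<open>r powr \<alpha> = 1 / (2 * (w + 1))\<close>: raising
    \<open>k\<close> by one then multiplies the bound by \<open>w / (2 * (w + 1))\<close>, which is
    at most \<open>1 / 2\<close>.\<close>
  define r where "r = (1 / (2 * (w + 1))) powr (1 / \<alpha>)"
  define \<rho> where "\<rho> = r / exp 1"
  have r: "0 < r" using assms by (simp add: r_def)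
  have r1: "r \<le> 1"
    unfolding r_def using assms by (intro powr_le1) (auto simp: field_simps)
  have ra: "r powr \<alpha> = 1 / (2 * (w + 1))" using assms by (simp add: r_def powr_powr)
  have \<rho>: "0 < \<rho>" "exp 1 * \<rho> = r" using r by (auto simp: \<rho>_def)
  have "eventually (\<lambda>n. \<forall>k. scaled_moment \<alpha> n k * w ^ k \<le> (exp (1 + 1 / \<rho>) / r) * (1/2) ^ k) sequentially"
    using eventually_ge_at_top[of "nat \<lceil>1 / \<rho>\<rceil>"]
  proof eventually_elim
    case (elim n)
    show ?case
    proof
      fix k
      have "scaled_moment \<alpha> n k * w ^ k \<le> (exp (1 + 1 / \<rho>) * r powr (\<alpha> * real k - 1)) * w ^ k"
        using scaled_moment_le[of \<alpha> \<rho> n k] \<rho> r1 elim assms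
        by (intro mult_right_mono) (auto simp: ceiling_le_iff nat_le_iff)
      also have "r powr (\<alpha> * real k - 1) = (1 / (2 * (w + 1))) ^ k / r"
      proof -
        have "0 < 1 / (2 * (w + 1))" using assms by simp
        then show ?thesis
          using r by (simp only: powr_diff powr_powr[symmetric] ra powr_realpow powr_one)
      qed
      also have "(exp (1 + 1 / \<rho>) * ((1 / (2 * (w + 1))) ^ k / r)) * w ^ k =
        (exp (1 + 1 / \<rho>) / r) * (w / (2 * (w + 1))) ^ k"
        by (simp add: power_divide)
      also have "\<dots> \<le> (exp (1 + 1 / \<rho>) / r) * (1/2) ^ k"
        using r assms by (intro mult_left_mono power_mono) (auto simp: field_simps)
      finally show "scaled_moment \<alpha> n k * w ^ k \<le> (exp (1 + 1 / \<rho>) / r) * (1/2) ^ k" .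
    qed
  qed
  then show ?thesis by blast
qed

section \<open>The Mittag-Leffler function as a limit of Laplace transforms\<close>

definition mittag_leffler :: "real \<Rightarrow> real \<Rightarrow> real" where
  "mittag_leffler \<alpha> z = (\<Sum>k. rGamma (1 + \<alpha> * real k) * z ^ k)"

text \<open>The geometric bound for the scaled moments passes to the limit
  \<open>n -> \<infinity>\<close> term by term.\<close>

lemma summable_mittag_leffler:
  assumes "0 < \<alpha>"
  shows "summable (\<lambda>k. norm (rGamma (1 + \<alpha> * real k) * z ^ k))"
proof -
  obtain C where C: "eventually (\<lambda>n. \<forall>k. scaled_moment \<alpha> n k * \<bar>z\<bar> ^ k \<le> C * (1/2) ^ k) sequentially"
    using scaled_moment_dominated[OF assms, of "\<bar>z\<bar>"] by auto
  have *: "rGamma (1 + \<alpha> * real k) * \<bar>z\<bar> ^ k \<le> C * (1/2) ^ k" for k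
    by (rule tendsto_upperbound[of "\<lambda>n. scaled_moment \<alpha> n k * \<bar>z\<bar> ^ k"])
       (use C in \<open>auto intro!: tendsto_intros scaled_moment_tendsto assms elim: eventually_mono\<close>)
  have "0 \<le> rGamma (1 + \<alpha> * real k)" for k
    by (rule tendsto_lowerbound[OF scaled_moment_tendsto]) (auto simp: assms scaled_moment_nonneg)
  then have "norm (norm (rGamma (1 + \<alpha> * real k) * z ^ k)) \<le> C * (1/2) ^ k" for k
    using *[of k] by (simp add: abs_mult power_abs)
  then show ?thesis
    by (rule summable_comparison_test'[of "\<lambda>k. C * (1/2) ^ k", rotated])
       (auto intro!: summable_mult summable_geometric)
qed

text \<open>The shift from \<open>j\<close> to \<open>Suc j\<close> matters: the powers
  \<open>1 / (1 - v) ^ Suc j\<close> expand in exactly the binomials \<open>(j + k) choose k\<close>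
  whose expectations are known in closed form.\<close>

definition chain_laplace :: "real \<Rightarrow> nat \<Rightarrow> real \<Rightarrow> real" where
  "chain_laplace \<alpha> n z = (\<Sum>j\<le>n. chain_prob \<alpha> n j * exp (- z * (real (Suc j) * real n powr (- \<alpha>))))"

lemma negative_binomial_series:
  fixes w :: real
  assumes "\<bar>w\<bar> < 1"
  shows "(\<lambda>k. real ((j + k) choose k) * w ^ k) sums (1 / (1 - w) ^ Suc j)"
proof -
  have "(\<lambda>k. ((- real (Suc j)) gchoose k) * (- w) ^ k) sums (1 + (- w)) powr (- real (Suc j))"
    using assms by (intro gen_binomial_real) auto
  moreover have "((- real (Suc j)) gchoose k) * (- w) ^ k = real ((j + k) choose k) * w ^ k" for k
  proof -
    have "((- real (Suc j)) gchoose k) = (-1) ^ k * (real (j + k) gchoose k)"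
      using gbinomial_negated_upper[of "- real (Suc j)" k] by (simp add: add_ac)
    also have "real (j + k) gchoose k = real ((j + k) choose k)"
      by (rule binomial_gbinomial[symmetric])
    finally show ?thesis by (simp flip: power_mult_distrib)
  qed
  moreover have "(1 + (- w)) powr (- real (Suc j)) = 1 / (1 - w) ^ Suc j"
    using assms by (simp add: powr_minus powr_realpow divide_inverse del: of_nat_Suc power_Suc)
  ultimately show ?thesis by simp
qed


text \<open>The substitution \<open>v = 1 - exp (z * n powr (- \<alpha>))\<close> turns each
  exponential into \<open>1 / (1 - v) ^ Suc j\<close>; expanding it and summing over
  \<open>j\<close> first leaves the moments. The condition \<open>\<bar>v\<bar> < 1\<close> holds
  for large \<open>n\<close> if \<alpha> > 0.\<close>

lemma chain_laplace_sums:
  assumes "0 < n" "\<bar>1 - exp (z * real n powr (- \<alpha>))\<bar> < 1"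
  shows "(\<lambda>k. scaled_moment \<alpha> n k * (real n powr \<alpha> * (1 - exp (z * real n powr (- \<alpha>)))) ^ k)
    sums chain_laplace \<alpha> n z"
proof -
  define v where "v = 1 - exp (z * real n powr (- \<alpha>))"
  have v: "\<bar>v\<bar> < 1" using assms by (simp add: v_def)
  have s: "(\<lambda>k. \<Sum>j\<le>n. chain_prob \<alpha> n j * (real ((j + k) choose k) * v ^ k)) sums
      (\<Sum>j\<le>n. chain_prob \<alpha> n j * (1 / (1 - v) ^ Suc j))"
    by (intro sums_sum sums_mult negative_binomial_series v)
  have e: "1 / (1 - v) ^ Suc j = exp (- z * (real (Suc j) * real n powr (- \<alpha>)))" for j
  proof -
    have "(1 - v) ^ Suc j = exp (real (Suc j) * (z * real n powr (- \<alpha>)))"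
      unfolding v_def exp_of_nat_mult by simp
    then show ?thesis
      by (simp only: exp_minus inverse_eq_divide mult_minus_left mult.left_commute)
  qed
  have m: "(\<Sum>j\<le>n. chain_prob \<alpha> n j * (real ((j + k) choose k) * v ^ k)) =
      scaled_moment \<alpha> n k * (real n powr \<alpha> * v) ^ k" for k
  proof -
    have "(\<Sum>j\<le>n. chain_prob \<alpha> n j * (real ((j + k) choose k) * v ^ k)) = rising_moment \<alpha> n k * v ^ k"
      unfolding chain_prob_moment[symmetric] sum_distrib_right by (simp add: mult.assoc)
    also have "\<dots> = scaled_moment \<alpha> n k * (real n powr (\<alpha> * real k) * v ^ k)"
      using assms(1) by (simp add: scaled_moment_def powr_minus)
    also have "real n powr (\<alpha> * real k) = (real n powr \<alpha>) ^ k"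
      using assms(1) by (simp add: powr_powr[symmetric] powr_realpow)
    finally show ?thesis by (simp add: power_mult_distrib)
  qed
  show ?thesis
    using s unfolding e m unfolding v_def chain_laplace_def .
qed

text \<open>The argument \<open>w n\<close> of the moment series tends to \<open>- z\<close> and the
  moments tend to the Mittag-Leffler coefficients; \<open>scaled_moment_dominated\<close> at
  \<open>z + 1\<close>, which eventually bounds \<open>\<bar>w n\<bar>\<close>, gives the majorant
  for Tannery's theorem.\<close>

lemma chain_laplace_tendsto:
  assumes "0 < \<alpha>" "0 \<le> z"
  shows "(\<lambda>n. chain_laplace \<alpha> n z) \<longlonglongrightarrow> mittag_leffler \<alpha> (- z)"
proof (cases "z = 0")
  case True
  have "mittag_leffler \<alpha> 0 = 1"
    unfolding mittag_leffler_def by (subst suminf_finite[of "{0}"]) auto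
  with True show ?thesis by (simp add: chain_laplace_def chain_prob_sum)
next
  case False
  then have z: "0 < z" using assms by simp
  define w where "w n = real n powr \<alpha> * (1 - exp (z * real n powr (- \<alpha>)))" for n
  have w: "w \<longlonglongrightarrow> - z"
    unfolding w_def using assms z by real_asymp
  have "(\<lambda>n. \<bar>1 - exp (z * real n powr (- \<alpha>))\<bar>) \<longlonglongrightarrow> 0"
    using assms z by real_asymp
  then have v1: "eventually (\<lambda>n. \<bar>1 - exp (z * real n powr (- \<alpha>))\<bar> < 1) sequentially"
    by (rule order_tendstoD) simp
  have "(\<lambda>n. \<bar>w n\<bar>) \<longlonglongrightarrow> \<bar>- z\<bar>" by (intro tendsto_intros w)
  then have w1: "eventually (\<lambda>n. \<bar>w n\<bar> < z + 1) sequentially"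
    using assms by (intro order_tendstoD) auto
  obtain C where C: "eventually (\<lambda>n. \<forall>k. scaled_moment \<alpha> n k * (z + 1) ^ k \<le> C * (1/2) ^ k) sequentially"
    using scaled_moment_dominated[of \<alpha> "z + 1"] assms by auto
  have bd: "eventually (\<lambda>n. \<forall>k. norm (scaled_moment \<alpha> n k * w n ^ k) \<le> C * (1/2) ^ k) sequentially"
    using w1 C
  proof eventually_elim
    case (elim n)
    have "norm (scaled_moment \<alpha> n k * w n ^ k) \<le> scaled_moment \<alpha> n k * (z + 1) ^ k" for k
      using elim scaled_moment_nonneg[OF assms(1), of n k]
      by (auto simp: abs_mult power_abs intro!: mult_left_mono power_mono)
    then show ?case using elim order_trans by blast
  qed
  have "((\<lambda>n. \<Sum>k. scaled_moment \<alpha> n k * w n ^ k) \<longlongrightarrow> (\<Sum>k. rGamma (1 + \<alpha> * real k) * (- z) ^ k)) sequentially"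
  proof (rule tannerys_theorem[THEN conjunct2, THEN conjunct2])
    show "((\<lambda>n. scaled_moment \<alpha> n k * w n ^ k) \<longlongrightarrow> rGamma (1 + \<alpha> * real k) * (- z) ^ k) sequentially" for k
      by (intro tendsto_intros scaled_moment_tendsto w assms)
    show "\<forall>\<^sub>F (k, n) in sequentially \<times>\<^sub>F sequentially. norm (scaled_moment \<alpha> n k * w n ^ k) \<le> C * (1/2) ^ k"
      unfolding eventually_prod_filter using bd eventually_True by fastforce
    show "summable (\<lambda>k. C * (1/2) ^ k)" by (intro summable_mult summable_geometric) auto
  qed simp
  moreover have "eventually (\<lambda>n. (\<Sum>k. scaled_moment \<alpha> n k * w n ^ k) = chain_laplace \<alpha> n z) sequentially"
    using v1 eventually_gt_at_top[of 0]
    by eventually_elim (auto simp: w_def intro!: sums_unique[symmetric] chain_laplace_sums)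
  ultimately show ?thesis
    unfolding mittag_leffler_def by (rule Lim_transform_eventually)
qed

lemma chain_laplace_bounds:
  assumes "0 < \<alpha>" "\<alpha> \<le> 1" "0 \<le> z"
  shows "0 \<le> chain_laplace \<alpha> n z" "chain_laplace \<alpha> n z \<le> 1"
proof -
  show "0 \<le> chain_laplace \<alpha> n z"
    unfolding chain_laplace_def using assms
    by (intro sum_nonneg mult_nonneg_nonneg chain_prob_nonneg) auto
  have "chain_laplace \<alpha> n z \<le> (\<Sum>j\<le>n. chain_prob \<alpha> n j * 1)"
    unfolding chain_laplace_def using assms
    by (intro sum_mono mult_left_mono chain_prob_nonneg) auto
  then show "chain_laplace \<alpha> n z \<le> 1" by (simp add: chain_prob_sum)
qed

text \<open>Second moment method. Eventually the first moment exceeds \<open>3 * g / 4\<close> and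
  the second stays below \<open>M\<close>. Values below \<open>A = g / 4\<close> and above
  \<open>B = 4 * M / g\<close> contribute at most \<open>g / 4\<close> each to the first moment, so
  at least \<open>g / 4\<close> of it comes from \<open>[A, B]\<close>, whose mass is then at least
  \<open>g / (4 * B)\<close>.\<close>

lemma chain_prob_concentration:
  assumes "0 < \<alpha>" "\<alpha> \<le> 1"
  shows "\<exists>A>0. \<exists>B>0. \<exists>c>0. eventually (\<lambda>n. c \<le> (\<Sum>j | j \<le> n \<and> A \<le> real (Suc j) * real n powr (- \<alpha>) \<and>
     real (Suc j) * real n powr (- \<alpha>) \<le> B. chain_prob \<alpha> n j)) sequentially"
proof -
  define g where "g = rGamma (1 + \<alpha>)"
  define M where "M = 2 * rGamma (1 + \<alpha> * 2) + 1"
  have g: "0 < g" unfolding g_def using assms by (intro rGamma_real_pos) simp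
  have M: "0 < M" using assms rGamma_real_pos[of "1 + \<alpha> * 2"] by (simp add: M_def)
  define A where "A = g / 4"
  define B where "B = 4 * M / g"
  have AB: "0 < A" "0 < B" using g M by (auto simp: A_def B_def)
  have "(\<lambda>n. scaled_moment \<alpha> n 1) \<longlonglongrightarrow> g"
    using scaled_moment_tendsto[of \<alpha> 1] assms by (simp add: g_def)
  then have 1: "eventually (\<lambda>n. 3 * g / 4 < scaled_moment \<alpha> n 1) sequentially"
    using g by (intro order_tendstoD) auto
  have "(\<lambda>n. 2 * scaled_moment \<alpha> n 2) \<longlonglongrightarrow> 2 * rGamma (1 + \<alpha> * 2)"
    using scaled_moment_tendsto[of \<alpha> 2] assms by (intro tendsto_intros) simp
  then have 2: "eventually (\<lambda>n. 2 * scaled_moment \<alpha> n 2 < M) sequentially"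
    by (rule order_tendstoD) (simp add: M_def)
  have "eventually (\<lambda>n. g / (4 * B) \<le> (\<Sum>j | j \<le> n \<and> A \<le> real (Suc j) * real n powr (- \<alpha>) \<and>
     real (Suc j) * real n powr (- \<alpha>) \<le> B. chain_prob \<alpha> n j)) sequentially"
    using 1 2 eventually_gt_at_top[of 0]
  proof eventually_elim
    case (elim n)
    define \<Theta> where "\<Theta> j = real (Suc j) * real n powr (- \<alpha>)" for j
    define p where "p = chain_prob \<alpha> n"
    have p: "0 \<le> p j" for j using assms by (simp add: p_def chain_prob_nonneg)
    have \<Theta>: "0 \<le> \<Theta> j" for j by (simp add: \<Theta>_def)
    have m1: "(\<Sum>j\<le>n. p j * \<Theta> j) = scaled_moment \<alpha> n 1"
      unfolding scaled_moment_def chain_prob_moment[symmetric]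
      by (simp add: p_def \<Theta>_def sum_distrib_right mult.assoc add.commute)
    have m2: "(\<Sum>j\<le>n. p j * (\<Theta> j)\<^sup>2) \<le> 2 * scaled_moment \<alpha> n 2"
    proof -
      have T: "(\<Theta> j)\<^sup>2 \<le> 2 * (real ((j + 2) choose 2) * real n powr (- (\<alpha> * real 2)))" for j
      proof -
        have "(j + 2) choose 2 = (j + 2) * (j + 1) div 2" by (simp add: choose_two)
        moreover have "even ((j + 2) * (j + 1))" by simp
        ultimately have d: "2 * ((j + 2) choose 2) = (j + 2) * (j + 1)" by simp
        have c: "2 * real ((j + 2) choose 2) = (real j + 2) * (real j + 1)"
          using arg_cong[OF d, of real]
          by (simp only: of_nat_mult of_nat_add of_nat_1 of_nat_numeral)
        have "(\<Theta> j)\<^sup>2 = (real j + 1)\<^sup>2 * (real n powr (- \<alpha>))\<^sup>2"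
          by (simp add: \<Theta>_def power_mult_distrib add.commute)
        also have "(real n powr (- \<alpha>))\<^sup>2 = real n powr (- (\<alpha> * real 2))"
          by (simp add: power2_eq_square powr_add[symmetric] mult.commute)
        also have "(real j + 1)\<^sup>2 \<le> (real j + 2) * (real j + 1)"
          by (simp add: power2_eq_square)
        finally show ?thesis unfolding mult.assoc[symmetric] c by (simp add: mult_right_mono)
      qed
      have "(\<Sum>j\<le>n. p j * (\<Theta> j)\<^sup>2) \<le>
          (\<Sum>j\<le>n. p j * (2 * (real ((j + 2) choose 2) * real n powr (- (\<alpha> * real 2)))))"
        by (intro sum_mono mult_left_mono p T)
      also have "\<dots> = 2 * scaled_moment \<alpha> n 2"
        unfolding scaled_moment_def chain_prob_moment[symmetric]
        by (simp only: p_def sum_distrib_right sum_distrib_left mult_ac)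
      finally show ?thesis .
    qed
    define S where "S = {j. j \<le> n \<and> A \<le> \<Theta> j \<and> \<Theta> j \<le> B}"
    have S: "S \<subseteq> {..n}" by (auto simp: S_def)
    have "p j * \<Theta> j \<le> p j * A + (if j \<in> S then p j * B else 0) + p j * (\<Theta> j)\<^sup>2 / B" if "j \<le> n" for j
    proof -
      have "\<Theta> j \<le> A + (if j \<in> S then B else 0) + (\<Theta> j)\<^sup>2 / B"
      proof (cases "\<Theta> j \<le> B")
        case True
        have z: "0 \<le> (\<Theta> j)\<^sup>2 / B" using AB by simp
        have "j \<notin> S \<Longrightarrow> \<Theta> j < A" using True that by (auto simp: S_def)
        then show ?thesis using True AB z by (cases "j \<in> S") (simp_all add: add_increasing2)
      next
        case False
        then have "\<Theta> j * B \<le> (\<Theta> j)\<^sup>2" using \<Theta>[of j] by (simp add: power2_eq_square mult_left_mono)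
        then have "\<Theta> j \<le> (\<Theta> j)\<^sup>2 / B" using AB by (simp add: pos_le_divide_eq)
        then show ?thesis using AB by auto
      qed
      then have "p j * \<Theta> j \<le> p j * (A + (if j \<in> S then B else 0) + (\<Theta> j)\<^sup>2 / B)"
        by (intro mult_left_mono p)
      then show ?thesis by (simp add: algebra_simps split: if_splits)
    qed
    then have "(\<Sum>j\<le>n. p j * \<Theta> j) \<le> (\<Sum>j\<le>n. p j * A + (if j \<in> S then p j * B else 0) + p j * (\<Theta> j)\<^sup>2 / B)"
      by (intro sum_mono) auto
    also have "\<dots> = A + (\<Sum>j\<in>S. p j) * B + (\<Sum>j\<le>n. p j * (\<Theta> j)\<^sup>2) / B"
    proof -
      have "(\<Sum>j\<le>n. if j \<in> S then p j * B else 0) = (\<Sum>j\<in>S. p j * B)"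
        using S by (subst sum.inter_restrict[symmetric]) (auto simp: Int_absorb1)
      moreover have "(\<Sum>j\<le>n. p j * A) = A"
        using chain_prob_sum[of \<alpha> n] by (simp add: p_def flip: sum_distrib_right)
      ultimately show ?thesis by (simp add: sum.distrib sum_distrib_right sum_divide_distrib)
    qed
    also have "\<dots> \<le> A + (\<Sum>j\<in>S. p j) * B + M / B"
      using m2 elim AB by (intro add_left_mono divide_right_mono) auto
    finally have "3 * g / 4 \<le> g / 4 + (\<Sum>j\<in>S. p j) * B + g / 4"
      using m1 elim g M by (simp add: A_def B_def)
    then have "g / (4 * B) \<le> (\<Sum>j\<in>S. p j)"
      using AB by (simp add: field_simps)
    then show ?case by (simp add: S_def p_def \<Theta>_def)
  qed
  moreover have "0 < g / (4 * B)" using g AB by simp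
  ultimately show ?thesis using AB by blast
qed

section \<open>The fractional relaxation equation\<close>

text \<open>Extended by zero to the whole line, so that the fractional integral becomes a
  convolution to which Tonelli's theorem on \<open>lborel\<close> applies.\<close>

definition frac_kernel :: "real \<Rightarrow> real \<Rightarrow> real" where
  "frac_kernel \<alpha> r = (if 0 < r then r powr (\<alpha> - 1) / Gamma \<alpha> else 0)"

lemma frac_kernel_nonneg: "0 < \<alpha> \<Longrightarrow> 0 \<le> frac_kernel \<alpha> r"
  by (auto simp: frac_kernel_def intro!: divide_nonneg_pos Gamma_real_pos)

lemma frac_kernel_measurable [measurable]: "frac_kernel \<alpha> \<in> borel_measurable borel"
  unfolding frac_kernel_def by measurable

lemma frac_kernel_laplace:
  assumes "0 < \<alpha>" "0 < \<sigma>"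
  shows "(\<integral>\<^sup>+r. ennreal (exp (- \<sigma> * r) * frac_kernel \<alpha> r) \<partial>lborel) = ennreal (\<sigma> powr (- \<alpha>))"
proof -
  define f where "f t = indicator {0..} t * t powr (\<alpha> - 1) / exp t" for t :: real
  have [measurable]: "f \<in> borel_measurable borel" unfolding f_def by measurable
  have G: "0 < Gamma \<alpha>" using assms by (simp add: Gamma_real_pos)
  have f0: "0 \<le> f t" for t by (simp add: f_def)
  define c where "c = \<sigma> powr (- \<alpha>) * \<sigma> / Gamma \<alpha>"
  have c: "0 \<le> c" using assms G by (simp add: c_def)
  have "exp (- \<sigma> * r) * frac_kernel \<alpha> r = c * f (\<sigma> * r)" for r
  proof (cases "0 < r")
    case True
    then have "f (\<sigma> * r) = \<sigma> powr (\<alpha> - 1) * r powr (\<alpha> - 1) * exp (- \<sigma> * r)"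
      using assms by (simp add: f_def powr_mult exp_minus field_simps)
    moreover have "\<sigma> powr (- \<alpha>) * \<sigma> * \<sigma> powr (\<alpha> - 1) = 1"
      using assms by (simp add: powr_diff powr_minus)
    ultimately show ?thesis
      using True G by (simp add: frac_kernel_def c_def mult_ac)
  next
    case False
    then have "f (\<sigma> * r) = 0"
      using assms by (cases "r = 0") (auto simp: f_def zero_le_mult_iff)
    then show ?thesis using False by (simp add: frac_kernel_def)
  qed
  then have "(\<integral>\<^sup>+r. ennreal (exp (- \<sigma> * r) * frac_kernel \<alpha> r) \<partial>lborel) = (\<integral>\<^sup>+r. ennreal c * ennreal (f (\<sigma> * r)) \<partial>lborel)"
    using c f0 by (simp add: ennreal_mult)
  also have "\<dots> = ennreal c * (\<integral>\<^sup>+r. ennreal (f (\<sigma> * r)) \<partial>lborel)"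
    by (rule nn_integral_cmult) measurable
  also have "ennreal c = ennreal (\<sigma> powr (- \<alpha>) / Gamma \<alpha>) * ennreal \<sigma>"
    using assms G by (simp add: c_def flip: ennreal_mult)
  also have "ennreal (\<sigma> powr (- \<alpha>) / Gamma \<alpha>) * ennreal \<sigma> * (\<integral>\<^sup>+r. ennreal (f (\<sigma> * r)) \<partial>lborel)
     = ennreal (\<sigma> powr (- \<alpha>) / Gamma \<alpha>) * (\<integral>\<^sup>+r. ennreal (f r) \<partial>lborel)"
    using assms nn_integral_real_affine[of "\<lambda>x. ennreal (f x)" \<sigma> 0] by (simp add: mult.assoc)
  also have "(\<integral>\<^sup>+r. ennreal (f r) \<partial>lborel) = ennreal (Gamma \<alpha>)"
    using Gamma_conv_nn_integral_real[OF assms(1)] by (simp add: f_def)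
  also have "ennreal (\<sigma> powr (- \<alpha>) / Gamma \<alpha>) * ennreal (Gamma \<alpha>) = ennreal (\<sigma> powr (- \<alpha>))"
    using G by (simp flip: ennreal_mult)
  finally show ?thesis .
qed

text \<open>In the norm with weight \<open>exp (- \<sigma> t)\<close> the fractional integral has norm at most
  \<open>\<sigma> powr (- \<alpha>)\<close>, so for large \<open>\<sigma>\<close> the Volterra inequality is a contraction.\<close>

lemma volterra_zero:
  fixes z :: "real \<Rightarrow> real"
  assumes "0 < \<alpha>" "0 < \<kappa>" and [measurable]: "z \<in> borel_measurable borel"
    and int: "integrable lborel z" and z0: "\<And>t. t \<le> 0 \<Longrightarrow> z t = 0"
    and le: "AE t in lborel. ennreal \<bar>z t\<bar> \<le> ennreal \<kappa> * (\<integral>\<^sup>+s. ennreal (frac_kernel \<alpha> (t - s) * \<bar>z s\<bar>) \<partial>lborel)"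
  shows "AE t in lborel. z t = 0"
proof -
  define \<sigma> where "\<sigma> = (2 * \<kappa>) powr (1 / \<alpha>)"
  have \<sigma>: "0 < \<sigma>" using assms by (simp add: \<sigma>_def)
  have \<sigma>\<alpha>: "\<kappa> * \<sigma> powr (- \<alpha>) = 1 / 2" using assms by (simp add: \<sigma>_def powr_powr powr_minus)
  define I where "I = (\<integral>\<^sup>+t. ennreal (exp (- \<sigma> * t) * \<bar>z t\<bar>) \<partial>lborel)"
  \<comment> \<open>Finiteness of \<open>I\<close> is what makes the final
    \<open>I \<le> I / 2\<close> conclusive. The weight may exceed 1 only for negative
    \<open>t\<close>, where \<open>z\<close> vanishes.\<close>
  have "I \<le> (\<integral>\<^sup>+t. ennreal (norm (z t)) \<partial>lborel)"
    unfolding I_def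
  proof (intro nn_integral_mono ennreal_leI)
    fix t show "exp (- \<sigma> * t) * \<bar>z t\<bar> \<le> norm (z t)"
      using \<sigma> z0[of t] by (cases "t \<le> 0") (auto intro!: mult_left_le_one_le)
  qed
  also have "\<dots> < \<infinity>" using int by (simp add: integrable_iff_bounded)
  finally have fin: "I < \<infinity>" .
  have "I \<le> (\<integral>\<^sup>+t. ennreal (exp (- \<sigma> * t)) * (ennreal \<kappa> * (\<integral>\<^sup>+s. ennreal (frac_kernel \<alpha> (t - s) * \<bar>z s\<bar>) \<partial>lborel)) \<partial>lborel)"
    unfolding I_def using le
    by (intro nn_integral_mono_AE) (auto simp: ennreal_mult intro!: mult_left_mono)
  also have "\<dots> = ennreal \<kappa> * (\<integral>\<^sup>+t. (\<integral>\<^sup>+s. ennreal (exp (- \<sigma> * t) * (frac_kernel \<alpha> (t - s) * \<bar>z s\<bar>)) \<partial>lborel) \<partial>lborel)"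
    using assms(1) frac_kernel_nonneg
    by (simp add: ennreal_mult nn_integral_cmult[symmetric] mult_ac)
  also have "(\<integral>\<^sup>+t. (\<integral>\<^sup>+s. ennreal (exp (- \<sigma> * t) * (frac_kernel \<alpha> (t - s) * \<bar>z s\<bar>)) \<partial>lborel) \<partial>lborel)
      = (\<integral>\<^sup>+s. (\<integral>\<^sup>+t. ennreal (exp (- \<sigma> * t) * (frac_kernel \<alpha> (t - s) * \<bar>z s\<bar>)) \<partial>lborel) \<partial>lborel)"
    by (rule lborel_pair.Fubini') measurable
  also have "\<dots> = (\<integral>\<^sup>+s. ennreal (exp (- \<sigma> * s) * \<bar>z s\<bar>) * ennreal (\<sigma> powr (- \<alpha>)) \<partial>lborel)"
  proof (rule nn_integral_cong)
    fix s
    have "(\<integral>\<^sup>+t. ennreal (exp (- \<sigma> * t) * (frac_kernel \<alpha> (t - s) * \<bar>z s\<bar>)) \<partial>lborel)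
      = (\<integral>\<^sup>+t. ennreal (exp (- \<sigma> * s) * \<bar>z s\<bar>) * ennreal (exp (- \<sigma> * (t - s)) * frac_kernel \<alpha> (t - s)) \<partial>lborel)"
    proof (rule nn_integral_cong)
      fix t
      have "exp (- \<sigma> * t) = exp (- \<sigma> * s) * exp (- \<sigma> * (t - s))"
        by (simp add: exp_add[symmetric] algebra_simps)
      then have "exp (- \<sigma> * t) * (frac_kernel \<alpha> (t - s) * \<bar>z s\<bar>) =
          (exp (- \<sigma> * s) * \<bar>z s\<bar>) * (exp (- \<sigma> * (t - s)) * frac_kernel \<alpha> (t - s))"
        by (simp only: mult_ac)
      then have "ennreal (exp (- \<sigma> * t) * (frac_kernel \<alpha> (t - s) * \<bar>z s\<bar>)) =
          ennreal ((exp (- \<sigma> * s) * \<bar>z s\<bar>) * (exp (- \<sigma> * (t - s)) * frac_kernel \<alpha> (t - s)))"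
        by (rule arg_cong)
      also have "\<dots> = ennreal (exp (- \<sigma> * s) * \<bar>z s\<bar>) * ennreal (exp (- \<sigma> * (t - s)) * frac_kernel \<alpha> (t - s))"
        using frac_kernel_nonneg[OF assms(1)] by (intro ennreal_mult) auto
      finally show "ennreal (exp (- \<sigma> * t) * (frac_kernel \<alpha> (t - s) * \<bar>z s\<bar>)) =
          ennreal (exp (- \<sigma> * s) * \<bar>z s\<bar>) * ennreal (exp (- \<sigma> * (t - s)) * frac_kernel \<alpha> (t - s))" .
    qed
    also have "\<dots> = ennreal (exp (- \<sigma> * s) * \<bar>z s\<bar>) * (\<integral>\<^sup>+t. ennreal (exp (- \<sigma> * (t - s)) * frac_kernel \<alpha> (t - s)) \<partial>lborel)"
      by (rule nn_integral_cmult) measurable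
    also have "(\<integral>\<^sup>+t. ennreal (exp (- \<sigma> * (t - s)) * frac_kernel \<alpha> (t - s)) \<partial>lborel) = ennreal (\<sigma> powr (- \<alpha>))"
      using nn_integral_real_affine[of "\<lambda>r. ennreal (exp (- \<sigma> * r) * frac_kernel \<alpha> r)" 1 "- s"]
        frac_kernel_laplace[OF assms(1) \<sigma>] by simp
    finally show "(\<integral>\<^sup>+t. ennreal (exp (- \<sigma> * t) * (frac_kernel \<alpha> (t - s) * \<bar>z s\<bar>)) \<partial>lborel)
      = ennreal (exp (- \<sigma> * s) * \<bar>z s\<bar>) * ennreal (\<sigma> powr (- \<alpha>))" .
  qed
  also have "\<dots> = I * ennreal (\<sigma> powr (- \<alpha>))"
    unfolding I_def by (rule nn_integral_multc) measurable
  also have "ennreal \<kappa> * (I * ennreal (\<sigma> powr (- \<alpha>))) = I * ennreal (1 / 2)"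
    using assms(2) by (subst \<sigma>\<alpha>[symmetric]) (simp add: ennreal_mult mult_ac)
  finally have half: "I \<le> I * ennreal (1 / 2)" .
  obtain i where i: "I = ennreal i" "0 \<le> i" using fin by (cases I) auto
  have "ennreal i * ennreal (1 / 2) = ennreal (i * (1 / 2))"
    by (rule ennreal_mult[symmetric]) (use i in auto)
  then have "ennreal i \<le> ennreal (i * (1 / 2))"
    using half unfolding i(1) by (simp only:)
  then have "i \<le> i * (1 / 2)" using i by (subst (asm) ennreal_le_iff) auto
  then have "I = 0" using i by simp
  then have "AE t in lborel. ennreal (exp (- \<sigma> * t) * \<bar>z t\<bar>) = 0"
    unfolding I_def by (subst (asm) nn_integral_0_iff_AE) auto
  then show ?thesis
    by eventually_elim (auto simp: ennreal_eq_0_iff mult_le_0_iff)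
qed

text \<open>Euler's Beta integral, rescaled from \<open>[0, 1]\<close> to \<open>[0, t]\<close>.
  Nonnegativity of the integrand turns the gauge integral into a Lebesgue integral.\<close>

lemma frac_integral_powr:
  fixes \<alpha> \<beta> t :: real
  assumes "0 < \<alpha>" "0 \<le> \<beta>" "0 < t"
  shows "has_bochner_integral (lebesgue_on {0<..<t}) (\<lambda>s. (t - s) powr (\<alpha> - 1) / Gamma \<alpha> * s powr \<beta>)
    (Gamma (\<beta> + 1) / Gamma (\<beta> + 1 + \<alpha>) * t powr (\<beta> + \<alpha>))"
proof -
  have G: "Gamma \<alpha> > 0" using assms by (simp add: Gamma_real_pos)
  then have G0: "Gamma \<alpha> \<noteq> 0" by linarith
  have "((\<lambda>x. (1 / t * x) powr (\<beta> + 1 - 1) * (1 - 1 / t * x) powr (\<alpha> - 1)) has_integral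
      (1 / \<bar>1 / t\<bar>) *\<^sub>R Beta (\<beta> + 1) \<alpha>) ((\<lambda>x. x / (1 / t)) ` {0..1})"
    using assms by (intro has_integral_stretch_real has_integral_Beta_real) auto
  moreover have "(\<lambda>x. x / (1 / t)) ` {0..1} = {0..t}"
  proof -
    have "(\<lambda>x. x / (1 / t)) ` {0..1} = (\<lambda>x. t * x) ` {0..1}" by (simp add: mult.commute)
    also have "\<dots> = {0..t}" using assms image_mult_atLeastAtMost[of t 0 1] by simp
    finally show ?thesis .
  qed
  ultimately have "((\<lambda>x. (x / t) powr \<beta> * (1 - x / t) powr (\<alpha> - 1)) has_integral t * Beta (\<beta> + 1) \<alpha>) {0<..<t}"
    using assms by (simp add: has_integral_Icc_iff_Ioo)
  then have "((\<lambda>x. (t powr (\<beta> + \<alpha> - 1) / Gamma \<alpha>) * ((x / t) powr \<beta> * (1 - x / t) powr (\<alpha> - 1))) has_integral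
     (t powr (\<beta> + \<alpha> - 1) / Gamma \<alpha>) * (t * Beta (\<beta> + 1) \<alpha>)) {0<..<t}"
    by (rule has_integral_mult_right)
  moreover have "(t powr (\<beta> + \<alpha> - 1) / Gamma \<alpha>) * (t * Beta (\<beta> + 1) \<alpha>) =
      Gamma (\<beta> + 1) / Gamma (\<beta> + 1 + \<alpha>) * t powr (\<beta> + \<alpha>)"
    using assms by (simp add: Beta_def powr_diff G0)
  moreover have "(t powr (\<beta> + \<alpha> - 1) / Gamma \<alpha>) * ((s / t) powr \<beta> * (1 - s / t) powr (\<alpha> - 1))
     = (t - s) powr (\<alpha> - 1) / Gamma \<alpha> * s powr \<beta>" if "s \<in> {0<..<t}" for s
  proof -
    have "1 - s / t = (t - s) / t" using assms by (simp add: diff_divide_distrib)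
    then have "(s / t) powr \<beta> * (1 - s / t) powr (\<alpha> - 1) = s powr \<beta> * (t - s) powr (\<alpha> - 1) / (t powr \<beta> * t powr (\<alpha> - 1))"
      using that by (simp add: powr_divide)
    also have "t powr \<beta> * t powr (\<alpha> - 1) = t powr (\<beta> + \<alpha> - 1)"
      by (simp add: powr_add[symmetric] add_diff_eq)
    finally show ?thesis using assms by simp
  qed
  ultimately have hi: "((\<lambda>s. (t - s) powr (\<alpha> - 1) / Gamma \<alpha> * s powr \<beta>) has_integral
      Gamma (\<beta> + 1) / Gamma (\<beta> + 1 + \<alpha>) * t powr (\<beta> + \<alpha>)) {0<..<t}"
    by (metis (no_types, lifting) has_integral_eq)
  have "(\<lambda>s. (t - s) powr (\<alpha> - 1) / Gamma \<alpha> * s powr \<beta>) absolutely_integrable_on {0<..<t}"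
    using hi G by (intro nonnegative_absolutely_integrable_1) (auto intro!: mult_nonneg_nonneg)
  then have int: "integrable (lebesgue_on {0<..<t}) (\<lambda>s. (t - s) powr (\<alpha> - 1) / Gamma \<alpha> * s powr \<beta>)"
    by (simp add: set_integrable_def integrable_restrict_space)
  then have "integral\<^sup>L (lebesgue_on {0<..<t}) (\<lambda>s. (t - s) powr (\<alpha> - 1) / Gamma \<alpha> * s powr \<beta>)
     = Gamma (\<beta> + 1) / Gamma (\<beta> + 1 + \<alpha>) * t powr (\<beta> + \<alpha>)"
    by (intro trans[OF lebesgue_integral_eq_integral integral_unique[OF hi]]) simp_all
  with int show ?thesis by (simp add: has_bochner_integral_iff)
qed

text \<open>Fractional integration sends term \<open>k\<close> of the series to term
  \<open>k + 1\<close> divided by \<open>- \<kappa>\<close>, so only the constant term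
  \<open>c 0 = 1\<close> is left over. Sum and integral may be exchanged because the integrals of
  the absolute values form, up to a factor, the series at \<open>+ \<kappa>\<close>, which
  converges.\<close>

lemma mittag_leffler_volterra:
  assumes "0 < \<alpha>" "0 < \<kappa>" "0 < t"
  shows "integrable (lebesgue_on {0<..<t}) (\<lambda>s. (t - s) powr (\<alpha> - 1) / Gamma \<alpha> * mittag_leffler \<alpha> (- \<kappa> * s powr \<alpha>))"
    and "mittag_leffler \<alpha> (- \<kappa> * t powr \<alpha>) =
      1 - \<kappa> * (LINT s|lebesgue_on {0<..<t}. (t - s) powr (\<alpha> - 1) / Gamma \<alpha> * mittag_leffler \<alpha> (- \<kappa> * s powr \<alpha>))"
proof -
  define c where "c k = rGamma (1 + \<alpha> * real k)" for k
  have c: "0 < c k" for k using assms by (auto simp: c_def intro!: rGamma_real_pos add_pos_nonneg)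
  define f where "f k s = (t - s) powr (\<alpha> - 1) / Gamma \<alpha> * (c k * (- \<kappa> * s powr \<alpha>) ^ k)" for k s
  have G: "Gamma \<alpha> > 0" using assms by (simp add: Gamma_real_pos)
  have *: "has_bochner_integral (lebesgue_on {0<..<t}) (\<lambda>s. (t - s) powr (\<alpha> - 1) / Gamma \<alpha> * (c k * (x * s powr \<alpha>) ^ k))
     (c (Suc k) * x ^ k * (t powr \<alpha>) ^ Suc k)" for x k
  proof -
    have "has_bochner_integral (lebesgue_on {0<..<t}) (\<lambda>s. (c k * x ^ k) * ((t - s) powr (\<alpha> - 1) / Gamma \<alpha> * s powr (\<alpha> * real k)))
      ((c k * x ^ k) * (Gamma (\<alpha> * real k + 1) / Gamma (\<alpha> * real k + 1 + \<alpha>) * t powr (\<alpha> * real k + \<alpha>)))"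
      using assms by (intro has_bochner_integral_mult_right frac_integral_powr) auto
    moreover have "(c k * x ^ k) * (Gamma (\<alpha> * real k + 1) / Gamma (\<alpha> * real k + 1 + \<alpha>) * t powr (\<alpha> * real k + \<alpha>))
      = c (Suc k) * x ^ k * (t powr \<alpha>) ^ Suc k"
    proof -
      have "c k * Gamma (\<alpha> * real k + 1) = 1"
        using c[of k] by (simp add: c_def rGamma_inverse_Gamma add.commute)
      moreover have "1 / Gamma (\<alpha> * real k + 1 + \<alpha>) = c (Suc k)"
        by (simp add: c_def rGamma_inverse_Gamma algebra_simps inverse_eq_divide)
      moreover have "t powr (\<alpha> * real k + \<alpha>) = (t powr \<alpha>) ^ Suc k"
        using assms by (simp add: powr_add powr_powr[symmetric] powr_realpow)
      moreover have "(c k * x ^ k) * (Gamma (\<alpha> * real k + 1) / Gamma (\<alpha> * real k + 1 + \<alpha>) * t powr (\<alpha> * real k + \<alpha>))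
        = (c k * Gamma (\<alpha> * real k + 1)) * (1 / Gamma (\<alpha> * real k + 1 + \<alpha>)) * x ^ k * t powr (\<alpha> * real k + \<alpha>)"
        by simp
      ultimately show ?thesis by simp
    qed
    moreover have "(c k * x ^ k) * ((t - s) powr (\<alpha> - 1) / Gamma \<alpha> * s powr (\<alpha> * real k)) =
      (t - s) powr (\<alpha> - 1) / Gamma \<alpha> * (c k * (x * s powr \<alpha>) ^ k)" if "s \<in> {0<..<t}" for s
      using that by (simp add: power_mult_distrib powr_powr[symmetric] powr_realpow)
    ultimately show ?thesis
      by (subst has_bochner_integral_cong[OF refl _ refl, symmetric]) auto
  qed
  have f: "has_bochner_integral (lebesgue_on {0<..<t}) (f k) (c (Suc k) * (- \<kappa>) ^ k * (t powr \<alpha>) ^ Suc k)" for k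
    unfolding f_def by (rule *)
  have nf: "norm (f k s) = (t - s) powr (\<alpha> - 1) / Gamma \<alpha> * (c k * (\<kappa> * s powr \<alpha>) ^ k)" for k s
    using G c[of k] assms by (simp add: f_def abs_mult power_abs)
  have fint: "integrable (lebesgue_on {0<..<t}) (f k)" for k
    using f has_bochner_integral_iff by blast
  have nint: "(LINT s|lebesgue_on {0<..<t}. norm (f k s)) = c (Suc k) * \<kappa> ^ k * (t powr \<alpha>) ^ Suc k" for k
    unfolding nf using * has_bochner_integral_iff by blast
  have sm: "summable (\<lambda>k. c k * x ^ k)" for x
    using summable_mittag_leffler[OF assms(1), of x] unfolding c_def by (rule summable_norm_cancel)
  have smS: "summable (\<lambda>k. c (Suc k) * x ^ Suc k)" for x
    by (rule iffD2[OF summable_Suc_iff[of "\<lambda>k. c k * x ^ k"] sm])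
  have sfs: "summable (\<lambda>k. norm (f k s))" for s
    unfolding nf by (intro summable_mult sm)
  have fsuminf: "(\<Sum>k. f k s) = (t - s) powr (\<alpha> - 1) / Gamma \<alpha> * mittag_leffler \<alpha> (- \<kappa> * s powr \<alpha>)" for s
    unfolding f_def mittag_leffler_def c_def[symmetric] by (rule suminf_mult[OF sm])
  have "summable (\<lambda>k. c (Suc k) * (\<kappa> * t powr \<alpha>) ^ Suc k / \<kappa>)"
    by (intro summable_divide smS)
  then have snorm: "summable (\<lambda>k. LINT s|lebesgue_on {0<..<t}. norm (f k s))"
    unfolding nint using assms by (simp add: power_mult_distrib mult_ac)
  show "integrable (lebesgue_on {0<..<t}) (\<lambda>s. (t - s) powr (\<alpha> - 1) / Gamma \<alpha> * mittag_leffler \<alpha> (- \<kappa> * s powr \<alpha>))"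
    unfolding fsuminf[symmetric] by (rule integrable_suminf[OF fint AE_I2[OF sfs] snorm])
  have "(LINT s|lebesgue_on {0<..<t}. (t - s) powr (\<alpha> - 1) / Gamma \<alpha> * mittag_leffler \<alpha> (- \<kappa> * s powr \<alpha>))
    = (\<Sum>k. (- 1 / \<kappa>) * (c (Suc k) * (- \<kappa> * t powr \<alpha>) ^ Suc k))"
    unfolding fsuminf[symmetric] integral_suminf[OF fint AE_I2[OF sfs] snorm]
  proof (rule suminf_cong)
    fix k
    have "(LINT s|lebesgue_on {0<..<t}. f k s) = c (Suc k) * (- \<kappa>) ^ k * (t powr \<alpha>) ^ Suc k"
      using f has_bochner_integral_iff by blast
    also have "\<dots> = (- 1 / \<kappa>) * (c (Suc k) * (- \<kappa> * t powr \<alpha>) ^ Suc k)"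
      using assms(2) unfolding power_mult_distrib by simp
    finally show "(LINT s|lebesgue_on {0<..<t}. f k s) = (- 1 / \<kappa>) * (c (Suc k) * (- \<kappa> * t powr \<alpha>) ^ Suc k)" .
  qed
  also have "\<dots> = (- 1 / \<kappa>) * (\<Sum>k. c (Suc k) * (- \<kappa> * t powr \<alpha>) ^ Suc k)"
    by (rule suminf_mult[OF smS])
  also have "(\<Sum>k. c (Suc k) * (- \<kappa> * t powr \<alpha>) ^ Suc k) = mittag_leffler \<alpha> (- \<kappa> * t powr \<alpha>) - c 0"
    unfolding mittag_leffler_def c_def[symmetric] using suminf_split_head[OF sm, of "- \<kappa> * t powr \<alpha>"] by (simp only: power_0 mult_1_right)
  also have "c 0 = 1" by (simp add: c_def)
  finally show "mittag_leffler \<alpha> (- \<kappa> * t powr \<alpha>) =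
      1 - \<kappa> * (LINT s|lebesgue_on {0<..<t}. (t - s) powr (\<alpha> - 1) / Gamma \<alpha> * mittag_leffler \<alpha> (- \<kappa> * s powr \<alpha>))"
    using assms(2) by simp
qed

lemma continuous_mittag_leffler:
  assumes "0 < \<alpha>"
  shows "continuous_on UNIV (mittag_leffler \<alpha>)"
proof -
  have "isCont (\<lambda>x. \<Sum>n. rGamma (1 + \<alpha> * real n) * x ^ n) x" for x
    by (rule isCont_powser[where K = "\<bar>x\<bar> + 1"])
       (use summable_norm_cancel[OF summable_mittag_leffler[OF assms]] in auto)
  then show ?thesis
    unfolding mittag_leffler_def[abs_def] by (simp add: continuous_at_imp_continuous_on)
qed

text \<open>Both bounds are those of Laplace transforms of probability laws on the positive
  half-line, inherited from \<open>chain_laplace\<close>.\<close>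

lemma mittag_leffler_bounds:
  assumes "0 < \<alpha>" "\<alpha> \<le> 1" "0 \<le> z"
  shows "0 \<le> mittag_leffler \<alpha> (- z)" "mittag_leffler \<alpha> (- z) \<le> 1"
  using tendsto_lowerbound[OF chain_laplace_tendsto[OF assms(1,3)], of 0]
    tendsto_upperbound[OF chain_laplace_tendsto[OF assms(1,3)], of 1] chain_laplace_bounds[OF assms]
  by (simp_all add: always_eventually)

section \<open>The finite Jacobi triple product and the Dirichlet heat kernel\<close>

text \<open>Weierstrass's inequality bounds such a product below by one minus the sum of the powers,
  which helps only where that sum is small. So the first \<open>K\<close> factors, with
  \<open>K\<close> making the tail sum less than \<open>1 / 2\<close>, are kept as a fixed positive
  number. Uniformity in \<open>M\<close> and in \<open>r \<le> q\<close> is essential, since the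
  truncation and the time both vary later.\<close>

lemma prod_one_minus_power_bound:
  fixes q :: real
  assumes "0 \<le> q" "q < 1"
  shows "\<exists>c>0. \<forall>r M. 0 \<le> r \<longrightarrow> r \<le> q \<longrightarrow> c \<le> (\<Prod>i=1..M. 1 - r ^ i)"
proof -
  have "(\<lambda>K. q ^ K / (1 - q)) \<longlonglongrightarrow> 0 / (1 - q)"
    using assms by (intro tendsto_intros LIMSEQ_realpow_zero) auto
  then have "eventually (\<lambda>K. q ^ K / (1 - q) < 1/2) sequentially"
    by (intro order_tendstoD) auto
  then obtain K where K: "q ^ K / (1 - q) < 1/2" by (auto simp: eventually_sequentially)
  define c where "c = (\<Prod>i=1..K. 1 - q ^ i) * (1 / 2)"
  have pos: "0 < 1 - q ^ i" if "i \<ge> 1" for i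
    using assms that by (simp add: power_less_one_iff)
  have le1: "q ^ i \<le> 1" for i using assms by (simp add: power_le_one)
  have "0 < (\<Prod>i=1..K. 1 - q ^ i)" by (intro prod_pos pos) auto
  then have "0 < c" by (simp add: c_def)
  moreover have "c \<le> (\<Prod>i=1..M. 1 - r ^ i)" if r: "0 \<le> r" "r \<le> q" for r M
  proof -
    have le: "r ^ i \<le> q ^ i" for i using r by (simp add: power_mono)
    have tail: "1 / 2 \<le> (\<Prod>i\<in>{K<..M}. 1 - q ^ i)"
    proof -
      have "(\<Sum>i\<in>{K<..M}. q ^ i) \<le> q ^ K / (1 - q)"
      proof -
        have "(\<Sum>i\<in>{K<..M}. q ^ i) \<le> (\<Sum>i\<in>{K..<K + Suc M}. q ^ i)"
          using assms by (intro sum_mono2) auto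
        also have "\<dots> = (\<Sum>i<Suc M. q ^ (K + i))"
          by (rule sum.reindex_bij_witness[of _ "\<lambda>i. K + i" "\<lambda>i. i - K"]) auto
        also have "\<dots> = q ^ K * (\<Sum>i<Suc M. q ^ i)"
          by (simp only: power_add sum_distrib_left)
        also have "(\<Sum>i<Suc M. q ^ i) = (1 - q ^ Suc M) / (1 - q)"
          using assms by (subst sum_gp_strict) auto
        also have "q ^ K * ((1 - q ^ Suc M) / (1 - q)) \<le> q ^ K * (1 / (1 - q))"
          using assms by (intro mult_left_mono divide_right_mono) auto
        finally show ?thesis by simp
      qed
      then have "1 / 2 \<le> 1 - (\<Sum>i\<in>{K<..M}. q ^ i)" using K by linarith
      also have "\<dots> \<le> (\<Prod>i\<in>{K<..M}. 1 - q ^ i)"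
        using assms by (intro Weierstrass_prod_ineq) (auto simp: power_le_one)
      finally show ?thesis .
    qed
    have "c \<le> (\<Prod>i=1..K. 1 - q ^ i) * (\<Prod>i\<in>{K<..M}. 1 - q ^ i)"
      unfolding c_def using tail by (intro mult_left_mono prod_nonneg) (auto simp: le1)
    also have "\<dots> = (\<Prod>i\<in>{1..K} \<union> {K<..M}. 1 - q ^ i)"
      by (intro prod.union_disjoint[symmetric]) auto
    \<comment> \<open>If \<open>M < K\<close>, the union contains factors beyond \<open>M\<close>;
      they are at most 1.\<close>
    also have "\<dots> \<le> (\<Prod>i=1..M. 1 - q ^ i)"
    proof -
      have "(\<Prod>i\<in>{1..K} \<union> {K<..M}. 1 - q ^ i) =
          (\<Prod>i=1..M. 1 - q ^ i) * (\<Prod>i\<in>({1..K} \<union> {K<..M}) - {1..M}. 1 - q ^ i)"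
        by (subst prod.union_disjoint[symmetric]) (auto intro!: prod.cong)
      also have "\<dots> \<le> (\<Prod>i=1..M. 1 - q ^ i) * 1"
        using assms by (intro mult_left_mono prod_le_1 prod_nonneg) (auto simp: le1 zero_le_power)
      finally show ?thesis by simp
    qed
    also have "\<dots> \<le> (\<Prod>i=1..M. 1 - r ^ i)"
      by (intro prod_mono) (auto simp: le le1)
    finally show ?thesis .
  qed
  ultimately show ?thesis by blast
qed

text \<open>\<open>qratio q N j\<close> is the central ratio \<open>[2N, N + j] / [2N, N]\<close> of \<open>q\<^sup>2\<close>-binomial
  coefficients.\<close>

definition qratio :: "real \<Rightarrow> nat \<Rightarrow> nat \<Rightarrow> real" where
  "qratio q N j = (\<Prod>i=1..j. (1 - q ^ (2 * (N + 1 - i))) / (1 - q ^ (2 * (N + i))))"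

lemma qratio_0 [simp]: "qratio q N 0 = 1"
  by (simp add: qratio_def)

lemma qratio_Suc:
  "qratio q N (Suc j) = qratio q N j * ((1 - q ^ (2 * (N - j))) / (1 - q ^ (2 * (N + Suc j))))"
  by (simp add: qratio_def)

lemma qratio_eq_0: "N < j \<Longrightarrow> qratio q N j = 0"
  unfolding qratio_def by (intro prod_zero bexI[of _ "Suc N"]) auto

lemma qratio_bounds:
  assumes "0 \<le> q" "q < 1"
  shows "0 \<le> qratio q N j" "qratio q N j \<le> 1"
proof -
  have *: "0 \<le> (1 - q ^ (2 * (N + 1 - i))) / (1 - q ^ (2 * (N + i)))"
     "(1 - q ^ (2 * (N + 1 - i))) / (1 - q ^ (2 * (N + i))) \<le> 1" if "i \<in> {1..j}" for i
  proof -
    have "q ^ (2 * (N + i)) < 1" using that assms by (simp add: power_less_one_iff)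
    moreover have "q ^ (2 * (N + 1 - i)) \<le> 1" using assms by (simp add: power_le_one)
    moreover have "q ^ (2 * (N + i)) \<le> q ^ (2 * (N + 1 - i))"
      using that assms by (intro power_decreasing) auto
    ultimately show "0 \<le> (1 - q ^ (2 * (N + 1 - i))) / (1 - q ^ (2 * (N + i)))"
     "(1 - q ^ (2 * (N + 1 - i))) / (1 - q ^ (2 * (N + i))) \<le> 1" by auto
  qed
  show "0 \<le> qratio q N j" unfolding qratio_def using * by (intro prod_nonneg) auto
  show "qratio q N j \<le> 1" unfolding qratio_def using * by (intro prod_le_1) auto
qed

lemma qratio_tendsto:
  assumes "0 \<le> q" "q < 1"
  shows "(\<lambda>N. qratio q N j) \<longlonglongrightarrow> 1"
proof -
  have "(\<lambda>N. q ^ (2 * (N + 1 - i))) \<longlonglongrightarrow> 0" "(\<lambda>N. q ^ (2 * (N + i))) \<longlonglongrightarrow> 0" for i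
  proof -
    have z: "(\<lambda>N. (q\<^sup>2) ^ (N + k)) \<longlonglongrightarrow> 0" for k
      using assms by (intro LIMSEQ_ignore_initial_segment LIMSEQ_realpow_zero) (auto simp: power_less_one_iff)
    have s: "N + i + 1 - i = N + 1" for N by simp
    have "(\<lambda>N. q ^ (2 * (N + i + 1 - i))) \<longlonglongrightarrow> 0"
      using z[of 1] by (simp only: s power_mult)
    then show "(\<lambda>N. q ^ (2 * (N + 1 - i))) \<longlonglongrightarrow> 0"
      by (rule LIMSEQ_offset[of "\<lambda>N. q ^ (2 * (N + 1 - i))" i])
    show "(\<lambda>N. q ^ (2 * (N + i))) \<longlonglongrightarrow> 0"
      using z[of i] by (simp only: power_mult)
  qed
  then have "(\<lambda>N. qratio q N j) \<longlonglongrightarrow> (\<Prod>i=1..j. (1 - 0) / (1 - 0))"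
    unfolding qratio_def by (intro tendsto_prod tendsto_divide tendsto_diff tendsto_const) auto
  then show ?thesis by simp
qed

section \<open>The finite Jacobi triple product\<close>

definition qpoch :: "real \<Rightarrow> nat \<Rightarrow> real" where
  "qpoch q n = (\<Prod>i=1..n. 1 - q ^ (2 * i))"

lemma qpoch_Suc: "qpoch q (Suc n) = qpoch q n * (1 - q ^ (2 * Suc n))"
  by (simp add: qpoch_def)

lemma qpoch_pos: "0 \<le> q \<Longrightarrow> q < 1 \<Longrightarrow> 0 < qpoch q n"
  unfolding qpoch_def by (intro prod_pos) (auto simp: power_less_one_iff)

text \<open>The coefficient \<open>[2N, N + j] q\<^bsup>j\<^sup>2\<^esup>\<close> of the finite form of the Jacobi triple product.\<close>

definition theta_coeff :: "real \<Rightarrow> nat \<Rightarrow> nat \<Rightarrow> real" where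
  "theta_coeff q N j = (if j \<le> N then qpoch q (2 * N) / (qpoch q (N - j) * qpoch q (N + j)) * q ^ (j\<^sup>2) else 0)"

text \<open>Dividing by the central coefficient leaves weights in \<open>[0, 1]\<close> that tend to
  1, so that the truncated theta series can later be compared with the infinite one.\<close>

lemma theta_coeff_eq_qratio:
  assumes "0 \<le> q" "q < 1"
  shows "theta_coeff q N j = theta_coeff q N 0 * qratio q N j * q ^ (j\<^sup>2)"
proof (cases "j \<le> N")
  case True
  have "qratio q N j * (qpoch q (N - j) * qpoch q (N + j)) = qpoch q N * qpoch q N"
    using True
  proof (induction j)
    case (Suc j)
    have N: "N - j = Suc (N - Suc j)" using Suc.prems by simp
    have "1 - q ^ (2 * (N + Suc j)) \<noteq> 0"
      using assms by (metis add_Suc_right diff_gt_0_iff_gt less_irrefl nat_0_less_mult_iff power_less_one_iff zero_less_Suc zero_less_numeral)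
    then have "qratio q N (Suc j) * (qpoch q (N - Suc j) * qpoch q (N + Suc j)) =
       qratio q N j * ((qpoch q (N - Suc j) * (1 - q ^ (2 * (N - j)))) * qpoch q (N + j))"
      unfolding qratio_Suc add_Suc_right qpoch_Suc by (simp add: field_simps)
    also have "qpoch q (N - Suc j) * (1 - q ^ (2 * (N - j))) = qpoch q (N - j)"
      unfolding N qpoch_Suc ..
    finally show ?case using Suc by simp
  qed simp
  then have "qratio q N j = qpoch q N * qpoch q N / (qpoch q (N - j) * qpoch q (N + j))"
    using qpoch_pos[OF assms] by (metis divisors_zero less_irrefl nonzero_eq_divide_eq)
  then show ?thesis
    using True qpoch_pos[OF assms, of N] by (simp add: theta_coeff_def)
qed (simp add: theta_coeff_def qratio_eq_0)

text \<open>The recurrence below divided by \<open>theta_coeff q N j\<close>, with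
  \<open>p = q\<^sup>2\<close>, \<open>x = p ^ (N - j)\<close> and \<open>y = p ^ (N + j)\<close>;
  then \<open>x * y * p\<close> is the square of \<open>q ^ (2 * N + 1)\<close>.\<close>

lemma theta_coeff_identity:
  fixes x y p :: real
  assumes "1 - x * p \<noteq> 0" "1 - y * p \<noteq> 0"
  shows "(1 - x * y * p) * (1 - x * y * p * p) / ((1 - x * p) * (1 - y * p)) =
    1 + x * y * p + x * p * ((1 - y) / (1 - x * p)) + y * p * ((1 - x) / (1 - y * p))"
  using assms by (simp add: divide_simps) (simp add: algebra_simps)

text \<open>Multiplying a cosine polynomial by the new factor
  \<open>1 + 2 * Q * cos \<phi> + Q\<^sup>2\<close> combines each coefficient with its two
  neighbours; index 0 has the first coefficient on both sides, hence the factor 2.\<close>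

lemma theta_coeff_rec:
  assumes "0 \<le> q" "q < 1"
  defines "Q \<equiv> \<lambda>N. q ^ (2 * N + 1)"
  shows "theta_coeff q (Suc N) (Suc j) =
      (1 + (Q N)\<^sup>2) * theta_coeff q N (Suc j) + Q N * (theta_coeff q N j + theta_coeff q N (Suc (Suc j)))"
    and "theta_coeff q (Suc N) 0 = (1 + (Q N)\<^sup>2) * theta_coeff q N 0 + 2 * Q N * theta_coeff q N 1"
proof -
  have ne: "1 - q ^ (2 * Suc n) \<noteq> 0" for n
    using assms by (metis diff_gt_0_iff_gt less_irrefl nat_0_less_mult_iff power_less_one_iff zero_less_Suc zero_less_numeral)
  have P: "qpoch q n \<noteq> 0" for n using qpoch_pos[OF assms(1,2), of n] by simp
  define p where "p = q\<^sup>2"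
  have pp: "q ^ (2 * n) = p ^ n" for n by (simp add: p_def power_mult)
  \<comment> \<open>\<open>up\<close> and \<open>down\<close> express the neighbours as multiples of
    the middle coefficient: \<open>Q\<close> absorbs the change of the exponent
    \<open>j\<^sup>2\<close> up to a power of \<open>p\<close>.\<close>
  have up: "Q N * theta_coeff q N (Suc j) = theta_coeff q N j * (p ^ (N + j) * p * ((1 - p ^ (N - j)) / (1 - p ^ (N + j) * p)))"
    if "j \<le> N" for j
  proof (cases "j = N")
    case False
    then have j: "Suc j \<le> N" using that by simp
    have N: "N - j = Suc (N - Suc j)" using j by simp
    have "2 * N + 1 + (Suc j)\<^sup>2 = 2 * Suc (N + j) + j\<^sup>2" by (simp add: power2_eq_square)
    then have qq: "Q N * q ^ (Suc j)\<^sup>2 = p ^ Suc (N + j) * q ^ j\<^sup>2"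
      by (metis Q_def power_add pp)
    have "Q N * theta_coeff q N (Suc j) = qpoch q (2 * N) / (qpoch q (N - Suc j) * qpoch q (N + Suc j)) * (Q N * q ^ (Suc j)\<^sup>2)"
      using j by (simp add: theta_coeff_def)
    also have "\<dots> = qpoch q (2 * N) / (qpoch q (N - Suc j) * qpoch q (N + Suc j)) * (p ^ Suc (N + j) * q ^ j\<^sup>2)"
      by (simp only: qq)
    also have "qpoch q (N - Suc j) = qpoch q (N - j) / (1 - p ^ (N - j))"
      using ne[of "N - Suc j"] unfolding N qpoch_Suc pp by simp
    also have "qpoch q (N + Suc j) = qpoch q (N + j) * (1 - p ^ (N + j) * p)"
      unfolding add_Suc_right qpoch_Suc pp by (simp add: mult.commute)
    finally show ?thesis using that by (simp add: theta_coeff_def mult_ac)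
  qed (simp add: theta_coeff_def)
  have down: "Q N * theta_coeff q N j = theta_coeff q N (Suc j) * (p ^ (N - Suc j) * p * ((1 - p ^ (N + Suc j)) / (1 - p ^ (N - Suc j) * p)))"
    if j: "Suc j \<le> N" for j
  proof -
    have N: "N - j = Suc (N - Suc j)" using j by simp
    have "2 * N + 1 + j\<^sup>2 = 2 * Suc (N - Suc j) + (Suc j)\<^sup>2" using j by (simp add: power2_eq_square algebra_simps)
    then have qq: "Q N * q ^ j\<^sup>2 = p ^ Suc (N - Suc j) * q ^ (Suc j)\<^sup>2"
      by (metis Q_def power_add pp)
    have "Q N * theta_coeff q N j = qpoch q (2 * N) / (qpoch q (N - j) * qpoch q (N + j)) * (Q N * q ^ j\<^sup>2)"
      using j by (simp add: theta_coeff_def)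
    also have "\<dots> = qpoch q (2 * N) / (qpoch q (N - j) * qpoch q (N + j)) * (p ^ Suc (N - Suc j) * q ^ (Suc j)\<^sup>2)"
      by (simp only: qq)
    also have "qpoch q (N - j) = qpoch q (N - Suc j) * (1 - p ^ (N - Suc j) * p)"
      unfolding N qpoch_Suc pp by (simp add: mult.commute)
    also have "qpoch q (N + j) = qpoch q (N + Suc j) / (1 - p ^ (N + Suc j))"
      using ne[of "N + j"] unfolding add_Suc_right qpoch_Suc pp by simp
    finally show ?thesis using j by (simp add: theta_coeff_def mult_ac)
  qed
  have Q2: "(Q N)\<^sup>2 = p ^ (N - j) * p ^ (N + j) * p" if "j \<le> N" for j
  proof -
    have "(Q N)\<^sup>2 = p ^ (2 * N + 1)"
      unfolding Q_def p_def power_mult[symmetric] by (simp only: mult.commute)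
    also have "2 * N + 1 = (N - j) + (N + j) + 1" using that by simp
    finally show ?thesis by (simp only: power_add power_one_right)
  qed
  have new: "theta_coeff q (Suc N) j = theta_coeff q N j *
      ((1 - p ^ (N - j) * p ^ (N + j) * p) * (1 - p ^ (N - j) * p ^ (N + j) * p * p) /
        ((1 - p ^ (N - j) * p) * (1 - p ^ (N + j) * p)))" if "j \<le> N" for j
  proof -
    have e: "p ^ (N - j) * p ^ (N + j) = p ^ (2 * N)" using that by (simp add: mult_2 flip: power_add)
    have "qpoch q (2 * Suc N) = qpoch q (2 * N) * (1 - p ^ (2 * N) * p) * (1 - p ^ (2 * N) * p * p)"
    proof -
      have "2 * Suc N = Suc (Suc (2 * N))" by simp
      then show ?thesis by (simp only: qpoch_Suc pp power_Suc2)
    qed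
    moreover have "qpoch q (Suc N - j) = qpoch q (N - j) * (1 - p ^ (N - j) * p)"
      using that by (simp only: Suc_diff_le qpoch_Suc pp power_Suc2)
    moreover have "qpoch q (Suc N + j) = qpoch q (N + j) * (1 - p ^ (N + j) * p)"
      by (simp only: add_Suc qpoch_Suc pp power_Suc2)
    ultimately show ?thesis
      using that unfolding e by (simp add: theta_coeff_def mult_ac)
  qed
  have ne': "1 - p ^ n * p \<noteq> 0" for n using ne[of n] unfolding pp by (simp add: mult.commute)
  show "theta_coeff q (Suc N) (Suc j) =
      (1 + (Q N)\<^sup>2) * theta_coeff q N (Suc j) + Q N * (theta_coeff q N j + theta_coeff q N (Suc (Suc j)))"
  proof -
    consider "Suc j \<le> N" | "j = N" | "N < j" by linarith
    then show ?thesis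
    proof cases
      case 1
      show ?thesis
        unfolding new[OF 1] theta_coeff_identity[OF ne' ne'] distrib_left[of "Q N"] up[OF 1] down[OF 1] Q2[OF 1]
        by (simp add: algebra_simps)
    next
      \<comment> \<open>At the top index the old coefficients \<open>N + 1\<close> and
        \<open>N + 2\<close> vanish, and only \<open>Q\<close> times the old leading coefficient
        \<open>q ^ N\<^sup>2\<close> survives.\<close>
      case 2
      have "(Suc N)\<^sup>2 = (2 * N + 1) + N\<^sup>2" by (simp add: power2_eq_square)
      then have "q ^ (Suc N)\<^sup>2 = Q N * q ^ N\<^sup>2" unfolding Q_def power_add[symmetric] by (simp only:)
      moreover have "theta_coeff q n n = q ^ n\<^sup>2" for n
        using P[of "2 * n"] by (simp add: theta_coeff_def mult_2) (simp add: qpoch_def)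
      moreover have "theta_coeff q N (Suc N) = 0" "theta_coeff q N (Suc (Suc N)) = 0"
        by (simp_all add: theta_coeff_def)
      ultimately show ?thesis
        using 2 by simp
    qed (simp add: theta_coeff_def)
  qed
  show "theta_coeff q (Suc N) 0 = (1 + (Q N)\<^sup>2) * theta_coeff q N 0 + 2 * Q N * theta_coeff q N 1"
  proof -
    have "2 * Q N * theta_coeff q N 1 = 2 * (theta_coeff q N 0 * (p ^ N * p * ((1 - p ^ N) / (1 - p ^ N * p))))"
      using up[of 0] by simp
    moreover have "theta_coeff q (Suc N) 0 = theta_coeff q N 0 *
       (1 + p ^ N * p ^ N * p + p ^ N * p * ((1 - p ^ N) / (1 - p ^ N * p)) + p ^ N * p * ((1 - p ^ N) / (1 - p ^ N * p)))"
      using new[of 0] theta_coeff_identity[OF ne' ne', of N N] by simp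
    moreover have "(Q N)\<^sup>2 = p ^ N * p ^ N * p" using Q2[of 0] by simp
    ultimately show ?thesis by (simp add: algebra_simps)
  qed
qed

definition theta_prod :: "real \<Rightarrow> nat \<Rightarrow> real \<Rightarrow> real" where
  "theta_prod q N \<phi> = (\<Prod>m<N. 1 + 2 * q ^ (2 * m + 1) * cos \<phi> + q ^ (2 * (2 * m + 1)))"


text \<open>Induction on \<open>N\<close> by \<open>theta_coeff_rec\<close> and \<open>2 cos \<phi>
  cos ((n + 1) \<phi>) = cos ((n + 2) \<phi>) + cos (n \<phi>)\<close>. The summation bound
  \<open>M\<close> stays free so that the hypothesis for \<open>N\<close> can be used with the same
  range as the conclusion for \<open>Suc N\<close>.\<close>

lemma theta_prod_eq:
  assumes "0 \<le> q" "q < 1" "N \<le> M"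
  shows "theta_prod q N \<phi> = theta_coeff q N 0 + 2 * (\<Sum>j<M. theta_coeff q N (Suc j) * cos (real (Suc j) * \<phi>))"
  using assms(3)
proof (induction N arbitrary: M)
  case 0
  show ?case by (simp add: theta_prod_def theta_coeff_def qpoch_def)
next
  case (Suc N)
  define Q where "Q = q ^ (2 * N + 1)"
  define a where "a = theta_coeff q N"
  define C where "C n = cos (real n * \<phi>)" for n
  obtain M' where M': "M = Suc M'" "N \<le> M'" using Suc.prems by (cases M) auto
  have a0: "a j = 0" if "N < j" for j using that by (simp add: a_def theta_coeff_def)
  have rec: "2 * cos \<phi> * C (Suc n) = C (Suc (Suc n)) + C n" for n
  proof -
    have "C (Suc (Suc n)) = cos (real (Suc n) * \<phi> + \<phi>)" "C n = cos (real (Suc n) * \<phi> - \<phi>)"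
      by (simp_all add: C_def algebra_simps)
    then show ?thesis by (simp add: C_def cos_add cos_diff)
  qed
  have IH: "theta_prod q N \<phi> = a 0 + 2 * (\<Sum>j<M. a (Suc j) * C (Suc j))"
    using Suc.IH[of M] Suc.prems unfolding a_def C_def by simp
  have up: "a 0 * C 1 + (\<Sum>j<M. a (Suc j) * C (Suc (Suc j))) = (\<Sum>j<M. a j * C (Suc j))"
  proof -
    have "(\<Sum>j<M. a (Suc j) * C (Suc (Suc j))) = (\<Sum>j<M'. a (Suc j) * C (Suc (Suc j)))"
      using M' by (simp add: a0)
    then show ?thesis by (simp only: M'(1) sum.lessThan_Suc_shift) simp
  qed
  have down: "(\<Sum>j<M. a (Suc j) * C j) = a 1 + (\<Sum>j<M. a (Suc (Suc j)) * C (Suc j))"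
  proof -
    have "(\<Sum>j<M. a (Suc (Suc j)) * C (Suc j)) = (\<Sum>j<M'. a (Suc (Suc j)) * C (Suc j))"
      using M' by (simp add: a0)
    moreover have "C 0 = 1" by (simp add: C_def)
    ultimately show ?thesis by (simp only: M'(1) sum.lessThan_Suc_shift) simp
  qed
  have "2 * cos \<phi> * theta_prod q N \<phi> = 2 * (a 0 * C 1) + 2 * (\<Sum>j<M. a (Suc j) * (2 * cos \<phi> * C (Suc j)))"
    unfolding IH by (simp add: C_def algebra_simps sum_distrib_left)
  also have "\<dots> = 2 * (a 0 * C 1 + (\<Sum>j<M. a (Suc j) * C (Suc (Suc j)))) + 2 * (\<Sum>j<M. a (Suc j) * C j)"
    unfolding rec by (simp add: distrib_left sum.distrib)
  finally have cosT: "2 * cos \<phi> * theta_prod q N \<phi> =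
      2 * (\<Sum>j<M. a j * C (Suc j)) + 2 * (a 1 + (\<Sum>j<M. a (Suc (Suc j)) * C (Suc j)))"
    unfolding up down .
  have "theta_prod q (Suc N) \<phi> = theta_prod q N \<phi> * (1 + 2 * Q * cos \<phi> + Q\<^sup>2)"
    unfolding theta_prod_def Q_def power_mult[symmetric] by (simp add: mult.commute)
  also have "\<dots> = (1 + Q\<^sup>2) * theta_prod q N \<phi> + Q * (2 * cos \<phi> * theta_prod q N \<phi>)"
    by (simp add: algebra_simps)
  also have "\<dots> = ((1 + Q\<^sup>2) * a 0 + 2 * Q * a 1) +
      2 * ((1 + Q\<^sup>2) * (\<Sum>j<M. a (Suc j) * C (Suc j)) + Q * ((\<Sum>j<M. a j * C (Suc j)) + (\<Sum>j<M. a (Suc (Suc j)) * C (Suc j))))"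
    unfolding cosT unfolding IH by (simp add: algebra_simps)
  also have "(1 + Q\<^sup>2) * (\<Sum>j<M. a (Suc j) * C (Suc j)) + Q * ((\<Sum>j<M. a j * C (Suc j)) + (\<Sum>j<M. a (Suc (Suc j)) * C (Suc j)))
      = (\<Sum>j<M. ((1 + Q\<^sup>2) * a (Suc j) + Q * (a j + a (Suc (Suc j)))) * C (Suc j))"
    by (simp add: sum_distrib_left sum.distrib[symmetric] algebra_simps)
  finally show ?case
    unfolding a_def Q_def theta_coeff_rec[OF assms(1,2), symmetric] C_def .
qed

text \<open>Each factor increases with the cosine. The factor \<open>m = 0\<close> supplies
  \<open>2 * q * (cos \<phi> - cos \<psi>)\<close>; the others, taken at \<psi>, are at least
  \<open>(1 - q ^ (2 * m + 1))\<^sup>2\<close>, their value at cosine \<open>- 1\<close>. Passing to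
  all exponents up to \<open>2 * N\<close> only adds factors in \<open>[0, 1]\<close>.\<close>

lemma theta_prod_diff:
  assumes "0 \<le> q" "q < 1" "0 < N" "cos \<psi> \<le> cos \<phi>"
  shows "2 * q * (cos \<phi> - cos \<psi>) * (\<Prod>i=1..2*N. 1 - q ^ i)\<^sup>2 \<le> theta_prod q N \<phi> - theta_prod q N \<psi>"
proof -
  define g where "g m x = 1 + 2 * q ^ (2 * m + 1) * x + q ^ (2 * (2 * m + 1))" for m and x :: real
  define R where "R x = (\<Prod>m\<in>{1..<N}. g m x)" for x
  have N: "{..<N} = insert 0 {1..<N}" using assms(3) by auto
  have T: "theta_prod q N \<phi> = g 0 (cos \<phi>) * R (cos \<phi>)" for \<phi>
    unfolding theta_prod_def R_def g_def N by (subst prod.insert) auto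
  have q1: "q ^ i \<le> 1" for i using assms by (simp add: power_le_one)
  have g_ge: "(1 - q ^ (2 * m + 1))\<^sup>2 \<le> g m x" if "- 1 \<le> x" for m x
  proof -
    have "0 \<le> 2 * q ^ (2 * m + 1) * (1 + x)" using assms that by simp
    moreover have "(1 - q ^ (2 * m + 1))\<^sup>2 = 1 - 2 * q ^ (2 * m + 1) + q ^ (2 * (2 * m + 1))"
      by (simp only: power2_diff power_mult[symmetric] mult.commute[of _ 2]) simp
    ultimately show ?thesis unfolding g_def by (simp add: algebra_simps)
  qed
  have g_mono: "g m x \<le> g m y" if "x \<le> y" for m x y
    using assms that unfolding g_def by (simp add: mult_left_mono)
  have g0: "0 \<le> g m x" if "- 1 \<le> x" for m x
    using g_ge[OF that, of m] zero_le_power2 order_trans by blast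
  have R_mono: "R (cos \<psi>) \<le> R (cos \<phi>)"
    unfolding R_def using assms(4) by (intro prod_mono) (auto intro: g0 g_mono)
  have R_ge: "(\<Prod>i=1..2*N. 1 - q ^ i)\<^sup>2 \<le> R (cos \<psi>)"
  proof -
    have "(\<Prod>i=1..2*N. 1 - q ^ i) \<le> (\<Prod>i\<in>(\<lambda>m. 2 * m + 1) ` {1..<N}. 1 - q ^ i)"
    proof -
      have "(\<Prod>i=1..2*N. 1 - q ^ i) = (\<Prod>i\<in>(\<lambda>m. 2 * m + 1) ` {1..<N}. 1 - q ^ i) *
          (\<Prod>i\<in>{1..2*N} - (\<lambda>m. 2 * m + 1) ` {1..<N}. 1 - q ^ i)"
        by (subst mult.commute, rule prod.subset_diff) auto
      also have "\<dots> \<le> (\<Prod>i\<in>(\<lambda>m. 2 * m + 1) ` {1..<N}. 1 - q ^ i) * 1"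
        using assms(1) by (intro mult_left_mono prod_le_1 prod_nonneg) (auto simp: q1[simplified])
      finally show ?thesis by simp
    qed
    also have "\<dots> = (\<Prod>m\<in>{1..<N}. 1 - q ^ (2 * m + 1))"
      by (subst prod.reindex) (auto simp: inj_on_def)
    finally have "(\<Prod>i=1..2*N. 1 - q ^ i)\<^sup>2 \<le> (\<Prod>m\<in>{1..<N}. 1 - q ^ (2 * m + 1))\<^sup>2"
      using q1 by (intro power_mono prod_nonneg) auto
    also have "\<dots> = (\<Prod>m\<in>{1..<N}. (1 - q ^ (2 * m + 1))\<^sup>2)"
      by (simp add: prod_power_distrib)
    also have "\<dots> \<le> R (cos \<psi>)"
      unfolding R_def by (intro prod_mono) (auto intro: g_ge[simplified])
    finally show ?thesis .
  qed
  have "2 * q * (cos \<phi> - cos \<psi>) * (\<Prod>i=1..2*N. 1 - q ^ i)\<^sup>2 \<le> 2 * q * (cos \<phi> - cos \<psi>) * R (cos \<psi>)"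
    using assms R_ge by (intro mult_left_mono) auto
  also have "\<dots> = (g 0 (cos \<phi>) - g 0 (cos \<psi>)) * R (cos \<psi>)"
    by (simp add: g_def algebra_simps)
  also have "\<dots> \<le> g 0 (cos \<phi>) * R (cos \<phi>) - g 0 (cos \<psi>) * R (cos \<psi>)"
    using mult_left_mono[OF R_mono g0[of "cos \<phi>" 0]] by (simp add: algebra_simps)
  finally show ?thesis unfolding T .
qed

text \<open>Since \<open>cos (n (\<xi> - \<eta>)) - cos (n (\<xi> + \<eta>))\<close> is twice a
  product of sines, the difference of the theta products at \<open>\<xi> - \<eta>\<close> and
  \<open>\<xi> + \<eta>\<close> is \<open>4 * A * S\<close>, with the central coefficient
  \<open>A\<close> and the sought sum \<open>S\<close>. The product bound gives one
  \<open>c\<^sup>2\<close>; removing \<open>A\<close> by \<open>A * c\<^sup>2 \<le> 1\<close> costs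
  another, whence \<open>c ^ 4\<close>.\<close>

lemma sine_kernel_bound:
  assumes "0 \<le> q1" "q1 < 1"
  shows "\<exists>K>0. \<forall>q N \<xi> \<eta>. 0 \<le> q \<longrightarrow> q \<le> q1 \<longrightarrow> 0 < N \<longrightarrow> 0 \<le> sin \<xi> * sin \<eta> \<longrightarrow>
    K * q * (sin \<xi> * sin \<eta>) \<le>
      (\<Sum>j<N. qratio q N (Suc j) * q ^ (Suc j)\<^sup>2 * (sin (real (Suc j) * \<xi>) * sin (real (Suc j) * \<eta>)))"
proof -
  obtain c where c: "0 < c" "\<And>r M. 0 \<le> r \<Longrightarrow> r \<le> q1 \<Longrightarrow> c \<le> (\<Prod>i=1..M. 1 - r ^ i)"
    using prod_one_minus_power_bound[OF assms] by blast
  have "c ^ 4 * q * (sin \<xi> * sin \<eta>) \<le>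
      (\<Sum>j<N. qratio q N (Suc j) * q ^ (Suc j)\<^sup>2 * (sin (real (Suc j) * \<xi>) * sin (real (Suc j) * \<eta>)))"
    if q: "0 \<le> q" "q \<le> q1" and N: "0 < N" and s: "0 \<le> sin \<xi> * sin \<eta>" for q N \<xi> \<eta>
  proof -
    have q1: "q < 1" using q assms by simp
    define S where "S = (\<Sum>j<N. qratio q N (Suc j) * q ^ (Suc j)\<^sup>2 * (sin (real (Suc j) * \<xi>) * sin (real (Suc j) * \<eta>)))"
    define A where "A = theta_coeff q N 0"
    have cd: "cos (real n * (\<xi> - \<eta>)) - cos (real n * (\<xi> + \<eta>)) = 2 * (sin (real n * \<xi>) * sin (real n * \<eta>))" for n
      by (simp add: right_diff_distrib distrib_left cos_diff cos_add)
    have "theta_prod q N (\<xi> - \<eta>) - theta_prod q N (\<xi> + \<eta>) =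
       2 * (\<Sum>j<N. theta_coeff q N (Suc j) * (cos (real (Suc j) * (\<xi> - \<eta>)) - cos (real (Suc j) * (\<xi> + \<eta>))))"
      unfolding theta_prod_eq[OF q(1) q1 order_refl] by (simp add: sum_subtractf right_diff_distrib)
    also have "\<dots> = 4 * A * S"
      unfolding cd theta_coeff_eq_qratio[OF q(1) q1, of N "Suc _"] A_def S_def
      by (simp add: sum_distrib_left mult_ac)
    finally have T: "theta_prod q N (\<xi> - \<eta>) - theta_prod q N (\<xi> + \<eta>) = 4 * A * S" .
    have "c\<^sup>2 \<le> (\<Prod>i=1..2*N. 1 - q ^ i)\<^sup>2"
      using c q by (intro power_mono) auto
    then have "2 * q * (2 * (sin \<xi> * sin \<eta>)) * c\<^sup>2 \<le> 2 * q * (2 * (sin \<xi> * sin \<eta>)) * (\<Prod>i=1..2*N. 1 - q ^ i)\<^sup>2"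
      using q s by (intro mult_left_mono) auto
    also have "\<dots> \<le> 4 * A * S"
      using theta_prod_diff[OF q(1) q1 N, of "\<xi> + \<eta>" "\<xi> - \<eta>"] s cd[of 1] T by simp
    finally have 1: "q * (sin \<xi> * sin \<eta>) * c\<^sup>2 \<le> A * S" by simp
    have A: "0 < A" using qpoch_pos[OF q(1) q1] by (simp add: A_def theta_coeff_def)
    have "0 \<le> A * S" using 1 q s by (meson mult_nonneg_nonneg order_trans zero_le_power2)
    then have S0: "0 \<le> S" using A by (simp add: zero_le_mult_iff)
    have q2: "qpoch q n = (\<Prod>i=1..n. 1 - (q\<^sup>2) ^ i)" for n by (simp add: qpoch_def power_mult)
    have "q\<^sup>2 \<le> q1" using q q1 by (smt (verit) mult_left_le power2_eq_square)
    then have "c \<le> qpoch q N" using c(2)[of "q\<^sup>2" N] by (simp add: q2)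
    then have "c\<^sup>2 \<le> (qpoch q N)\<^sup>2" using c(1) by (intro power_mono) auto
    moreover have "qpoch q (2 * N) \<le> 1"
      unfolding qpoch_def using q(1) q1 by (intro prod_le_1) (auto simp: power_le_one)
    moreover have "A * (qpoch q N)\<^sup>2 = qpoch q (2 * N)"
      using qpoch_pos[OF q(1) q1, of N] by (simp add: A_def theta_coeff_def power2_eq_square)
    ultimately have 2: "A * c\<^sup>2 \<le> 1"
      using A by (smt (verit) mult_left_mono)
    have "c ^ 4 * q * (sin \<xi> * sin \<eta>) = (q * (sin \<xi> * sin \<eta>) * c\<^sup>2) * c\<^sup>2" by (simp add: power4_eq_xxxx power2_eq_square)
    also have "\<dots> \<le> (A * S) * c\<^sup>2" using 1 by (intro mult_right_mono) auto
    also have "\<dots> = (A * c\<^sup>2) * S" by simp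
    also have "\<dots> \<le> 1 * S" using 2 S0 by (intro mult_right_mono)
    finally show ?thesis by (simp add: S_def)
  qed
  then show ?thesis using c(1) by (intro exI[of _ "c ^ 4"]) auto
qed

section \<open>Test functions and weak derivatives\<close>

text \<open>A class of functions closed under differentiation; its members with compact support are test
  functions.\<close>

inductive_set smooth_alg :: "(real \<Rightarrow> real) set" where
  bump: "(\<lambda>x. if 0 < a * x + b then poly P (1 / (a * x + b)) * exp (- 1 / (a * x + b)) else 0) \<in> smooth_alg"
| sin: "(\<lambda>x. sin (a * x + b)) \<in> smooth_alg"
| cos: "(\<lambda>x. cos (a * x + b)) \<in> smooth_alg"
| const: "(\<lambda>x. c) \<in> smooth_alg"
| add: "f \<in> smooth_alg \<Longrightarrow> g \<in> smooth_alg \<Longrightarrow> (\<lambda>x. f x + g x) \<in> smooth_alg"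
| mult: "f \<in> smooth_alg \<Longrightarrow> g \<in> smooth_alg \<Longrightarrow> (\<lambda>x. f x * g x) \<in> smooth_alg"

lemma poly_exp_tendsto_0:
  fixes P :: "real poly"
  shows "((\<lambda>y. poly P y * exp (- y)) \<longlongrightarrow> 0) at_top"
proof -
  have "((\<lambda>y. \<Sum>i\<le>degree P. coeff P i * (y ^ i / exp y)) \<longlongrightarrow> (\<Sum>i\<le>degree P. coeff P i * 0)) at_top"
    by (intro tendsto_sum tendsto_mult tendsto_const tendsto_power_div_exp_0)
  then show ?thesis
    by (simp add: poly_altdef sum_distrib_right exp_minus divide_inverse mult.assoc)
qed

text \<open>With \<open>u = 1 / y\<close> the derivative of \<open>P(u) exp (- u)\<close> is
  \<open>u\<^sup>2 (P(u) - P'(u)) exp (- u)\<close>, again of the same form. At 0 the difference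
  quotient from the right is \<open>u P(u) exp (- u)\<close>, the case of the polynomial
  \<open>pCons 0 P\<close>.\<close>

lemma bump_has_derivative:
  fixes P :: "real poly"
  defines "B \<equiv> \<lambda>(P :: real poly) y. if 0 < y then poly P (1 / y) * exp (- 1 / y) else 0"
  shows "(B P has_real_derivative B (monom 1 2 * (P - pderiv P)) y) (at y)"
proof -
  consider "0 < y" | "y < 0" | "y = 0" by linarith
  then show ?thesis
  proof cases
    case 1
    have "((\<lambda>y. poly P (1 / y) * exp (- 1 / y)) has_real_derivative B (monom 1 2 * (P - pderiv P)) y) (at y)"
      using 1 by (auto intro!: derivative_eq_intros simp: B_def poly_monom power2_eq_square field_simps)
    moreover have "eventually (\<lambda>y. poly P (1 / y) * exp (- 1 / y) = B P y) (nhds y)"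
      using eventually_nhds_in_open[of "{0<..}" y] 1 by (auto elim!: eventually_mono simp: B_def)
    ultimately show ?thesis
      using DERIV_cong_ev[OF refl _ refl, of "\<lambda>y. poly P (1 / y) * exp (- 1 / y)" "B P" y] by blast
  next
    case 2
    have "((\<lambda>y. 0) has_real_derivative B (monom 1 2 * (P - pderiv P)) y) (at y)"
      using 2 by (simp add: B_def)
    moreover have "eventually (\<lambda>y. 0 = B P y) (nhds y)"
      using eventually_nhds_in_open[of "{..<0}" y] 2 by (auto elim!: eventually_mono simp: B_def)
    ultimately show ?thesis
      using DERIV_cong_ev[OF refl _ refl, of "\<lambda>y. 0" "B P" y] by blast
  next
    case 3
    have "((\<lambda>h. B P h / h) \<longlongrightarrow> 0) (at_right 0)"
    proof -
      have "((\<lambda>h. poly (pCons 0 P) (inverse h) * exp (- inverse h)) \<longlongrightarrow> 0) (at_right 0)"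
        by (rule filterlim_compose[OF poly_exp_tendsto_0 filterlim_inverse_at_top_right])
      moreover have "eventually (\<lambda>h. poly (pCons 0 P) (inverse h) * exp (- inverse h) = B P h / h) (at_right 0)"
        by (rule eventually_at_rightI[of 0 1]) (auto simp: B_def divide_inverse)
      ultimately show ?thesis by (rule Lim_transform_eventually)
    qed
    moreover have "((\<lambda>h. B P h / h) \<longlongrightarrow> 0) (at_left 0)"
    proof (rule tendsto_eventually)
      show "eventually (\<lambda>h. B P h / h = 0) (at_left 0)"
        by (rule eventually_at_leftI[of "-1"]) (auto simp: B_def)
    qed
    ultimately have "((\<lambda>h. B P h / h) \<longlongrightarrow> 0) (at 0)"
      by (simp add: filterlim_at_split)
    then show ?thesis
      unfolding 3 DERIV_def by (simp add: B_def)
  qed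
qed

lemma smooth_alg_derivative:
  assumes "f \<in> smooth_alg"
  shows "\<exists>f'\<in>smooth_alg. \<forall>x. (f has_real_derivative f' x) (at x)"
  using assms
proof induction
  case (bump a b P)
  define B where "B = (\<lambda>(P :: real poly) y. if 0 < y then poly P (1 / y) * exp (- 1 / y) else (0::real))"
  define Q where "Q = monom 1 2 * (P - pderiv P)"
  have B: "(B P has_real_derivative B Q y) (at y)" for y
    unfolding B_def Q_def by (rule bump_has_derivative)
  have "((\<lambda>x. B P (a * x + b)) has_real_derivative B Q (a * x + b) * a) (at x)" for x
    by (rule DERIV_chain2[OF B]) (auto intro!: derivative_eq_intros)
  moreover have m: "(\<lambda>x. B Q (a * x + b) * a) \<in> smooth_alg"
    unfolding B_def by (intro smooth_alg.intros)
  ultimately have "\<exists>f'\<in>smooth_alg. \<forall>x. ((\<lambda>x. B P (a * x + b)) has_real_derivative f' x) (at x)"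
    by (intro bexI[OF _ m]) simp
  then show ?case unfolding B_def .
next
  case (sin a b)
  have "((\<lambda>x. sin (a * x + b)) has_real_derivative cos (a * x + b) * a) (at x)" for x
    by (auto intro!: derivative_eq_intros)
  moreover have m: "(\<lambda>x. cos (a * x + b) * a) \<in> smooth_alg" by (intro smooth_alg.intros)
  ultimately show ?case by (intro bexI[OF _ m]) simp
next
  case (cos a b)
  have "((\<lambda>x. cos (a * x + b)) has_real_derivative sin (a * x + b) * (- a)) (at x)" for x
    by (auto intro!: derivative_eq_intros)
  moreover have m: "(\<lambda>x. sin (a * x + b) * (- a)) \<in> smooth_alg" by (intro smooth_alg.intros)
  ultimately show ?case by (intro bexI[OF _ m]) simp
next
  case (const c)
  have "((\<lambda>x. c) has_real_derivative 0) (at x)" for x :: real by simp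
  then show ?case by (intro bexI[OF _ smooth_alg.const[of 0]]) simp
next
  case (add f g)
  then obtain f' g' where "f' \<in> smooth_alg" "g' \<in> smooth_alg"
    "\<And>x. (f has_real_derivative f' x) (at x)" "\<And>x. (g has_real_derivative g' x) (at x)" by blast
  then show ?case
    by (intro bexI[of _ "\<lambda>x. f' x + g' x"]) (auto intro!: DERIV_add smooth_alg.intros)
next
  case (mult f g)
  then obtain f' g' where *: "f' \<in> smooth_alg" "g' \<in> smooth_alg"
    "\<And>x. (f has_real_derivative f' x) (at x)" "\<And>x. (g has_real_derivative g' x) (at x)" by blast
  have "((\<lambda>x. f x * g x) has_real_derivative f' x * g x + g' x * f x) (at x)" for x
    by (rule DERIV_mult[OF *(3,4)])
  moreover have m: "(\<lambda>x. f' x * g x + g' x * f x) \<in> smooth_alg"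
    using * mult by (intro smooth_alg.intros)
  ultimately show ?case by (intro bexI[OF _ m]) simp
qed

lemma smooth_alg_deriv:
  assumes "f \<in> smooth_alg"
  shows "deriv f \<in> smooth_alg" "(f has_real_derivative deriv f x) (at x)"
proof -
  obtain f' where f': "f' \<in> smooth_alg" "\<And>x. (f has_real_derivative f' x) (at x)"
    using smooth_alg_derivative[OF assms] by blast
  then have "deriv f = f'" by (auto simp: DERIV_imp_deriv)
  with f' show "deriv f \<in> smooth_alg" "(f has_real_derivative deriv f x) (at x)" by auto
qed

lemma smooth_alg_test_functions:
  assumes "f \<in> smooth_alg" "compact K" "K \<subseteq> S" "\<And>x. x \<notin> K \<Longrightarrow> f x = 0"
  shows "f \<in> test_functions S"
proof -
  have "(deriv ^^ n) f \<in> smooth_alg" for n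
    by (induction n) (auto simp: assms(1) smooth_alg_deriv)
  then have "(deriv ^^ n) f field_differentiable at x" for n x
    using smooth_alg_deriv(2) by (auto simp: field_differentiable_def)
  with assms show ?thesis unfolding test_functions_def by blast
qed

lemma smooth_alg_continuous: "f \<in> smooth_alg \<Longrightarrow> continuous_on A f"
  using smooth_alg_deriv(2) by (meson DERIV_continuous continuous_at_imp_continuous_on)

section \<open>Cut-offs approximating the indicator of an interval\<close>

definition bump :: "real \<Rightarrow> real" where
  "bump y = (if 0 < y then exp (- 1 / y) else 0)"

text \<open>Without a plateau: the values stay below 1 and reach it only in the pointwise limit on
  the open interval, which is enough for dominated convergence. The shift by 1 keeps the support at
  distance \<open>1 / (n + 1)\<close> from the endpoints.\<close>

definition cutoff :: "real \<Rightarrow> real \<Rightarrow> nat \<Rightarrow> real \<Rightarrow> real" where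
  "cutoff a b n x = bump (real (Suc n) * (x - a) - 1) * bump (real (Suc n) * (b - x) - 1)"

lemma bump_bounds: "0 \<le> bump y" "bump y \<le> 1"
  by (auto simp: bump_def)

lemma cutoff_bounds: "0 \<le> cutoff a b n x" "cutoff a b n x \<le> 1"
  unfolding cutoff_def using bump_bounds by (auto intro!: mult_nonneg_nonneg mult_le_one)

lemma bump_affine_smooth_alg: "(\<lambda>x. bump (a * x + b)) \<in> smooth_alg"
  using smooth_alg.bump[of a b 1] by (simp add: bump_def cong: if_cong)

lemma cutoff_smooth_alg: "cutoff a b n \<in> smooth_alg"
proof -
  have "(\<lambda>x. bump (real (Suc n) * x + (- real (Suc n) * a - 1)) * bump (- real (Suc n) * x + (real (Suc n) * b - 1))) \<in> smooth_alg"
    by (intro smooth_alg.mult bump_affine_smooth_alg)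
  then show ?thesis by (simp add: cutoff_def[abs_def] algebra_simps)
qed

lemma cutoff_eq_0: "x \<notin> {a + 1 / real (Suc n)..b - 1 / real (Suc n)} \<Longrightarrow> cutoff a b n x = 0"
  by (auto simp: cutoff_def bump_def field_simps)

lemma mult_cutoff_test_function:
  assumes "F \<in> smooth_alg" "p \<le> a" "b \<le> q"
  shows "(\<lambda>x. F x * cutoff a b n x) \<in> test_functions {p<..<q}"
proof (rule smooth_alg_test_functions[where K = "{a + 1 / real (Suc n)..b - 1 / real (Suc n)}"])
  show "{a + 1 / real (Suc n)..b - 1 / real (Suc n)} \<subseteq> {p<..<q}"
  proof
    fix x assume "x \<in> {a + 1 / real (Suc n)..b - 1 / real (Suc n)}"
    moreover have "0 < 1 / real (Suc n)" by simp
    ultimately have "a < x" "x < b" unfolding atLeastAtMost_iff by (linarith, linarith)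
    with assms show "x \<in> {p<..<q}" by simp
  qed
qed (use assms cutoff_eq_0 in \<open>auto intro!: smooth_alg.mult cutoff_smooth_alg\<close>)

lemma cutoff_test_function: "p \<le> a \<Longrightarrow> b \<le> q \<Longrightarrow> cutoff a b n \<in> test_functions {p<..<q}"
  using mult_cutoff_test_function[OF smooth_alg.const[of 1], of p a b q n] by simp

lemma filterlim_Suc_mult_minus_1: "0 < c \<Longrightarrow> filterlim (\<lambda>n. real (Suc n) * c - 1) at_top sequentially"
  by real_asymp

lemma bump_tendsto: "(bump \<longlongrightarrow> 1) at_top"
proof (rule Lim_transform_eventually)
  show "((\<lambda>y::real. exp (- 1 / y)) \<longlongrightarrow> 1) at_top" by real_asymp
  show "eventually (\<lambda>y. exp (- 1 / y) = bump y) at_top"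
    using eventually_gt_at_top[of 0] by eventually_elim (simp add: bump_def)
qed

lemma cutoff_tendsto:
  assumes "a < x" "x < b"
  shows "(\<lambda>n. cutoff a b n x) \<longlonglongrightarrow> 1"
proof -
  have "(\<lambda>n. cutoff a b n x) \<longlonglongrightarrow> 1 * 1"
    unfolding cutoff_def
    by (intro tendsto_mult filterlim_compose[OF bump_tendsto] filterlim_Suc_mult_minus_1) (use assms in auto)
  then show ?thesis by simp
qed

lemma cutoff_tendsto_indicator: "(\<lambda>n. cutoff a b n x) \<longlonglongrightarrow> indicator {a<..<b} x"
proof (cases "x \<in> {a<..<b}")
  case False
  have "cutoff a b n x = 0" for n
  proof (rule cutoff_eq_0)
    have "0 < 1 / real (Suc n)" by simp
    then show "x \<notin> {a + 1 / real (Suc n)..b - 1 / real (Suc n)}"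
      using False unfolding atLeastAtMost_iff greaterThanLessThan_iff by linarith
  qed
  with False show ?thesis by simp
qed (auto intro: cutoff_tendsto)

definition bump' :: "real \<Rightarrow> real" where
  "bump' y = (if 0 < y then 1 / y\<^sup>2 * exp (- 1 / y) else 0)"

lemma bump_deriv: "(bump has_real_derivative bump' y) (at y)"
  using bump_has_derivative[of 1 y]
  by (simp add: bump_def[abs_def] bump'_def poly_monom power_one_over cong: if_cong)

text \<open>For \<open>y = real (Suc n) * d - 1\<close> the factor \<open>y + 1\<close> equals
  \<open>real (Suc n) * d\<close>. The product thus bounds the derivative of the cut-off at distance
  \<open>d\<close> from an endpoint, times \<open>d\<close>, the order of a smooth function that
  vanishes there.\<close>

lemma bump'_bound: "0 \<le> (y + 1) * bump' y" "(y + 1) * bump' y \<le> 3"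
proof -
  show "0 \<le> (y + 1) * bump' y" by (auto simp: bump'_def)
  show "(y + 1) * bump' y \<le> 3"
  proof (cases "0 < y")
    case True
    define u where "u = 1 / y"
    have u: "0 < u" using True by (simp add: u_def)
    have "1 + u + u\<^sup>2 / 2 \<le> exp u" using exp_lower_Taylor_quadratic[of u] u by simp
    then have "u + u\<^sup>2 \<le> 3 * exp u" using u by (smt (verit) zero_le_power2 field_sum_of_halves)
    then have "(u + u\<^sup>2) * exp (- u) \<le> 3" by (simp add: exp_minus field_simps)
    moreover have "(y + 1) * bump' y = (u + u\<^sup>2) * exp (- u)"
      using True by (simp add: bump'_def u_def field_simps power2_eq_square)
    ultimately show ?thesis by simp
  qed (simp add: bump'_def)
qed

lemma bump'_tendsto: "((\<lambda>y. (y + 1) * bump' y) \<longlongrightarrow> 0) at_top"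
proof (rule Lim_transform_eventually)
  show "((\<lambda>y::real. (y + 1) * (1 / y\<^sup>2 * exp (- 1 / y))) \<longlongrightarrow> 0) at_top" by real_asymp
  show "eventually (\<lambda>y. (y + 1) * (1 / y\<^sup>2 * exp (- 1 / y)) = (y + 1) * bump' y) at_top"
    using eventually_gt_at_top[of 0] by eventually_elim (simp add: bump'_def)
qed


section \<open>Square integrability and weak derivatives on a bounded interval\<close>

lemma measurable_lebesgue_on_Ioo:
  assumes "continuous_on {p..q} (F :: real \<Rightarrow> real)"
  shows "F \<in> borel_measurable (lebesgue_on {p<..<q})"
  by (rule continuous_imp_measurable_on_sets_lebesgue)
     (auto intro: continuous_on_subset[OF assms] lmeasurable_interval)

lemma finite_measure_Ioo: "finite_measure (lebesgue_on {p<..<q::real})"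
  by (intro finite_measure_lebesgue_on) (simp add: bounded_set_imp_lmeasurable)

lemma integrable_bounded_Ioo:
  assumes "F \<in> borel_measurable (lebesgue_on {p<..<q::real})" "\<And>x. x \<in> {p<..<q} \<Longrightarrow> \<bar>F x\<bar> \<le> (B::real)"
  shows "integrable (lebesgue_on {p<..<q}) F"
  by (rule finite_measure.integrable_const_bound[OF finite_measure_Ioo, where B = B])
     (use assms in \<open>auto intro!: AE_I2\<close>)

lemma continuous_bounded_Icc:
  assumes "continuous_on {p..q} (F :: real \<Rightarrow> real)"
  shows "\<exists>B>0. \<forall>x\<in>{p..q}. \<bar>F x\<bar> \<le> B"
proof -
  have "bounded (F ` {p..q})"
    by (intro compact_imp_bounded compact_continuous_image assms) auto
  then obtain B where "0 < B" "\<forall>x\<in>F ` {p..q}. norm x \<le> B"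
    unfolding bounded_pos by blast
  then show ?thesis by (intro exI[of _ B]) simp
qed

lemma L2_measurable: "f \<in> L2 S \<Longrightarrow> f \<in> borel_measurable (lebesgue_on S)"
  and L2_square_integrable: "f \<in> L2 S \<Longrightarrow> integrable (lebesgue_on S) (\<lambda>x. (f x)\<^sup>2)"
  by (auto simp: L2_def)

lemma L2_mult_integrable:
  assumes "f \<in> L2 S" "g \<in> L2 S"
  shows "integrable (lebesgue_on S) (\<lambda>x. f x * g x)"
proof (rule Bochner_Integration.integrable_bound)
  show "integrable (lebesgue_on S) (\<lambda>x. (f x)\<^sup>2 + (g x)\<^sup>2)"
    using assms by (intro Bochner_Integration.integrable_add L2_square_integrable)
  show "(\<lambda>x. f x * g x) \<in> borel_measurable (lebesgue_on S)"
    using assms by (intro borel_measurable_times L2_measurable)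
  have "\<bar>a * b\<bar> \<le> a\<^sup>2 + b\<^sup>2" for a b :: real
  proof -
    have "0 \<le> \<bar>a * b\<bar>" "2 * \<bar>a * b\<bar> \<le> a\<^sup>2 + b\<^sup>2"
      using sum_squares_bound[of "\<bar>a\<bar>" "\<bar>b\<bar>"] by (simp_all add: abs_mult)
    then show ?thesis by linarith
  qed
  then show "AE x in lebesgue_on S. norm (f x * g x) \<le> norm ((f x)\<^sup>2 + (g x)\<^sup>2)" by simp
qed

lemma L2_continuous:
  assumes "continuous_on {p..q} F"
  shows "F \<in> L2 {p<..<q}"
proof -
  obtain B where B: "0 < B" "\<forall>x\<in>{p..q}. \<bar>F x\<bar> \<le> B" using continuous_bounded_Icc[OF assms] by blast
  have m: "F \<in> borel_measurable (lebesgue_on {p<..<q})" by (rule measurable_lebesgue_on_Ioo[OF assms])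
  have "\<bar>(F x)\<^sup>2\<bar> \<le> B\<^sup>2" if "x \<in> {p<..<q}" for x
    using B(2)[rule_format, of x] that by (simp add: abs_le_square_iff[symmetric])
  then have "integrable (lebesgue_on {p<..<q}) (\<lambda>x. (F x)\<^sup>2)"
    using m by (intro integrable_bounded_Ioo) auto
  with m show ?thesis by (simp add: L2_def)
qed

lemma L2_lincomb:
  assumes "f \<in> L2 S" "g \<in> L2 S"
  shows "(\<lambda>x. a * f x + b * g x) \<in> L2 S"
proof -
  have "integrable (lebesgue_on S) (\<lambda>x. a\<^sup>2 * (f x)\<^sup>2 + (2 * a * b) * (f x * g x) + b\<^sup>2 * (g x)\<^sup>2)"
    using assms
    by (intro Bochner_Integration.integrable_add integrable_mult_right L2_square_integrable L2_mult_integrable)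
  moreover have "(a * f x + b * g x)\<^sup>2 = a\<^sup>2 * (f x)\<^sup>2 + (2 * a * b) * (f x * g x) + b\<^sup>2 * (g x)\<^sup>2" for x
    by (simp add: power2_eq_square algebra_simps)
  moreover have "(\<lambda>x. a * f x + b * g x) \<in> borel_measurable (lebesgue_on S)"
    using assms by (intro borel_measurable_add borel_measurable_times borel_measurable_const L2_measurable)
  ultimately show ?thesis by (simp add: L2_def)
qed

lemma L2_diff: "f \<in> L2 S \<Longrightarrow> g \<in> L2 S \<Longrightarrow> (\<lambda>x. f x - g x) \<in> L2 S"
  using L2_lincomb[of f S g 1 "-1"] by simp

lemma L2_integrable:
  assumes "f \<in> L2 {p<..<q}"
  shows "integrable (lebesgue_on {p<..<q}) f"
  using L2_mult_integrable[OF assms L2_continuous[of p q "\<lambda>_. 1"]] by simp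

lemma L2_Cauchy_Schwarz:
  assumes "f \<in> L2 S" "g \<in> L2 S"
  shows "\<bar>LINT x|lebesgue_on S. f x * g x\<bar> \<le> sqrt (LINT x|lebesgue_on S. (f x)\<^sup>2) * sqrt (LINT x|lebesgue_on S. (g x)\<^sup>2)"
proof -
  define A where "A = (LINT x|lebesgue_on S. (f x)\<^sup>2)"
  define B where "B = (LINT x|lebesgue_on S. f x * g x)"
  define D where "D = (LINT x|lebesgue_on S. (g x)\<^sup>2)"
  have AD: "0 \<le> A" "0 \<le> D" by (simp_all add: A_def D_def)
  have *: "0 \<le> A - 2 * t * B + t\<^sup>2 * D" for t
  proof -
    have "(f x - t * g x)\<^sup>2 = (f x)\<^sup>2 - (2 * t) * (f x * g x) + t\<^sup>2 * (g x)\<^sup>2" for x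
      by (simp add: power2_eq_square algebra_simps)
    then have "(LINT x|lebesgue_on S. (f x - t * g x)\<^sup>2) = A - 2 * t * B + t\<^sup>2 * D"
      using assms unfolding A_def B_def D_def
      by (simp add: L2_square_integrable L2_mult_integrable)
    moreover have "0 \<le> (LINT x|lebesgue_on S. (f x - t * g x)\<^sup>2)" by simp
    ultimately show ?thesis by simp
  qed
  have "B\<^sup>2 \<le> A * D"
  proof (cases "D = 0")
    case True
    have "B = 0"
    proof (rule ccontr)
      assume "B \<noteq> 0"
      with *[of "(A + 1) / (2 * B)"] True show False by simp
    qed
    with True show ?thesis by simp
  next
    case False
    with *[of "B / D"] AD show ?thesis by (simp add: power2_eq_square field_simps)
  qed
  then have "sqrt (B\<^sup>2) \<le> sqrt (A * D)" by (rule real_sqrt_le_mono)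
  then show ?thesis by (simp add: real_sqrt_mult A_def B_def D_def)
qed

lemma test_function_deriv:
  assumes "\<phi> \<in> test_functions S"
  shows "(\<phi> has_real_derivative deriv \<phi> x) (at x)" "continuous_on A \<phi>" "continuous_on A (deriv \<phi>)"
proof -
  have d: "(deriv ^^ n) \<phi> field_differentiable at x" for n x
    using assms by (auto simp: test_functions_def)
  show "(\<phi> has_real_derivative deriv \<phi> x) (at x)" for x
    using d[of 0 x] by (simp add: field_differentiable_derivI)
  then show "continuous_on A \<phi>"
    by (meson DERIV_continuous continuous_at_imp_continuous_on)
  show "continuous_on A (deriv \<phi>)"
    using d[of 1] by (auto intro!: continuous_at_imp_continuous_on field_differentiable_imp_continuous_at)
qed

lemma test_function_C1:
  assumes "p < q" "\<And>x. (F has_real_derivative F' x) (at x)" "continuous_on UNIV F'" "\<phi> \<in> test_functions {p<..<q}"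
  shows "(LINT x|lebesgue_on {p<..<q}. F x * deriv \<phi> x) = - (LINT x|lebesgue_on {p<..<q}. F' x * \<phi> x)"
proof -
  have F: "continuous_on A F" for A
    using assms(2) by (meson DERIV_continuous continuous_at_imp_continuous_on)
  have F': "continuous_on A F'" for A using assms(3) continuous_on_subset by blast
  note \<phi> = test_function_deriv[OF assms(4)]
  obtain K where K: "K \<subseteq> {p<..<q}" "\<And>x. x \<notin> K \<Longrightarrow> \<phi> x = 0" using assms(4) by (auto simp: test_functions_def)
  have z: "\<phi> p = 0" "\<phi> q = 0" by (rule K(2); use K(1) in auto)+
  have "((\<lambda>x. F x * deriv \<phi> x + F' x * \<phi> x) has_integral (F q * \<phi> q - F p * \<phi> p)) {p..q}"
  proof (rule fundamental_theorem_of_calculus)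
    show "((\<lambda>x. F x * \<phi> x) has_vector_derivative F x * deriv \<phi> x + F' x * \<phi> x) (at x within {p..q})" for x
      unfolding has_real_derivative_iff_has_vector_derivative[symmetric]
      by (rule DERIV_subset[OF _ subset_UNIV]) (auto intro!: derivative_eq_intros assms(2) \<phi>(1))
  qed (use assms(1) in simp)
  then have 0: "((\<lambda>x. F x * deriv \<phi> x + F' x * \<phi> x) has_integral 0) {p<..<q}"
    using z by (simp add: has_integral_Icc_iff_Ioo)
  have i: "integrable (lebesgue_on {p<..<q}) (\<lambda>x. F x * deriv \<phi> x)"
    "integrable (lebesgue_on {p<..<q}) (\<lambda>x. F' x * \<phi> x)"
    by (intro L2_mult_integrable L2_continuous F F' \<phi>)+
  have "integral\<^sup>L (lebesgue_on {p<..<q}) (\<lambda>x. F x * deriv \<phi> x + F' x * \<phi> x) = 0"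
    by (rule trans[OF lebesgue_integral_eq_integral integral_unique[OF 0]])
       (auto intro!: Bochner_Integration.integrable_add i)
  then show ?thesis using i by simp
qed

lemma is_weak_deriv_C1:
  assumes "p < q" "\<And>x. (F has_real_derivative F' x) (at x)" "continuous_on UNIV F'"
  shows "is_weak_deriv {p<..<q} F F'"
proof -
  have "continuous_on UNIV F"
    using assms(2) by (meson DERIV_continuous continuous_at_imp_continuous_on)
  then show ?thesis
    unfolding is_weak_deriv_def using test_function_C1[OF assms] assms(3)
    by (auto intro!: L2_continuous elim: continuous_on_subset)
qed

lemma is_weak_deriv_test_function:
  assumes "p < q" "\<phi> \<in> test_functions {p<..<q}"
  shows "is_weak_deriv {p<..<q} \<phi> (deriv \<phi>)"
  using assms test_function_deriv by (intro is_weak_deriv_C1) auto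

lemma is_weak_deriv_lincomb:
  assumes "is_weak_deriv {p<..<q} f f'" "is_weak_deriv {p<..<q} g g'" "p < q"
  shows "is_weak_deriv {p<..<q} (\<lambda>x. a * f x + b * g x) (\<lambda>x. a * f' x + b * g' x)"
  unfolding is_weak_deriv_def
proof (intro conjI ballI)
  have L: "f \<in> L2 {p<..<q}" "f' \<in> L2 {p<..<q}" "g \<in> L2 {p<..<q}" "g' \<in> L2 {p<..<q}"
    using assms by (auto simp: is_weak_deriv_def)
  then show "(\<lambda>x. a * f x + b * g x) \<in> L2 {p<..<q}" "(\<lambda>x. a * f' x + b * g' x) \<in> L2 {p<..<q}"
    by (auto intro: L2_lincomb)
  fix \<phi> assume \<phi>: "\<phi> \<in> test_functions {p<..<q}"
  have \<phi>L: "\<phi> \<in> L2 {p<..<q}" "deriv \<phi> \<in> L2 {p<..<q}"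
    using test_function_deriv[OF \<phi>] by (auto intro!: L2_continuous)
  have e: "(LINT x|lebesgue_on {p<..<q}. (a * u x + b * v x) * w x) =
    a * (LINT x|lebesgue_on {p<..<q}. u x * w x) + b * (LINT x|lebesgue_on {p<..<q}. v x * w x)"
    if "u \<in> L2 {p<..<q}" "v \<in> L2 {p<..<q}" "w \<in> L2 {p<..<q}" for u v w
  proof -
    have "(a * u x + b * v x) * w x = a * (u x * w x) + b * (v x * w x)" for x by (simp add: algebra_simps)
    then show ?thesis using that by (simp add: L2_mult_integrable)
  qed
  show "(LINT x|lebesgue_on {p<..<q}. (a * f x + b * g x) * deriv \<phi> x) =
      - (LINT x|lebesgue_on {p<..<q}. (a * f' x + b * g' x) * \<phi> x)"
    unfolding e[OF L(1,3) \<phi>L(2)] e[OF L(2,4) \<phi>L(1)]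
    using assms(1,2) \<phi> by (simp add: is_weak_deriv_def)
qed

text \<open>The cut-offs of the interval from \<open>a\<close> to \<open>q\<close> are test
  functions and converge boundedly to its indicator. Half-lines generate the Borel sets, so this
  prepares the uniqueness of measures.\<close>

lemma integral_zero_Ioo:
  assumes f: "integrable (lebesgue_on {p<..<q}) f"
    and test: "\<And>\<phi>. \<phi> \<in> test_functions {p<..<q} \<Longrightarrow> (LINT x|lebesgue_on {p<..<q}. f x * \<phi> x) = 0"
    and "p \<le> a"
  shows "(LINT x|lebesgue_on {p<..<q}. f x * indicator {a<..<q} x) = (0::real)"
proof -
  have "(\<lambda>n. LINT x|lebesgue_on {p<..<q}. f x * cutoff a q n x) \<longlonglongrightarrow>
      (LINT x|lebesgue_on {p<..<q}. f x * indicator {a<..<q} x)"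
  proof (rule integral_dominated_convergence[where w = "\<lambda>x. norm (f x)"])
    show "(\<lambda>x. f x * cutoff a q n x) \<in> borel_measurable (lebesgue_on {p<..<q})" for n
      using f by (intro borel_measurable_times borel_measurable_integrable measurable_lebesgue_on_Ioo
          smooth_alg_continuous cutoff_smooth_alg)
    have "(\<lambda>x. indicat_real {a<..<q} x) \<in> borel_measurable (lebesgue_on {p<..<q})"
      by (intro measurable_restrict_space1 borel_measurable_indicator) simp
    then show "(\<lambda>x. f x * indicat_real {a<..<q} x) \<in> borel_measurable (lebesgue_on {p<..<q})"
      by (rule borel_measurable_times[OF borel_measurable_integrable[OF f]])
    show "AE x in lebesgue_on {p<..<q}. (\<lambda>n. f x * cutoff a q n x) \<longlonglongrightarrow> f x * indicator {a<..<q} x"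
      by (intro AE_I2 tendsto_mult tendsto_const cutoff_tendsto_indicator)
    show "AE x in lebesgue_on {p<..<q}. norm (f x * cutoff a q n x) \<le> norm (f x)" for n
      using cutoff_bounds by (auto simp: abs_mult intro!: AE_I2 mult_right_le_one_le)
  qed (use f in simp)
  moreover have "(LINT x|lebesgue_on {p<..<q}. f x * cutoff a q n x) = 0" for n
    using assms by (intro test cutoff_test_function) auto
  ultimately show ?thesis by (simp add: LIMSEQ_const_iff)
qed

text \<open>The positive and the negative part of \<open>f\<close> are densities of measures that agree on half-lines.\<close>

lemma AE_zero_if_test_zero:
  fixes f :: "real \<Rightarrow> real"
  assumes f: "integrable (lebesgue_on {p<..<q}) f"
    and test: "\<And>\<phi>. \<phi> \<in> test_functions {p<..<q} \<Longrightarrow> (LINT x|lebesgue_on {p<..<q}. f x * \<phi> x) = 0"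
  shows "AE x in lebesgue_on {p<..<q}. f x = 0"
proof -
  define g where "g x = indicator {p<..<q} x * f x" for x
  have gi: "integrable lebesgue g"
    using f by (simp add: g_def[abs_def] integrable_restrict_space)
  then obtain h where h[measurable]: "h \<in> borel_measurable lborel" and gh: "AE x in lborel. g x = h x"
    using completion_ex_borel_measurable_real[of g lborel] by auto
  have gh': "AE x in lebesgue. g x = h x" by (rule AE_completion[OF gh])
  have hi: "integrable lborel h"
  proof -
    have "integrable lebesgue h"
      by (rule integrable_cong_AE_imp[OF gi measurable_completion[OF h] gh'])
    then show ?thesis by (simp add: integrable_completion)
  qed
  define M where "M s = density lborel (\<lambda>x. ennreal (s * h x))" for s :: real
  have fin: "(\<integral>\<^sup>+x. ennreal (s * h x) * indicator {a<..} x \<partial>lborel) = ennreal (LINT x|lborel. max 0 (s * h x) * indicator {a<..} x)" for s a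
  proof -
    have "(\<integral>\<^sup>+x. ennreal (s * h x) * indicator {a<..} x \<partial>lborel) = (\<integral>\<^sup>+x. ennreal (max 0 (s * h x) * indicator {a<..} x) \<partial>lborel)"
      by (intro nn_integral_cong) (auto simp: indicator_def ennreal_max_0)
    also have "\<dots> = ennreal (LINT x|lborel. max 0 (s * h x) * indicator {a<..} x)"
      using hi by (intro nn_integral_eq_integral) (auto intro!: integrable_real_mult_indicator integrable_max)
    finally show ?thesis .
  qed
  have tail: "(LINT x|lborel. h x * indicator {a<..} x) = 0" for a
  proof -
    have "(LINT x|lborel. h x * indicator {a<..} x) = (LINT x|lebesgue. h x * indicator {a<..} x)"
      by (rule integral_completion[symmetric]) measurable
    also have "\<dots> = (LINT x|lebesgue. indicator {p<..<q} x *\<^sub>R (f x * indicator {max a p<..<q} x))"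
    proof (rule integral_cong_AE)
      show "(\<lambda>x. h x * indicat_real {a<..} x) \<in> borel_measurable lebesgue"
        by (intro measurable_completion) measurable
      have "(\<lambda>x. g x * indicat_real {max a p<..<q} x) \<in> borel_measurable lebesgue"
        using gi by (intro borel_measurable_times borel_measurable_integrable borel_measurable_indicator) auto
      then show "(\<lambda>x. indicat_real {p<..<q} x *\<^sub>R (f x * indicat_real {max a p<..<q} x)) \<in> borel_measurable lebesgue"
        by (simp add: g_def mult.assoc)
      show "AE x in lebesgue. h x * indicat_real {a<..} x = indicat_real {p<..<q} x *\<^sub>R (f x * indicat_real {max a p<..<q} x)"
        using gh' by eventually_elim (auto simp: g_def indicator_def split: if_splits)
    qed
    also have "\<dots> = (LINT x|lebesgue_on {p<..<q}. f x * indicator {max a p<..<q} x)"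
      by (simp add: integral_restrict_space)
    also have "\<dots> = 0" by (rule integral_zero_Ioo[OF f test]) auto
    finally show ?thesis .
  qed
  have "M 1 = M (-1)"
  proof (rule measure_eqI_lessThan)
    fix a
    have em: "emeasure (M s) {a<..} = ennreal (LINT x|lborel. max 0 (s * h x) * indicator {a<..} x)" for s
      unfolding M_def by (subst emeasure_density) (auto simp: fin)
    then show "emeasure (M 1) {a<..} < \<infinity>" by simp
    have mi: "integrable lborel (\<lambda>x. max 0 (s * h x) * indicator {a<..} x)" for s
      using hi by (intro integrable_real_mult_indicator integrable_max) auto
    have "(LINT x|lborel. max 0 (1 * h x) * indicator {a<..} x) - (LINT x|lborel. max 0 (-1 * h x) * indicator {a<..} x) =
       (LINT x|lborel. max 0 (1 * h x) * indicator {a<..} x - max 0 (-1 * h x) * indicator {a<..} x)"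
      by (rule Bochner_Integration.integral_diff[OF mi mi, symmetric])
    also have "\<dots> = (LINT x|lborel. h x * indicator {a<..} x)"
      by (intro Bochner_Integration.integral_cong) (auto simp: indicator_def)
    finally have "(LINT x|lborel. max 0 (1 * h x) * indicator {a<..} x) - (LINT x|lborel. max 0 (-1 * h x) * indicator {a<..} x) =
       (LINT x|lborel. h x * indicator {a<..} x)" .
    then show "emeasure (M 1) {a<..} = emeasure (M (-1)) {a<..}"
      unfolding em tail by simp
  qed (auto simp: M_def)
  then have "AE x in lborel. ennreal (1 * h x) = ennreal (-1 * h x)"
    unfolding M_def by (intro sigma_finite_measure.density_unique[OF sigma_finite_lborel]) auto
  then have "AE x in lborel. h x = 0"
    by eventually_elim (metis ennreal_eq_zero_iff linorder_le_cases mult_1 mult_minus1 neg_0_le_iff_le neg_le_0_iff_le order_antisym ennreal_neg)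
  then have "AE x in lebesgue. h x = 0" by (rule AE_completion)
  with gh' have "AE x in lebesgue. x \<in> {p<..<q} \<longrightarrow> f x = 0"
    by eventually_elim (auto simp: g_def)
  then show ?thesis by (simp add: AE_restrict_space_iff)
qed

lemma weak_deriv_unique:
  assumes "is_weak_deriv {p<..<q} f g" "is_weak_deriv {p<..<q} f h"
  shows "AE x in lebesgue_on {p<..<q}. g x = h x"
proof -
  have L: "g \<in> L2 {p<..<q}" "h \<in> L2 {p<..<q}" using assms by (auto simp: is_weak_deriv_def)
  have "AE x in lebesgue_on {p<..<q}. g x - h x = 0"
  proof (rule AE_zero_if_test_zero)
    show "integrable (lebesgue_on {p<..<q}) (\<lambda>x. g x - h x)"
      by (intro L2_integrable L2_diff L)
    fix \<phi> assume \<phi>: "\<phi> \<in> test_functions {p<..<q}"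
    have \<phi>L: "\<phi> \<in> L2 {p<..<q}" by (rule L2_continuous[OF test_function_deriv(2)[OF \<phi>]])
    have "(LINT x|lebesgue_on {p<..<q}. g x * \<phi> x) = (LINT x|lebesgue_on {p<..<q}. h x * \<phi> x)"
      using assms \<phi> by (simp add: is_weak_deriv_def)
    then show "(LINT x|lebesgue_on {p<..<q}. (g x - h x) * \<phi> x) = 0"
      using L \<phi>L by (simp add: left_diff_distrib L2_mult_integrable)
  qed
  then show ?thesis by eventually_elim simp
qed

lemma H1_is_weak_deriv: "f \<in> H1 S \<Longrightarrow> is_weak_deriv S f (weak_deriv S f)"
  unfolding H1_def weak_deriv_def mem_Collect_eq by (rule someI_ex[of "is_weak_deriv S f"])

lemma is_weak_deriv_H1: "is_weak_deriv S f g \<Longrightarrow> f \<in> H1 S"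
  by (auto simp: H1_def)

text \<open>\<open>weak_deriv\<close> picks an arbitrary representative, so explicit derivatives are
  accessible only through this equality almost everywhere.\<close>

lemma weak_deriv_AE:
  assumes "is_weak_deriv {p<..<q} f g"
  shows "AE x in lebesgue_on {p<..<q}. weak_deriv {p<..<q} f x = g x"
  by (rule weak_deriv_unique[OF H1_is_weak_deriv[OF is_weak_deriv_H1[OF assms]] assms])

lemma is_weak_deriv_L2:
  assumes "is_weak_deriv S f g"
  shows "f \<in> L2 S" "g \<in> L2 S"
  using assms by (auto simp: is_weak_deriv_def)

lemma integral_cong_AE_L2:
  assumes "AE x in lebesgue_on S. f x = g x" "f \<in> L2 S" "g \<in> L2 S" "h \<in> borel_measurable (lebesgue_on S)"
  shows "(LINT x|lebesgue_on S. f x * h x) = (LINT x|lebesgue_on S. g x * h x)"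
    and "(LINT x|lebesgue_on S. (f x)\<^sup>2) = (LINT x|lebesgue_on S. (g x)\<^sup>2)"
  using assms L2_measurable
  by (auto intro!: integral_cong_AE)

lemma H1_norm_eq:
  assumes "is_weak_deriv {p<..<q} f g"
  shows "H1_norm {p<..<q} f = sqrt ((LINT x|lebesgue_on {p<..<q}. (f x)\<^sup>2) + (LINT x|lebesgue_on {p<..<q}. (g x)\<^sup>2))"
  using integral_cong_AE_L2(2)[OF weak_deriv_AE[OF assms] is_weak_deriv_L2(2)[OF H1_is_weak_deriv[OF is_weak_deriv_H1[OF assms]]]
      is_weak_deriv_L2(2)[OF assms], of "\<lambda>_. 0"]
  by (simp add: H1_norm_def)

lemma is_weak_deriv_diff:
  assumes "is_weak_deriv {p<..<q} f f'" "is_weak_deriv {p<..<q} g g'" "p < q"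
  shows "is_weak_deriv {p<..<q} (\<lambda>x. f x - g x) (\<lambda>x. f' x - g' x)"
  using is_weak_deriv_lincomb[OF assms, of 1 "-1"] by simp

text \<open>For test functions this is the definition of the weak derivative; by Cauchy-Schwarz both
  sides depend continuously on \<Phi> in the \<open>H1_norm\<close>, so the identity extends to the
  closure.\<close>

lemma weak_deriv_H10:
  assumes "p < q" "is_weak_deriv {p<..<q} f g" "\<Phi> \<in> H10 {p<..<q}"
  shows "(LINT x|lebesgue_on {p<..<q}. f x * weak_deriv {p<..<q} \<Phi> x) = - (LINT x|lebesgue_on {p<..<q}. g x * \<Phi> x)"
proof -
  let ?S = "{p<..<q}"
  obtain \<phi> where \<phi>: "\<And>n::nat. \<phi> n \<in> test_functions ?S"
    and lim: "(\<lambda>n. H1_norm ?S (\<lambda>x. \<Phi> x - \<phi> n x)) \<longlonglongrightarrow> 0" and H1: "\<Phi> \<in> H1 ?S"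
    using assms(3) by (auto simp: H10_def)
  note wd\<Phi> = H1_is_weak_deriv[OF H1]
  note wd\<phi> = is_weak_deriv_test_function[OF assms(1) \<phi>]
  note wd = is_weak_deriv_diff[OF wd\<Phi> wd\<phi> assms(1)]
  note L = is_weak_deriv_L2[OF assms(2)] is_weak_deriv_L2[OF wd\<Phi>] is_weak_deriv_L2[OF wd\<phi>]
  let ?a = "\<lambda>n. LINT x|lebesgue_on ?S. (weak_deriv ?S \<Phi> x - deriv (\<phi> n) x)\<^sup>2"
  let ?b = "\<lambda>n. LINT x|lebesgue_on ?S. (\<Phi> x - \<phi> n x)\<^sup>2"
  define A where "A = (LINT x|lebesgue_on ?S. f x * weak_deriv ?S \<Phi> x)"
  define B where "B = (LINT x|lebesgue_on ?S. g x * \<Phi> x)"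
  define c where "c = sqrt (LINT x|lebesgue_on ?S. (f x)\<^sup>2) + sqrt (LINT x|lebesgue_on ?S. (g x)\<^sup>2)"
  have "\<bar>A + B\<bar> \<le> c * H1_norm ?S (\<lambda>x. \<Phi> x - \<phi> n x)" for n
  proof -
    have N: "H1_norm ?S (\<lambda>x. \<Phi> x - \<phi> n x) = sqrt (?b n + ?a n)" by (rule H1_norm_eq[OF wd])
    have "(LINT x|lebesgue_on ?S. f x * deriv (\<phi> n) x) = - (LINT x|lebesgue_on ?S. g x * \<phi> n x)"
      using assms(2) \<phi> by (simp add: is_weak_deriv_def)
    moreover have "(LINT x|lebesgue_on ?S. f x * (weak_deriv ?S \<Phi> x - deriv (\<phi> n) x)) = A - (LINT x|lebesgue_on ?S. f x * deriv (\<phi> n) x)"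
      unfolding A_def using L by (simp add: right_diff_distrib L2_mult_integrable)
    moreover have "(LINT x|lebesgue_on ?S. g x * (\<Phi> x - \<phi> n x)) = B - (LINT x|lebesgue_on ?S. g x * \<phi> n x)"
      unfolding B_def using L by (simp add: right_diff_distrib L2_mult_integrable)
    ultimately have "A + B = (LINT x|lebesgue_on ?S. f x * (weak_deriv ?S \<Phi> x - deriv (\<phi> n) x)) + (LINT x|lebesgue_on ?S. g x * (\<Phi> x - \<phi> n x))"
      by simp
    then have "\<bar>A + B\<bar> \<le> \<bar>LINT x|lebesgue_on ?S. f x * (weak_deriv ?S \<Phi> x - deriv (\<phi> n) x)\<bar> + \<bar>LINT x|lebesgue_on ?S. g x * (\<Phi> x - \<phi> n x)\<bar>"
      by simp
    also have "\<dots> \<le> sqrt (LINT x|lebesgue_on ?S. (f x)\<^sup>2) * sqrt (?a n) + sqrt (LINT x|lebesgue_on ?S. (g x)\<^sup>2) * sqrt (?b n)"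
      by (intro add_mono L2_Cauchy_Schwarz L2_diff L)
    also have "\<dots> \<le> sqrt (LINT x|lebesgue_on ?S. (f x)\<^sup>2) * sqrt (?b n + ?a n) + sqrt (LINT x|lebesgue_on ?S. (g x)\<^sup>2) * sqrt (?b n + ?a n)"
      by (intro add_mono mult_left_mono real_sqrt_le_mono) auto
    finally show ?thesis by (simp add: N c_def distrib_right)
  qed
  moreover have "(\<lambda>n. c * H1_norm ?S (\<lambda>x. \<Phi> x - \<phi> n x)) \<longlonglongrightarrow> c * 0"
    by (intro tendsto_mult tendsto_const lim)
  ultimately have "\<bar>A + B\<bar> \<le> c * 0"
    by (intro tendsto_lowerbound[of "\<lambda>n. c * H1_norm ?S (\<lambda>x. \<Phi> x - \<phi> n x)"]) auto
  then show ?thesis by (simp add: A_def B_def)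
qed

text \<open>The derivative of \<open>cutoff\<close> is of order \<open>n\<close>, but only at distance of order \<open>1 / n\<close> from the endpoints,
  where \<open>F\<close> is of order \<open>1 / n\<close>.\<close>

lemma smooth_alg_H10:
  assumes "p < q" "F \<in> smooth_alg" "F p = 0" "F q = 0"
  shows "F \<in> H10 {p<..<q}"
proof -
  let ?S = "{p<..<q}"
  define \<phi> where "\<phi> n x = F x * cutoff p q n x" for n x
  have \<phi>: "\<phi> n \<in> test_functions ?S" for n
    unfolding \<phi>_def using mult_cutoff_test_function[OF assms(2), of p p q q] by simp
  note F = smooth_alg_deriv[OF assms(2)]
  have Fc: "continuous_on A F" "continuous_on A (deriv F)" for A
    using smooth_alg_continuous assms(2) F(1) by auto
  have wdF: "is_weak_deriv ?S F (deriv F)"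
    by (rule is_weak_deriv_C1[OF assms(1) F(2) Fc(2)])
  obtain B where B: "0 < B" "\<And>x. x \<in> {p..q} \<Longrightarrow> \<bar>deriv F x\<bar> \<le> B"
    using continuous_bounded_Icc[OF Fc(2)] by blast
  obtain B0 where B0: "0 < B0" "\<And>x. x \<in> {p..q} \<Longrightarrow> \<bar>F x\<bar> \<le> B0"
    using continuous_bounded_Icc[OF Fc(1)] by blast
  have lip: "\<bar>F x - F y\<bar> \<le> B * \<bar>x - y\<bar>" if "x \<in> {p..q}" "y \<in> {p..q}" for x y
    using field_differentiable_bound[of "{p..q}" F "deriv F" B x y] that B(2) F(2)
    by (auto simp: DERIV_subset[OF _ subset_UNIV])
  define c' where "c' n x = real (Suc n) * bump' (real (Suc n) * (x - p) - 1) * bump (real (Suc n) * (q - x) - 1)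
      - real (Suc n) * bump' (real (Suc n) * (q - x) - 1) * bump (real (Suc n) * (x - p) - 1)" for n x
  have dc: "(cutoff p q n has_real_derivative c' n x) (at x)" for n x
    unfolding cutoff_def[abs_def] c'_def
    by (auto intro!: derivative_eq_intros DERIV_chain2[OF bump_deriv] simp: algebra_simps)
  have d\<phi>: "deriv (\<phi> n) x = deriv F x * cutoff p q n x + F x * c' n x" for n x
    unfolding \<phi>_def by (rule DERIV_imp_deriv) (auto intro!: derivative_eq_intros F(2) dc)
  have one: "\<bar>F x * (real (Suc n) * bump' (real (Suc n) * \<bar>x - z\<bar> - 1) * bump y)\<bar> \<le>
      B * ((real (Suc n) * \<bar>x - z\<bar> - 1 + 1) * bump' (real (Suc n) * \<bar>x - z\<bar> - 1))"
    if "x \<in> {p..q}" "z \<in> {p, q}" for n x y z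
  proof -
    have "\<bar>F x\<bar> \<le> B * \<bar>x - z\<bar>" using lip[of x z] that assms by auto
    moreover have b0: "0 \<le> bump' y" for y by (auto simp: bump'_def)
    moreover have "\<bar>bump y\<bar> \<le> 1" using bump_bounds[of y] by simp
    ultimately have "\<bar>F x\<bar> * (real (Suc n) * bump' (real (Suc n) * \<bar>x - z\<bar> - 1) * \<bar>bump y\<bar>) \<le>
      (B * \<bar>x - z\<bar>) * (real (Suc n) * bump' (real (Suc n) * \<bar>x - z\<bar> - 1) * 1)"
      using B(1) by (intro mult_mono mult_left_mono) auto
    then show ?thesis using b0 by (simp add: abs_mult mult_ac)
  qed
  have Fc'_le: "\<bar>F x * c' n x\<bar> \<le>
     B * ((real (Suc n) * \<bar>x - p\<bar> - 1 + 1) * bump' (real (Suc n) * \<bar>x - p\<bar> - 1)) +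
     B * ((real (Suc n) * \<bar>x - q\<bar> - 1 + 1) * bump' (real (Suc n) * \<bar>x - q\<bar> - 1))" if x: "x \<in> ?S" for n x
  proof -
    have "x - p = \<bar>x - p\<bar>" "q - x = \<bar>x - q\<bar>" using x by auto
    then have "F x * c' n x = F x * (real (Suc n) * bump' (real (Suc n) * \<bar>x - p\<bar> - 1) * bump (real (Suc n) * \<bar>x - q\<bar> - 1))
      - F x * (real (Suc n) * bump' (real (Suc n) * \<bar>x - q\<bar> - 1) * bump (real (Suc n) * \<bar>x - p\<bar> - 1))"
      by (simp only: c'_def right_diff_distrib)
    then have "\<bar>F x * c' n x\<bar> \<le> \<bar>F x * (real (Suc n) * bump' (real (Suc n) * \<bar>x - p\<bar> - 1) * bump (real (Suc n) * \<bar>x - q\<bar> - 1))\<bar>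
      + \<bar>F x * (real (Suc n) * bump' (real (Suc n) * \<bar>x - q\<bar> - 1) * bump (real (Suc n) * \<bar>x - p\<bar> - 1))\<bar>"
      by (simp only: abs_triangle_ineq4)
    also have "\<dots> \<le> B * ((real (Suc n) * \<bar>x - p\<bar> - 1 + 1) * bump' (real (Suc n) * \<bar>x - p\<bar> - 1)) +
       B * ((real (Suc n) * \<bar>x - q\<bar> - 1 + 1) * bump' (real (Suc n) * \<bar>x - q\<bar> - 1))"
      using x by (intro add_mono one) auto
    finally show ?thesis .
  qed
  \<comment> \<open>Each endpoint contributes \<open>3 * B\<close>, by
    \<open>bump'_bound\<close>.\<close>
  have Fc'_bd: "\<bar>F x * c' n x\<bar> \<le> 6 * B" if x: "x \<in> ?S" for n x
  proof -
    have "B * ((y + 1) * bump' y) \<le> B * 3" for y using B(1) bump'_bound(2) by (intro mult_left_mono) auto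
    from order_trans[OF Fc'_le[OF x] add_mono[OF this this]] show ?thesis by simp
  qed
  have Fc'_lim: "(\<lambda>n. F x * c' n x) \<longlonglongrightarrow> 0" if x: "x \<in> ?S" for x
  proof (rule Lim_null_comparison)
    show "eventually (\<lambda>n. norm (F x * c' n x) \<le>
       B * ((real (Suc n) * \<bar>x - p\<bar> - 1 + 1) * bump' (real (Suc n) * \<bar>x - p\<bar> - 1)) +
       B * ((real (Suc n) * \<bar>x - q\<bar> - 1 + 1) * bump' (real (Suc n) * \<bar>x - q\<bar> - 1))) sequentially"
      using Fc'_le[OF x] by (intro always_eventually allI) (simp only: real_norm_def)
    have "(\<lambda>n. B * ((real (Suc n) * \<bar>x - p\<bar> - 1 + 1) * bump' (real (Suc n) * \<bar>x - p\<bar> - 1)) +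
       B * ((real (Suc n) * \<bar>x - q\<bar> - 1 + 1) * bump' (real (Suc n) * \<bar>x - q\<bar> - 1))) \<longlonglongrightarrow> B * 0 + B * 0"
      by (intro tendsto_add tendsto_mult_left filterlim_compose[OF bump'_tendsto] filterlim_Suc_mult_minus_1)
         (use x in auto)
    then show "(\<lambda>n. B * ((real (Suc n) * \<bar>x - p\<bar> - 1 + 1) * bump' (real (Suc n) * \<bar>x - p\<bar> - 1)) +
       B * ((real (Suc n) * \<bar>x - q\<bar> - 1 + 1) * bump' (real (Suc n) * \<bar>x - q\<bar> - 1))) \<longlonglongrightarrow> 0" by simp
  qed
  have I: "(\<lambda>n. LINT x|lebesgue_on ?S. (u n x)\<^sup>2) \<longlonglongrightarrow> 0"
    if m: "\<And>n. u n \<in> borel_measurable (lebesgue_on ?S)" and b: "\<And>n x. x \<in> ?S \<Longrightarrow> \<bar>u n x\<bar> \<le> M"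
      and l: "\<And>x. x \<in> ?S \<Longrightarrow> (\<lambda>n. u n x) \<longlonglongrightarrow> 0" for u and M :: real
  proof -
    have "(\<lambda>n. LINT x|lebesgue_on ?S. (u n x)\<^sup>2) \<longlonglongrightarrow> (LINT x|lebesgue_on ?S. 0\<^sup>2)"
    proof (rule integral_dominated_convergence[where w = "\<lambda>_. M\<^sup>2"])
      show "(\<lambda>x. (u n x)\<^sup>2) \<in> borel_measurable (lebesgue_on ?S)" for n using m by measurable
      show "integrable (lebesgue_on ?S) (\<lambda>_. M\<^sup>2)"
        by (rule integrable_bounded_Ioo[where B = "M\<^sup>2"]) auto
      show "AE x in lebesgue_on ?S. (\<lambda>n. (u n x)\<^sup>2) \<longlonglongrightarrow> 0\<^sup>2"
        by (intro AE_I2 tendsto_power l) simp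
      show "AE x in lebesgue_on ?S. norm ((u n x)\<^sup>2) \<le> M\<^sup>2" for n
      proof (rule AE_I2)
        fix x assume "x \<in> space (lebesgue_on ?S)"
        then have "\<bar>u n x\<bar>\<^sup>2 \<le> M\<^sup>2" using b[of x n] by (intro power_mono) auto
        then show "norm ((u n x)\<^sup>2) \<le> M\<^sup>2" by simp
      qed
    qed simp
    then show ?thesis by simp
  qed
  have cm: "u \<in> borel_measurable (lebesgue_on ?S)" if "continuous_on UNIV u" for u :: "real \<Rightarrow> real"
    by (rule measurable_lebesgue_on_Ioo[OF continuous_on_subset[OF that]]) simp
  have "(\<lambda>n. LINT x|lebesgue_on ?S. (F x - \<phi> n x)\<^sup>2) \<longlonglongrightarrow> 0"
  proof (rule I[where M = B0])
    show "(\<lambda>x. F x - \<phi> n x) \<in> borel_measurable (lebesgue_on ?S)" for n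
      by (intro cm continuous_on_diff Fc test_function_deriv[OF \<phi>])
    fix x assume x: "x \<in> ?S"
    show "\<bar>F x - \<phi> n x\<bar> \<le> B0" for n
    proof -
      have "F x - \<phi> n x = F x * (1 - cutoff p q n x)" by (simp add: \<phi>_def algebra_simps)
      moreover have "\<bar>F x\<bar> * \<bar>1 - cutoff p q n x\<bar> \<le> B0 * 1"
        using B0 x cutoff_bounds[of p q n x] by (intro mult_mono) auto
      ultimately show ?thesis by (simp add: abs_mult)
    qed
    have "(\<lambda>n. F x - F x * cutoff p q n x) \<longlonglongrightarrow> F x - F x * 1"
      using x by (intro tendsto_intros cutoff_tendsto) auto
    then show "(\<lambda>n. F x - \<phi> n x) \<longlonglongrightarrow> 0" by (simp add: \<phi>_def)
  qed
  moreover have "(\<lambda>n. LINT x|lebesgue_on ?S. (deriv F x - deriv (\<phi> n) x)\<^sup>2) \<longlonglongrightarrow> 0"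
  proof (rule I[where M = "B + 6 * B"])
    show "(\<lambda>x. deriv F x - deriv (\<phi> n) x) \<in> borel_measurable (lebesgue_on ?S)" for n
      by (intro cm continuous_on_diff Fc test_function_deriv[OF \<phi>])
    fix x assume x: "x \<in> ?S"
    have e: "deriv F x - deriv (\<phi> n) x = deriv F x * (1 - cutoff p q n x) - F x * c' n x" for n
      by (simp add: d\<phi> algebra_simps)
    show "\<bar>deriv F x - deriv (\<phi> n) x\<bar> \<le> B + 6 * B" for n
    proof -
      have "\<bar>deriv F x\<bar> * \<bar>1 - cutoff p q n x\<bar> \<le> B * 1"
        using B x cutoff_bounds[of p q n x] by (intro mult_mono) auto
      then have "\<bar>deriv F x * (1 - cutoff p q n x)\<bar> \<le> B" by (simp add: abs_mult)
      then show ?thesis unfolding e using Fc'_bd[OF x, of n] by linarith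
    qed
    have "(\<lambda>n. deriv F x * (1 - cutoff p q n x) - F x * c' n x) \<longlonglongrightarrow> deriv F x * (1 - 1) - 0"
      using x by (intro tendsto_diff tendsto_mult tendsto_const cutoff_tendsto Fc'_lim) auto
    then show "(\<lambda>n. deriv F x - deriv (\<phi> n) x) \<longlonglongrightarrow> 0" unfolding e by simp
  qed
  ultimately have "(\<lambda>n. sqrt ((LINT x|lebesgue_on ?S. (F x - \<phi> n x)\<^sup>2) + (LINT x|lebesgue_on ?S. (deriv F x - deriv (\<phi> n) x)\<^sup>2))) \<longlonglongrightarrow> sqrt (0 + 0)"
    by (intro tendsto_intros)
  then have "(\<lambda>n. H1_norm ?S (\<lambda>x. F x - \<phi> n x)) \<longlonglongrightarrow> 0"
    by (simp add: H1_norm_eq[OF is_weak_deriv_diff[OF wdF is_weak_deriv_test_function[OF assms(1) \<phi>] assms(1)]])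
  then show ?thesis
    unfolding H10_def using is_weak_deriv_H1[OF wdF] \<phi> by blast
qed

section \<open>Completeness of the sine system\<close>

text \<open>\<open>sin (m \<theta>) cos \<theta>\<close> is half the sum of the sines with
  \<open>m + 1\<close> and \<open>m - 1\<close>, so the induction removes one power of the cosine at
  a time.\<close>

lemma sin_cos_power_orthogonal:
  fixes D :: "real \<Rightarrow> real"
  assumes D: "integrable (lebesgue_on {p<..<q}) D"
    and ortho: "\<And>n. (LINT x|lebesgue_on {p<..<q}. D x * sin (real (Suc n) * (w * (x - p)))) = 0"
  shows "(LINT x|lebesgue_on {p<..<q}. D x * (sin (real (Suc n) * (w * (x - p))) * cos (w * (x - p)) ^ k)) = 0"
proof (induction k arbitrary: n)
  case (Suc k)
  define \<theta> where "\<theta> x = w * (x - p)" for x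
  have cont: "continuous_on A (\<lambda>x. sin (real m * \<theta> x) * cos (\<theta> x) ^ k)" for A m
    unfolding \<theta>_def by (intro continuous_intros)
  have int: "integrable (lebesgue_on {p<..<q}) (\<lambda>x. D x * (sin (real m * \<theta> x) * cos (\<theta> x) ^ k))" for m
  proof (rule Bochner_Integration.integrable_bound[OF D])
    show "(\<lambda>x. D x * (sin (real m * \<theta> x) * cos (\<theta> x) ^ k)) \<in> borel_measurable (lebesgue_on {p<..<q})"
      by (intro borel_measurable_times[OF borel_measurable_integrable[OF D]] measurable_lebesgue_on_Ioo cont)
    have "\<bar>sin y * cos z ^ k\<bar> \<le> 1" for y z :: real
      by (simp add: abs_mult power_abs mult_le_one power_le_one)
    then show "AE x in lebesgue_on {p<..<q}. norm (D x * (sin (real m * \<theta> x) * cos (\<theta> x) ^ k)) \<le> norm (D x)"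
      unfolding real_norm_def abs_mult[of "D _"] by (intro AE_I2 mult_right_le_one_le) auto
  qed
  \<comment> \<open>Index \<open>m = 0\<close> occurs when stepping down from \<open>n = 0\<close>;
    there the sine vanishes.\<close>
  have z: "(LINT x|lebesgue_on {p<..<q}. D x * (sin (real m * \<theta> x) * cos (\<theta> x) ^ k)) = 0" for m
    using Suc[of "m - 1"] by (cases m) (auto simp: \<theta>_def)
  have e: "D x * (sin (real (Suc n) * \<theta> x) * cos (\<theta> x) ^ Suc k) =
      (1 / 2) * (D x * (sin (real (Suc (Suc n)) * \<theta> x) * cos (\<theta> x) ^ k)) +
      (1 / 2) * (D x * (sin (real n * \<theta> x) * cos (\<theta> x) ^ k))" for x
  proof -
    have "sin (real (Suc (Suc n)) * \<theta> x) = sin (real (Suc n) * \<theta> x + \<theta> x)"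
      "sin (real n * \<theta> x) = sin (real (Suc n) * \<theta> x - \<theta> x)"
      by (simp_all add: algebra_simps)
    then have "sin (real (Suc n) * \<theta> x) * cos (\<theta> x) =
       (1 / 2) * sin (real (Suc (Suc n)) * \<theta> x) + (1 / 2) * sin (real n * \<theta> x)"
      using sin_add[of "real (Suc n) * \<theta> x" "\<theta> x"] sin_diff[of "real (Suc n) * \<theta> x" "\<theta> x"] by linarith
    then have "sin (real (Suc n) * \<theta> x) * cos (\<theta> x) * (D x * cos (\<theta> x) ^ k) =
      ((1 / 2) * sin (real (Suc (Suc n)) * \<theta> x) + (1 / 2) * sin (real n * \<theta> x)) * (D x * cos (\<theta> x) ^ k)"
      by (simp only:)
    then show ?thesis by (simp add: algebra_simps del: of_nat_Suc)
  qed
  have "(LINT x|lebesgue_on {p<..<q}. D x * (sin (real (Suc n) * \<theta> x) * cos (\<theta> x) ^ Suc k)) = 0"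
    unfolding e using int z by (simp del: of_nat_Suc)
  then show ?case by (simp only: \<theta>_def)
qed (use ortho in simp)

text \<open>The polynomials in \<open>cos\<close> are dense in the continuous functions on \<open>[0, \<pi>]\<close>, and
  \<open>sin\<close> times such a polynomial is a linear combination of \<open>sin (n x)\<close>.\<close>

lemma sine_complete:
  assumes "p < q" and D: "integrable (lebesgue_on {p<..<q}) D"
    and ortho: "\<And>n. (LINT x|lebesgue_on {p<..<q}. D x * sin (real (Suc n) * (pi / (q - p) * (x - p)))) = (0::real)"
  shows "AE x in lebesgue_on {p<..<q}. D x = 0"
proof -
  define \<theta> where "\<theta> x = pi / (q - p) * (x - p)" for x
  have \<theta>: "0 < \<theta> x" "\<theta> x < pi" if "x \<in> {p<..<q}" for x
  proof -
    have "(x - p) / (q - p) < 1" "0 < (x - p) / (q - p)" using that assms(1) by auto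
    then have "pi * ((x - p) / (q - p)) < pi * 1" "0 < pi * ((x - p) / (q - p))"
      by (intro mult_strict_left_mono mult_pos_pos; simp)+
    then show "0 < \<theta> x" "\<theta> x < pi" by (simp_all add: \<theta>_def)
  qed
  have \<theta>c: "continuous_on A \<theta>" for A unfolding \<theta>_def by (intro continuous_intros)
  have bdd: "integrable (lebesgue_on {p<..<q}) (\<lambda>x. D x * u x)"
    if u: "continuous_on {p..q} u" for u
  proof -
    obtain B where B: "\<forall>x\<in>{p..q}. \<bar>u x\<bar> \<le> B" using continuous_bounded_Icc[OF u] by blast
    show ?thesis
    proof (rule Bochner_Integration.integrable_bound)
      show "integrable (lebesgue_on {p<..<q}) (\<lambda>x. \<bar>D x\<bar> * B)" using D by simp
      show "(\<lambda>x. D x * u x) \<in> borel_measurable (lebesgue_on {p<..<q})"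
        by (intro borel_measurable_times[OF borel_measurable_integrable[OF D]] measurable_lebesgue_on_Ioo u)
      show "AE x in lebesgue_on {p<..<q}. norm (D x * u x) \<le> norm (\<bar>D x\<bar> * B)"
      proof (rule AE_I2)
        fix x assume "x \<in> space (lebesgue_on {p<..<q})"
        then have "\<bar>u x\<bar> \<le> B" using B by simp
        then have "\<bar>D x\<bar> * \<bar>u x\<bar> \<le> \<bar>D x\<bar> * \<bar>B\<bar>" by (intro mult_left_mono) auto
        then show "norm (D x * u x) \<le> norm (\<bar>D x\<bar> * B)" by (simp add: abs_mult)
      qed
    qed
  qed
  have poly0: "(LINT x|lebesgue_on {p<..<q}. D x * (sin (\<theta> x) * P (cos (\<theta> x)))) = 0"
    if pf: "polynomial_function P" for P :: "real \<Rightarrow> real"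
  proof -
    obtain a n where P: "P = (\<lambda>x. \<Sum>i\<le>n. a i * x ^ i)"
      using pf unfolding real_polynomial_function_eq[symmetric] real_polynomial_function_iff_sum by blast
    have i: "integrable (lebesgue_on {p<..<q}) (\<lambda>x. a i * (D x * (sin (\<theta> x) * cos (\<theta> x) ^ i)))" for i
      by (intro integrable_mult_right bdd continuous_intros \<theta>c)
    have "(LINT x|lebesgue_on {p<..<q}. D x * (sin (\<theta> x) * P (cos (\<theta> x)))) =
      (LINT x|lebesgue_on {p<..<q}. (\<Sum>i\<le>n. a i * (D x * (sin (\<theta> x) * cos (\<theta> x) ^ i))))"
      unfolding P by (intro Bochner_Integration.integral_cong) (auto simp: sum_distrib_left mult_ac)
    also have "\<dots> = (\<Sum>i\<le>n. LINT x|lebesgue_on {p<..<q}. a i * (D x * (sin (\<theta> x) * cos (\<theta> x) ^ i)))"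
      by (rule Bochner_Integration.integral_sum) (rule i)
    also have "\<dots> = 0"
      using sin_cos_power_orthogonal[OF D ortho, of 0] by (simp add: \<theta>_def)
    finally show ?thesis .
  qed
  have cont0: "(LINT x|lebesgue_on {p<..<q}. D x * (sin (\<theta> x) * \<psi> x)) = 0" if \<psi>: "continuous_on {p..q} \<psi>" for \<psi>
  proof -
    \<comment> \<open>\<open>G\<close> is \<psi> in the variable \<open>cos (\<theta> x)\<close>;
      approximating \<open>G\<close> by polynomials on \<open>[-1, 1]\<close> approximates \<psi> by
      polynomials in the cosine.\<close>
    define G where "G y = \<psi> (p + (q - p) / pi * arccos y)" for y
    have "continuous_on {-1..1} G"
      unfolding G_def
    proof (rule continuous_on_compose2[OF \<psi>])
      show "continuous_on {-1..1} (\<lambda>y. p + (q - p) / pi * arccos y)"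
        by (intro continuous_intros continuous_on_arccos') auto
      show "(\<lambda>y. p + (q - p) / pi * arccos y) ` {-1..1} \<subseteq> {p..q}"
      proof safe
        fix y :: real assume y: "y \<in> {-1..1}"
        have "0 \<le> arccos y" "arccos y \<le> pi" using y by (auto intro: arccos_lbound arccos_ubound)
        then have "0 \<le> arccos y / pi" "arccos y / pi \<le> 1" by (auto simp: field_simps)
        then have "0 \<le> (q - p) * (arccos y / pi)" "(q - p) * (arccos y / pi) \<le> (q - p) * 1"
          using assms(1) by (auto intro!: mult_nonneg_nonneg mult_left_mono simp del: times_divide_eq_right)
        then show "p + (q - p) / pi * arccos y \<in> {p..q}" by simp
      qed
    qed
    moreover have G\<theta>: "G (cos (\<theta> x)) = \<psi> x" if "x \<in> {p<..<q}" for x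
      using \<theta>[OF that] assms(1) by (simp add: G_def arccos_cos) (simp add: \<theta>_def)
    ultimately have approx: "\<exists>P. polynomial_function P \<and> (\<forall>y\<in>{-1..1}. norm (G y - P y) < e)" if "0 < e" for e
      using Stone_Weierstrass_polynomial_function[of "{-1..1}" G e] that by auto
    define I where "I = (LINT x|lebesgue_on {p<..<q}. \<bar>D x\<bar>)"
    have bound: "\<bar>LINT x|lebesgue_on {p<..<q}. D x * (sin (\<theta> x) * \<psi> x)\<bar> \<le> e * I" if e0: "0 < e" for e
    proof -
      obtain P where P: "polynomial_function P" "\<forall>y\<in>{-1..1}. norm (G y - P y) < e" using approx[OF e0] by blast
      have Pc: "continuous_on {p..q} (\<lambda>x. P (cos (\<theta> x)))"
        by (rule continuous_on_compose2[OF continuous_on_polymonial_function[OF P(1), of UNIV]]) (auto intro!: continuous_intros \<theta>c)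
      have i: "integrable (lebesgue_on {p<..<q}) (\<lambda>x. D x * (sin (\<theta> x) * \<psi> x))"
        "integrable (lebesgue_on {p<..<q}) (\<lambda>x. D x * (sin (\<theta> x) * P (cos (\<theta> x))))"
        by (intro bdd continuous_intros \<theta>c \<psi> Pc)+
      have eq: "(LINT x|lebesgue_on {p<..<q}. D x * (sin (\<theta> x) * \<psi> x)) =
        (LINT x|lebesgue_on {p<..<q}. D x * (sin (\<theta> x) * \<psi> x) - D x * (sin (\<theta> x) * P (cos (\<theta> x))))"
        using i poly0[OF P(1)] by simp
      have "\<bar>LINT x|lebesgue_on {p<..<q}. D x * (sin (\<theta> x) * \<psi> x)\<bar> \<le> (LINT x|lebesgue_on {p<..<q}. \<bar>D x * (sin (\<theta> x) * \<psi> x) - D x * (sin (\<theta> x) * P (cos (\<theta> x)))\<bar>)"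
        unfolding eq by (rule integral_abs_bound)
      also have "\<dots> \<le> (LINT x|lebesgue_on {p<..<q}. e * \<bar>D x\<bar>)"
      proof (rule integral_mono)
        fix x assume "x \<in> space (lebesgue_on {p<..<q})"
        then have x: "x \<in> {p<..<q}" by simp
        have "norm (G (cos (\<theta> x)) - P (cos (\<theta> x))) < e"
          by (rule P(2)[rule_format]) simp
        then have "\<bar>\<psi> x - P (cos (\<theta> x))\<bar> \<le> e"
          unfolding G\<theta>[OF x] by (simp only: real_norm_def less_imp_le)
        then have "\<bar>D x\<bar> * (\<bar>sin (\<theta> x)\<bar> * \<bar>\<psi> x - P (cos (\<theta> x))\<bar>) \<le> \<bar>D x\<bar> * (1 * e)"
          by (intro mult_left_mono mult_mono) auto
        moreover have "D x * (sin (\<theta> x) * \<psi> x) - D x * (sin (\<theta> x) * P (cos (\<theta> x))) = D x * (sin (\<theta> x) * (\<psi> x - P (cos (\<theta> x))))"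
          by (simp add: algebra_simps)
        ultimately show "\<bar>D x * (sin (\<theta> x) * \<psi> x) - D x * (sin (\<theta> x) * P (cos (\<theta> x)))\<bar> \<le> e * \<bar>D x\<bar>"
          by (simp only: abs_mult mult_1 mult.commute[of e])
      qed (use i D in simp_all)
      finally show ?thesis by (simp add: I_def)
    qed
    have "\<bar>LINT x|lebesgue_on {p<..<q}. D x * (sin (\<theta> x) * \<psi> x)\<bar> \<le> 0"
    proof (rule field_le_epsilon)
      fix e :: real assume e: "0 < e"
      have I: "0 \<le> I" by (simp add: I_def)
      have "\<bar>LINT x|lebesgue_on {p<..<q}. D x * (sin (\<theta> x) * \<psi> x)\<bar> \<le> e / (I + 1) * I"
        using e I by (intro bound) simp
      also have "e / (I + 1) * I = e * (I / (I + 1))" by simp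
      also have "\<dots> \<le> e * 1" using e I by (intro mult_left_mono) auto
      finally show "\<bar>LINT x|lebesgue_on {p<..<q}. D x * (sin (\<theta> x) * \<psi> x)\<bar> \<le> 0 + e" by simp
    qed
    then show ?thesis by simp
  qed
  \<comment> \<open>So far only \<open>D\<close> times the sine is known to be orthogonal to all
    continuous functions; the sine is positive inside the interval and cancels.\<close>
  have "AE x in lebesgue_on {p<..<q}. D x * sin (\<theta> x) = 0"
  proof (rule AE_zero_if_test_zero)
    show "integrable (lebesgue_on {p<..<q}) (\<lambda>x. D x * sin (\<theta> x))"
      by (intro bdd continuous_intros \<theta>c)
    show "(LINT x|lebesgue_on {p<..<q}. D x * sin (\<theta> x) * \<phi> x) = 0" if "\<phi> \<in> test_functions {p<..<q}" for \<phi>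
      using cont0[OF test_function_deriv(2)[OF that]] by (simp add: mult.assoc)
  qed
  moreover have "sin (\<theta> x) \<noteq> 0" if "x \<in> {p<..<q}" for x
    using sin_gt_zero[of "\<theta> x"] \<theta>[OF that] by simp
  ultimately show ?thesis
    by (simp add: AE_restrict_space_iff)
qed

lemma continuous_AE_zero:
  fixes D :: "real \<Rightarrow> real"
  assumes D: "continuous_on {p<..<q} D" and ae: "AE x in lebesgue_on {p<..<q}. D x = 0"
    and x: "x \<in> {p<..<q}"
  shows "D x = 0"
proof (rule ccontr)
  assume "D x \<noteq> 0"
  have ae: "AE y in lebesgue. y \<in> {p<..<q} \<longrightarrow> D y = 0" using ae by (simp add: AE_restrict_space_iff)
  define U where "U = {p<..<q} \<inter> D -` (- {0})"
  have "open U"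
    unfolding U_def by (intro continuous_open_preimage D) auto
  moreover have "x \<in> U" using x \<open>D x \<noteq> 0\<close> by (simp add: U_def)
  ultimately have "\<not> negligible U" using open_not_negligible by blast
  moreover have "negligible U"
  proof -
    have "AE y in lebesgue. y \<notin> U" using ae by eventually_elim (auto simp: U_def)
    moreover have "U \<in> sets lebesgue" using \<open>open U\<close> by simp
    ultimately show ?thesis
      by (simp add: negligible_iff_null_sets AE_iff_null_sets)
  qed
  ultimately show False by simp
qed

lemma sine_complete_continuous:
  assumes "p < q" and D: "continuous_on {p..q} D"
    and ortho: "\<And>n. (LINT x|lebesgue_on {p<..<q}. D x * sin (real (Suc n) * (pi / (q - p) * (x - p)))) = (0::real)"
    and x: "x \<in> {p<..<q}"
  shows "D x = 0"
proof (rule continuous_AE_zero[OF continuous_on_subset[OF D] _ x])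
  show "AE x in lebesgue_on {p<..<q}. D x = 0"
    by (rule sine_complete[OF assms(1) L2_integrable[OF L2_continuous[OF D]] ortho])
qed auto

section \<open>Sine coefficients of weak solutions\<close>

text \<open>The index is shifted: \<open>sine_mode p q n\<close> is the \<open>(n + 1)\<close>-st Dirichlet eigenfunction.\<close>

definition sine_mode :: "real \<Rightarrow> real \<Rightarrow> nat \<Rightarrow> real \<Rightarrow> real" where
  "sine_mode p q n x = sin (real (Suc n) * (pi / (q - p) * (x - p)))"

definition sine_eigenvalue :: "real \<Rightarrow> real \<Rightarrow> nat \<Rightarrow> real" where
  "sine_eigenvalue p q n = (real (Suc n) * (pi / (q - p)))\<^sup>2"

abbreviation sine_coeff :: "real \<Rightarrow> real \<Rightarrow> (real \<Rightarrow> real) \<Rightarrow> nat \<Rightarrow> real" where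
  "sine_coeff p q v n \<equiv> LINT x|lebesgue_on {p<..<q}. v x * sine_mode p q n x"

lemma sine_eigenvalue_pos: "p < q \<Longrightarrow> 0 < sine_eigenvalue p q n"
  by (simp add: sine_eigenvalue_def)

lemma sine_mode_smooth_alg: "sine_mode p q n \<in> smooth_alg"
proof -
  define w where "w = real (Suc n) * (pi / (q - p))"
  have "sine_mode p q n = (\<lambda>x. sin (w * (x - p)))"
    by (intro ext) (simp only: sine_mode_def w_def mult.assoc)
  also have "\<dots> = (\<lambda>x. sin (w * x + (- (w * p))))"
    by (simp add: right_diff_distrib)
  finally show ?thesis by (simp only: smooth_alg.sin)
qed

lemma sine_mode_endpoints:
  assumes "p < q"
  shows "sine_mode p q n p = 0" "sine_mode p q n q = 0"
  using assms by (simp_all add: sine_mode_def sin_npi del: of_nat_Suc)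

lemma sine_mode_H10: "p < q \<Longrightarrow> sine_mode p q n \<in> H10 {p<..<q}"
  by (intro smooth_alg_H10 sine_mode_smooth_alg sine_mode_endpoints)

lemma sine_mode_deriv2: "deriv (deriv (sine_mode p q n)) x = - sine_eigenvalue p q n * sine_mode p q n x"
proof -
  define w where "w = real (Suc n) * (pi / (q - p))"
  have s: "sine_mode p q n = (\<lambda>x. sin (w * (x - p)))" by (simp add: sine_mode_def w_def fun_eq_iff mult.assoc)
  have "deriv (sine_mode p q n) = (\<lambda>x. w * cos (w * (x - p)))"
    unfolding s by (rule ext, rule DERIV_imp_deriv) (auto intro!: derivative_eq_intros)
  moreover have "deriv (\<lambda>x. w * cos (w * (x - p))) x = - w\<^sup>2 * sin (w * (x - p))"
    by (rule DERIV_imp_deriv) (auto intro!: derivative_eq_intros simp: power2_eq_square)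
  ultimately show ?thesis by (simp add: s sine_eigenvalue_def w_def)
qed

lemma sine_mode_weak_deriv:
  assumes "p < q"
  shows "is_weak_deriv {p<..<q} (sine_mode p q n) (deriv (sine_mode p q n))"
    and "is_weak_deriv {p<..<q} (deriv (sine_mode p q n)) (\<lambda>x. - sine_eigenvalue p q n * sine_mode p q n x)"
proof -
  note S = sine_mode_smooth_alg[of p q n]
  show "is_weak_deriv {p<..<q} (sine_mode p q n) (deriv (sine_mode p q n))"
    by (intro is_weak_deriv_C1 assms smooth_alg_deriv S smooth_alg_continuous)
  have "is_weak_deriv {p<..<q} (deriv (sine_mode p q n)) (deriv (deriv (sine_mode p q n)))"
    by (intro is_weak_deriv_C1 assms smooth_alg_deriv S smooth_alg_continuous)
  then show "is_weak_deriv {p<..<q} (deriv (sine_mode p q n)) (\<lambda>x. - sine_eigenvalue p q n * sine_mode p q n x)"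
    by (simp add: sine_mode_deriv2[abs_def])
qed

lemma integral_weak_deriv_sine_mode:
  assumes "p < q" "g \<in> L2 {p<..<q}"
  shows "(LINT x|lebesgue_on {p<..<q}. g x * weak_deriv {p<..<q} (sine_mode p q n) x) =
    (LINT x|lebesgue_on {p<..<q}. g x * deriv (sine_mode p q n) x)"
proof -
  note wd = sine_mode_weak_deriv(1)[OF assms(1), of n]
  have "(LINT x|lebesgue_on {p<..<q}. weak_deriv {p<..<q} (sine_mode p q n) x * g x) =
    (LINT x|lebesgue_on {p<..<q}. deriv (sine_mode p q n) x * g x)"
    by (rule integral_cong_AE_L2(1)[OF weak_deriv_AE[OF wd] is_weak_deriv_L2(2)[OF H1_is_weak_deriv[OF is_weak_deriv_H1[OF wd]]]
          is_weak_deriv_L2(2)[OF wd] L2_measurable[OF assms(2)]])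
  then show ?thesis by (simp only: mult.commute)
qed

text \<open>\<open>u\<close> has only one weak derivative, so the integration by parts
  differentiates the smooth mode a second time and uses \<open>u\<close> as the function that
  vanishes at the endpoints.\<close>

lemma sine_mode_eigen:
  assumes "p < q" "u \<in> H10 {p<..<q}"
  shows "(LINT x|lebesgue_on {p<..<q}. weak_deriv {p<..<q} u x * weak_deriv {p<..<q} (sine_mode p q n) x) =
    sine_eigenvalue p q n * (sine_coeff p q u n)"
proof -
  have "u \<in> H1 {p<..<q}" using assms(2) by (simp add: H10_def)
  then have L: "weak_deriv {p<..<q} u \<in> L2 {p<..<q}"
    using is_weak_deriv_L2(2)[OF H1_is_weak_deriv] by blast
  have "(LINT x|lebesgue_on {p<..<q}. weak_deriv {p<..<q} u x * weak_deriv {p<..<q} (sine_mode p q n) x) =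
     (LINT x|lebesgue_on {p<..<q}. deriv (sine_mode p q n) x * weak_deriv {p<..<q} u x)"
    unfolding integral_weak_deriv_sine_mode[OF assms(1) L]
    by (intro Bochner_Integration.integral_cong refl) (rule mult.commute)
  also have "\<dots> = - (LINT x|lebesgue_on {p<..<q}. - sine_eigenvalue p q n * sine_mode p q n x * u x)"
    by (rule weak_deriv_H10[OF assms(1) sine_mode_weak_deriv(2)[OF assms(1)] assms(2)])
  also have "\<dots> = - (LINT x|lebesgue_on {p<..<q}. (- sine_eigenvalue p q n) * (u x * sine_mode p q n x))"
    by (intro arg_cong[where f = uminus] Bochner_Integration.integral_cong refl) (simp only: mult_ac)
  finally show ?thesis by simp
qed

section \<open>Functionals in the dual space and their Bochner integrals\<close>

lemma Hm1_lincomb: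
  assumes "F \<in> Hm1 S" "G \<in> Hm1 S"
  shows "(\<lambda>d. a * F d + b * G d) \<in> Hm1 S"
proof -
  obtain B where B: "\<forall>\<Phi>\<in>H10 S. \<bar>F \<Phi>\<bar> \<le> B * H1_norm S \<Phi>" using assms(1) by (auto simp: Hm1_def)
  obtain C where C: "\<forall>\<Phi>\<in>H10 S. \<bar>G \<Phi>\<bar> \<le> C * H1_norm S \<Phi>" using assms(2) by (auto simp: Hm1_def)
  have "\<bar>a * F \<Phi> + b * G \<Phi>\<bar> \<le> (\<bar>a\<bar> * B + \<bar>b\<bar> * C) * H1_norm S \<Phi>" if "\<Phi> \<in> H10 S" for \<Phi>
  proof -
    have "\<bar>a * F \<Phi> + b * G \<Phi>\<bar> \<le> \<bar>a\<bar> * \<bar>F \<Phi>\<bar> + \<bar>b\<bar> * \<bar>G \<Phi>\<bar>"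
      by (metis abs_mult abs_triangle_ineq)
    also have "\<dots> \<le> \<bar>a\<bar> * (B * H1_norm S \<Phi>) + \<bar>b\<bar> * (C * H1_norm S \<Phi>)"
      using B C that by (intro add_mono mult_left_mono) auto
    finally show ?thesis by (simp add: algebra_simps)
  qed
  then have "\<exists>D. \<forall>\<Phi>\<in>H10 S. \<bar>a * F \<Phi> + b * G \<Phi>\<bar> \<le> D * H1_norm S \<Phi>" by blast
  then show ?thesis using assms by (simp add: Hm1_def algebra_simps)
qed

lemma Hm1_sum:
  assumes "finite A" "\<And>c. c \<in> A \<Longrightarrow> c \<in> Hm1 S"
  shows "(\<lambda>d. \<Sum>c\<in>A. m c * c d) \<in> Hm1 S"
  using assms
proof (induction A rule: finite_induct)
  case empty
  then show ?case by (auto simp: Hm1_def intro!: exI[of _ 0])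
next
  case (insert c A)
  then have "(\<lambda>d. m c * c d + 1 * (\<Sum>c\<in>A. m c * c d)) \<in> Hm1 S"
    by (intro Hm1_lincomb) auto
  with insert show ?case by simp
qed

lemma H1_norm_nonneg: "0 \<le> H1_norm S f"
  by (simp add: H1_norm_def)

lemma H1_norm_scale:
  assumes "p < q" "is_weak_deriv {p<..<q} f g"
  shows "H1_norm {p<..<q} (\<lambda>x. c * f x) = \<bar>c\<bar> * H1_norm {p<..<q} f"
proof -
  have "is_weak_deriv {p<..<q} (\<lambda>x. c * f x) (\<lambda>x. c * g x)"
    using is_weak_deriv_lincomb[OF assms(2,2,1), of c 0] by simp
  then have "H1_norm {p<..<q} (\<lambda>x. c * f x) =
      sqrt (c\<^sup>2 * ((LINT x|lebesgue_on {p<..<q}. (f x)\<^sup>2) + (LINT x|lebesgue_on {p<..<q}. (g x)\<^sup>2)))"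
    by (subst H1_norm_eq) (auto simp: power_mult_distrib distrib_left)
  then show ?thesis by (simp add: real_sqrt_mult H1_norm_eq[OF assms(2)])
qed

text \<open>Dividing \<open>F\<close> by one plus its norm puts it into the unit ball without a
  separate case for norm zero. With \<open>F\<close> in \<open>smooth_alg\<close>, the scaled
  function is in \<open>H10\<close> by \<open>smooth_alg_H10\<close>.\<close>

lemma Hm1_norm_bound:
  assumes "p < q" and G: "G \<in> Hm1 {p<..<q}" and F: "F \<in> smooth_alg" "F p = 0" "F q = 0"
  shows "\<bar>G F\<bar> \<le> (1 + H1_norm {p<..<q} F) * Hm1_norm {p<..<q} G"
proof -
  let ?S = "{p<..<q}"
  define c where "c = 1 + H1_norm ?S F"
  have c: "1 \<le> c" using H1_norm_nonneg by (simp add: c_def)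
  have wd: "is_weak_deriv ?S F (deriv F)"
    by (intro is_weak_deriv_C1 assms smooth_alg_deriv smooth_alg_continuous)
  have FH: "F \<in> H10 ?S" by (intro smooth_alg_H10 assms)
  define \<Psi> where "\<Psi> = (\<lambda>x. 1 / c * F x)"
  have \<Psi>: "\<Psi> \<in> H10 ?S"
    unfolding \<Psi>_def using F by (intro smooth_alg_H10 assms smooth_alg.intros) auto
  have "H1_norm ?S \<Psi> \<le> 1"
    unfolding \<Psi>_def H1_norm_scale[OF assms(1) wd] using c H1_norm_nonneg[of ?S F] by (simp add: c_def)
  obtain B where B: "\<forall>\<Phi>\<in>H10 ?S. \<bar>G \<Phi>\<bar> \<le> B * H1_norm ?S \<Phi>"
    and lin: "\<forall>\<Phi>\<in>H10 ?S. \<forall>\<Psi>\<in>H10 ?S. \<forall>a b. G (\<lambda>x. a * \<Phi> x + b * \<Psi> x) = a * G \<Phi> + b * G \<Psi>"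
    using G by (auto simp: Hm1_def)
  have "\<bar>G \<Psi>\<bar> \<le> Hm1_norm ?S G"
    unfolding Hm1_norm_def
  proof (rule cSUP_upper)
    show "\<Psi> \<in> {\<Phi> \<in> H10 ?S. H1_norm ?S \<Phi> \<le> 1}" using \<Psi> \<open>H1_norm ?S \<Psi> \<le> 1\<close> by simp
    show "bdd_above ((\<lambda>\<Phi>. \<bar>G \<Phi>\<bar>) ` {\<Phi> \<in> H10 ?S. H1_norm ?S \<Phi> \<le> 1})"
    proof (rule bdd_aboveI2[where M = "\<bar>B\<bar>"])
      fix \<Phi> assume \<Phi>: "\<Phi> \<in> {\<Phi> \<in> H10 ?S. H1_norm ?S \<Phi> \<le> 1}"
      then have "\<bar>G \<Phi>\<bar> \<le> B * H1_norm ?S \<Phi>" using B by simp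
      also have "\<dots> \<le> \<bar>B\<bar> * 1" using \<Phi> H1_norm_nonneg by (intro mult_mono) auto
      finally show "\<bar>G \<Phi>\<bar> \<le> \<bar>B\<bar>" by simp
    qed
  qed
  moreover have "G \<Psi> = 1 / c * G F"
    using lin[rule_format, OF FH FH, of "1 / c" 0] by (simp add: \<Psi>_def)
  ultimately show ?thesis using c by (simp add: c_def abs_mult field_simps)
qed

lemma simple_int_eval:
  assumes s: "simple_fun {0<..<t} X s"
  shows "integrable (lebesgue_on {0<..<t}) (\<lambda>\<tau>. s \<tau> \<Phi>)"
    and "(LINT \<tau>|lebesgue_on {0<..<t}. s \<tau> \<Phi>) = simple_int {0<..<t} s \<Phi>"
proof -
  let ?I = "{0<..<t::real}"
  define L where "L c = {\<tau> \<in> ?I. s \<tau> = c}" for c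
  have fin: "finite (s ` ?I)" and m: "L c \<in> sets lebesgue" for c
    using s by (auto simp: simple_fun_def L_def)
  have Lm: "L c \<in> sets (lebesgue_on ?I)" for c
    using m[of c] by (auto simp: sets_restrict_space_iff L_def)
  have emL: "emeasure (lebesgue_on ?I) (L c) = emeasure lebesgue (L c)" for c
    by (rule emeasure_restrict_space) (auto simp: L_def)
  have finL: "emeasure (lebesgue_on ?I) (L c) < \<infinity>" for c
    using finite_measure.emeasure_finite[OF finite_measure_Ioo[of 0 t]] by (simp add: top.not_eq_extremum)
  have i: "has_bochner_integral (lebesgue_on ?I) (\<lambda>\<tau>. c \<Phi> * indicator (L c) \<tau>) (measure lebesgue (L c) * c \<Phi>)" for c :: "'a \<Rightarrow> real"
  proof -
    have "has_bochner_integral (lebesgue_on ?I) (\<lambda>\<tau>. indicator (L c) \<tau> *\<^sub>R c \<Phi>) (measure (lebesgue_on ?I) (L c) *\<^sub>R c \<Phi>)"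
      by (rule has_bochner_integral_indicator[OF Lm finL])
    then show ?thesis by (simp add: mult.commute measure_def emL)
  qed
  have "has_bochner_integral (lebesgue_on ?I) (\<lambda>\<tau>. \<Sum>c\<in>s ` ?I. c \<Phi> * indicator (L c) \<tau>) (\<Sum>c\<in>s ` ?I. measure lebesgue (L c) * c \<Phi>)"
    by (intro has_bochner_integral_sum i)
  moreover have "(\<Sum>c\<in>s ` ?I. c \<Phi> * indicator (L c) \<tau>) = s \<tau> \<Phi>" if \<tau>: "\<tau> \<in> ?I" for \<tau>
  proof -
    have "(\<Sum>c\<in>s ` ?I. c \<Phi> * indicator (L c) \<tau>) = (\<Sum>c\<in>s ` ?I. if c = s \<tau> then s \<tau> \<Phi> else 0)"
      using \<tau> by (intro sum.cong) (auto simp: L_def indicator_def)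
    also have "\<dots> = s \<tau> \<Phi>" using fin \<tau> by (simp add: sum.delta)
    finally show ?thesis .
  qed
  ultimately have "has_bochner_integral (lebesgue_on ?I) (\<lambda>\<tau>. s \<tau> \<Phi>) (simple_int ?I s \<Phi>)"
    unfolding simple_int_def L_def[symmetric]
    by (subst has_bochner_integral_cong[OF refl _ refl, symmetric]) auto
  then show "integrable (lebesgue_on ?I) (\<lambda>\<tau>. s \<tau> \<Phi>)" "(LINT \<tau>|lebesgue_on ?I. s \<tau> \<Phi>) = simple_int ?I s \<Phi>"
    by (auto simp: has_bochner_integral_iff)
qed

text \<open>Evaluation at a fixed \<open>F\<close> is a bounded linear functional, hence commutes
  with the integral. Measurability of the scalar function enters as an assumption; for solutions it
  is supplied by the equation, through equality almost everywhere with a continuous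
  function.\<close>

lemma bochner_integral_eval:
  assumes "p < q" and F: "F \<in> smooth_alg" "F p = 0" "F q = 0"
    and b: "bochner_integral_is {0<..<t} (Hm1 {p<..<q}) (Hm1_norm {p<..<q}) v y"
    and meas: "(\<lambda>\<tau>. v \<tau> F) \<in> borel_measurable (lebesgue_on {0<..<t})"
  shows "integrable (lebesgue_on {0<..<t}) (\<lambda>\<tau>. v \<tau> F)"
    and "(LINT \<tau>|lebesgue_on {0<..<t}. v \<tau> F) = y F"
proof -
  let ?I = "{0<..<t}" and ?X = "Hm1 {p<..<q}" and ?N = "Hm1_norm {p<..<q}"
  define c where "c = 1 + H1_norm {p<..<q} F"
  have c: "0 < c" using H1_norm_nonneg[of "{p<..<q}" F] by (simp add: c_def)
  have vX: "AE \<tau> in lebesgue_on ?I. v \<tau> \<in> ?X" and yX: "y \<in> ?X"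
    using b by (auto simp: bochner_integral_is_def strongly_measurable_def)
  obtain s where s: "\<And>n::nat. simple_fun ?I ?X (s n)"
    and lim1: "(\<lambda>n. \<integral>\<^sup>+\<tau>. ennreal (?N (\<lambda>d. v \<tau> d - s n \<tau> d)) \<partial>lebesgue_on ?I) \<longlonglongrightarrow> 0"
    and lim2: "(\<lambda>n. ?N (\<lambda>d. simple_int ?I (s n) d - y d)) \<longlonglongrightarrow> 0"
    using b by (auto simp: bochner_integral_is_def)
  define e where "e n = (\<integral>\<^sup>+\<tau>. ennreal \<bar>v \<tau> F - s n \<tau> F\<bar> \<partial>lebesgue_on ?I)" for n
  have diff: "(\<lambda>d. G d - H d) \<in> ?X" if "G \<in> ?X" "H \<in> ?X" for G H
    using Hm1_lincomb[OF that, of 1 "-1"] by simp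
  have bd: "\<bar>G F - H F\<bar> \<le> c * ?N (\<lambda>d. G d - H d)" if "G \<in> ?X" "H \<in> ?X" for G H
    unfolding c_def using Hm1_norm_bound[OF assms(1) diff[OF that] F] .
  have e_le: "e n \<le> ennreal c * (\<integral>\<^sup>+\<tau>. ennreal (?N (\<lambda>d. v \<tau> d - s n \<tau> d)) \<partial>lebesgue_on ?I)" for n
  proof -
    \<comment> \<open>The constant stays on the side of the scalar difference: pulling it out of the
      integral requires measurability, which is established for that difference but not for the
      seminorm as a function of \<tau>.\<close>
    have "AE \<tau> in lebesgue_on ?I. ennreal (1 / c) * ennreal \<bar>v \<tau> F - s n \<tau> F\<bar> \<le> ennreal (?N (\<lambda>d. v \<tau> d - s n \<tau> d))"
      using vX AE_space
    proof eventually_elim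
      case (elim \<tau>)
      then have "s n \<tau> \<in> ?X" using s[of n] by (auto simp: simple_fun_def)
      from bd[OF elim(1) this] c show ?case
        by (simp add: ennreal_mult[symmetric] field_simps ennreal_leI)
    qed
    then have "(\<integral>\<^sup>+\<tau>. ennreal (1 / c) * ennreal \<bar>v \<tau> F - s n \<tau> F\<bar> \<partial>lebesgue_on ?I) \<le> (\<integral>\<^sup>+\<tau>. ennreal (?N (\<lambda>d. v \<tau> d - s n \<tau> d)) \<partial>lebesgue_on ?I)"
      by (rule nn_integral_mono_AE)
    moreover have "(\<integral>\<^sup>+\<tau>. ennreal (1 / c) * ennreal \<bar>v \<tau> F - s n \<tau> F\<bar> \<partial>lebesgue_on ?I) = ennreal (1 / c) * e n"
      unfolding e_def
      using meas borel_measurable_integrable[OF simple_int_eval(1)[OF s, of n F]]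
      by (intro nn_integral_cmult measurable_compose[OF _ measurable_ennreal] borel_measurable_abs borel_measurable_diff)
    ultimately have "ennreal c * (ennreal (1 / c) * e n) \<le> ennreal c * (\<integral>\<^sup>+\<tau>. ennreal (?N (\<lambda>d. v \<tau> d - s n \<tau> d)) \<partial>lebesgue_on ?I)"
      by (intro mult_left_mono) auto
    moreover have "ennreal c * (ennreal (1 / c) * e n) = e n"
      using c by (simp add: mult.assoc[symmetric] ennreal_mult[symmetric])
    ultimately show ?thesis by simp
  qed
  have "(\<lambda>n. ennreal c * (\<integral>\<^sup>+\<tau>. ennreal (?N (\<lambda>d. v \<tau> d - s n \<tau> d)) \<partial>lebesgue_on ?I)) \<longlonglongrightarrow> ennreal c * 0"
    by (intro ennreal_tendsto_cmult lim1) simp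
  then have e0: "e \<longlonglongrightarrow> 0"
    by (intro tendsto_sandwich[OF _ _ tendsto_const[of 0], of e]) (auto simp: e_le)
  have "eventually (\<lambda>n. e n < 1) sequentially"
    by (rule order_tendstoD(2)[OF e0]) simp
  then obtain n0 where n0: "e n < 1" if "n \<ge> n0" for n by (auto simp: eventually_sequentially)
  \<comment> \<open>One index with finite error already makes the evaluation of \<open>v\<close>
    integrable, as a simple function plus an integrable difference.\<close>
  have di: "integrable (lebesgue_on ?I) (\<lambda>\<tau>. v \<tau> F - s n \<tau> F)" if "n \<ge> n0" for n
  proof (rule integrableI_bounded)
    show "(\<lambda>\<tau>. v \<tau> F - s n \<tau> F) \<in> borel_measurable (lebesgue_on ?I)"
      using meas simple_int_eval(1)[OF s, of n F] by measurable
    have "e n < \<infinity>" using n0[OF that] by (rule less_trans) simp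
    then show "(\<integral>\<^sup>+ \<tau>. ennreal (norm (v \<tau> F - s n \<tau> F)) \<partial>lebesgue_on ?I) < \<infinity>"
      by (simp add: e_def)
  qed
  show vi: "integrable (lebesgue_on ?I) (\<lambda>\<tau>. v \<tau> F)"
    using Bochner_Integration.integrable_add[OF di[OF order_refl] simple_int_eval(1)[OF s, of n0 F]] by simp
  have "ennreal \<bar>(LINT \<tau>|lebesgue_on ?I. v \<tau> F) - simple_int ?I (s n) F\<bar> \<le> e n" if "n \<ge> n0" for n
  proof -
    have "(LINT \<tau>|lebesgue_on ?I. v \<tau> F) - simple_int ?I (s n) F = (LINT \<tau>|lebesgue_on ?I. v \<tau> F - s n \<tau> F)"
      using vi simple_int_eval[OF s, of n F] by simp
    then show ?thesis
      using integral_norm_bound_ennreal[OF di[OF that]] by (simp add: e_def)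
  qed
  then have "(\<lambda>n. ennreal \<bar>(LINT \<tau>|lebesgue_on ?I. v \<tau> F) - simple_int ?I (s n) F\<bar>) \<longlonglongrightarrow> 0"
    by (intro tendsto_sandwich[OF _ _ tendsto_const[of 0] e0]) (auto simp: eventually_sequentially)
  then have "(\<lambda>n. \<bar>(LINT \<tau>|lebesgue_on ?I. v \<tau> F) - simple_int ?I (s n) F\<bar>) \<longlonglongrightarrow> 0"
    by (subst (asm) ennreal_0[symmetric], subst (asm) tendsto_ennreal_iff) auto
  then have 1: "(\<lambda>n. (LINT \<tau>|lebesgue_on ?I. v \<tau> F) - simple_int ?I (s n) F) \<longlonglongrightarrow> 0"
    by (rule tendsto_rabs_zero_cancel)
  have 2: "(\<lambda>n. simple_int ?I (s n) F - y F) \<longlonglongrightarrow> 0"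
  proof (rule Lim_null_comparison)
    have "simple_int ?I (s n) \<in> ?X" for n
      unfolding simple_int_def using s[of n] by (intro Hm1_sum) (auto simp: simple_fun_def)
    then show "eventually (\<lambda>n. norm (simple_int ?I (s n) F - y F) \<le> c * ?N (\<lambda>d. simple_int ?I (s n) d - y d)) sequentially"
      using bd yX by simp
    show "(\<lambda>n. c * ?N (\<lambda>d. simple_int ?I (s n) d - y d)) \<longlonglongrightarrow> 0"
      using tendsto_mult[OF tendsto_const lim2, of c] by simp
  qed
  from tendsto_add[OF 1 2] have "(\<lambda>n::nat. (LINT \<tau>|lebesgue_on ?I. v \<tau> F) - y F) \<longlonglongrightarrow> 0" by simp
  then show "(LINT \<tau>|lebesgue_on ?I. v \<tau> F) = y F"
    by (simp add: LIMSEQ_const_iff)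
qed


lemma integral_Ioo_continuous:
  assumes "continuous_on {p..q} (f :: real \<Rightarrow> real)"
  shows "(LINT x|lebesgue_on {p<..<q}. f x) = integral {p..q} f"
proof -
  have "(LINT x|lebesgue_on {p<..<q}. f x) = integral {p<..<q} f"
    by (intro lebesgue_integral_eq_integral L2_integrable L2_continuous assms) auto
  then show ?thesis by (simp add: integral_open_interval_real)
qed

lemma measurable_lebesgue_on_AE:
  fixes f :: "real \<Rightarrow> real"
  assumes "f \<in> borel_measurable (lebesgue_on S)" "AE x in lebesgue_on S. f x = g x" "S \<in> sets lebesgue"
  shows "g \<in> borel_measurable (lebesgue_on S)"
proof (rule borel_measurable_if_D, rule borel_measurable_AE)
  show "(\<lambda>x. if x \<in> S then f x else 0) \<in> borel_measurable lebesgue"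
    using assms(1,3) by (simp add: borel_measurable_if)
  have "AE x in lebesgue. x \<in> S \<longrightarrow> f x = g x"
    using assms(2,3) by (simp add: AE_restrict_space_iff)
  then show "AE x in lebesgue. (if x \<in> S then f x else 0) = (if x \<in> S then g x else 0)"
    by eventually_elim auto
qed

lemma continuous_on_slice:
  assumes "continuous_on (A \<times> B) (\<lambda>(t, x). u t x)" "t \<in> A"
  shows "continuous_on B (u t)"
proof -
  have "continuous_on B (\<lambda>x. (\<lambda>(t, x). u t x) (t, x))"
    by (rule continuous_on_compose2[OF assms(1)])
       (use assms(2) in \<open>auto intro!: continuous_on_Pair continuous_on_const continuous_on_id\<close>)
  then show ?thesis by simp
qed

lemma continuous_on_sine_coefficient:
  assumes "continuous_on ({0<..<T} \<times> {p..q}) (\<lambda>(t, x). u t x)"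
  shows "continuous_on {0<..<T} (\<lambda>t. sine_coeff p q (u t) n)"
proof -
  have sc: "continuous_on A (sine_mode p q n)" for A
    by (rule smooth_alg_continuous[OF sine_mode_smooth_alg])
  have c: "continuous_on ({0<..<T} \<times> cbox p q) (\<lambda>(t, x). u t x * sine_mode p q n x)"
    using assms by (auto simp: case_prod_beta intro!: continuous_intros continuous_on_compose2[OF sc])
  have "continuous_on {p..q} (\<lambda>x. u t x * sine_mode p q n x)" if "t \<in> {0<..<T}" for t
    by (intro continuous_on_mult continuous_on_slice[OF assms that] sc)
  then have eq: "integral (cbox p q) (\<lambda>x. u t x * sine_mode p q n x) = (sine_coeff p q (u t) n)"
    if "t \<in> {0<..<T}" for t
    using that by (simp add: integral_Ioo_continuous)
  have "continuous_on {0<..<T} (\<lambda>t. integral (cbox p q) (\<lambda>x. u t x * sine_mode p q n x))"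
    by (rule integral_continuous_on_param[OF c])
  then show ?thesis by (rule continuous_on_eq) (simp only: eq)
qed

text \<open>By Cauchy-Schwarz, twice the absolute coefficient is at most \<open>c\<^sup>2\<close>
  plus the squared norm of \<open>u t\<close>. The constant is subtracted on the left, so that the
  norm, whose measurability in time is not established, occurs only in one monotone comparison of
  integrals.\<close>

lemma sine_coefficient_integrable:
  assumes "p < q" and u: "u \<in> L2_time T (H10 {p<..<q}) (H1_norm {p<..<q})"
    and cont: "continuous_on {0<..<T} (\<lambda>t. sine_coeff p q (u t) n)"
  shows "integrable (lebesgue_on {0<..<T}) (\<lambda>t. sine_coeff p q (u t) n)"
proof -
  let ?S = "{p<..<q}"
  define y where "y t = (LINT x|lebesgue_on ?S. u t x * sine_mode p q n x)" for t
  define c where "c = sqrt (LINT x|lebesgue_on ?S. (sine_mode p q n x)\<^sup>2)"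
  have ym: "y \<in> borel_measurable (lebesgue_on {0<..<T})"
    unfolding y_def by (rule continuous_imp_measurable_on_sets_lebesgue[OF cont]) auto
  have mL: "sine_mode p q n \<in> L2 ?S"
    by (intro L2_continuous smooth_alg_continuous sine_mode_smooth_alg)
  have uH: "AE t in lebesgue_on {0<..<T}. u t \<in> H10 ?S"
    and fin: "(\<integral>\<^sup>+t. ennreal ((H1_norm ?S (u t))\<^sup>2) \<partial>lebesgue_on {0<..<T}) < \<infinity>"
    using u by (auto simp: L2_time_def strongly_measurable_def)
  have b: "AE t in lebesgue_on {0<..<T}. ennreal \<bar>2 * y t\<bar> - ennreal (c\<^sup>2) \<le> ennreal ((H1_norm ?S (u t))\<^sup>2)"
    using uH
  proof eventually_elim
    case (elim t)
    then have "u t \<in> H1 ?S" by (simp add: H10_def)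
    then have uL: "u t \<in> L2 ?S" by (rule is_weak_deriv_L2(1)[OF H1_is_weak_deriv])
    have "\<bar>y t\<bar> \<le> sqrt (LINT x|lebesgue_on ?S. (u t x)\<^sup>2) * c"
      unfolding y_def c_def by (rule L2_Cauchy_Schwarz[OF uL mL])
    also have "\<dots> \<le> H1_norm ?S (u t) * c"
      unfolding H1_norm_def c_def by (intro mult_right_mono real_sqrt_le_mono) auto
    finally have "2 * \<bar>y t\<bar> \<le> (H1_norm ?S (u t))\<^sup>2 + c\<^sup>2"
      using sum_squares_bound[of "H1_norm ?S (u t)" c] by linarith
    then have "\<bar>2 * y t\<bar> - c\<^sup>2 \<le> (H1_norm ?S (u t))\<^sup>2" by (simp add: abs_mult)
    then show ?case by (subst ennreal_minus) (auto intro: ennreal_leI)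
  qed
  have "integrable (lebesgue_on {0<..<T}) (\<lambda>t. max 0 (\<bar>2 * y t\<bar> - c\<^sup>2))"
  proof (rule integrableI_bounded)
    show "(\<lambda>t. max 0 (\<bar>2 * y t\<bar> - c\<^sup>2)) \<in> borel_measurable (lebesgue_on {0<..<T})"
      using ym by measurable
    have "(\<integral>\<^sup>+t. ennreal (norm (max 0 (\<bar>2 * y t\<bar> - c\<^sup>2))) \<partial>lebesgue_on {0<..<T}) =
        (\<integral>\<^sup>+t. ennreal \<bar>2 * y t\<bar> - ennreal (c\<^sup>2) \<partial>lebesgue_on {0<..<T})"
      by (intro nn_integral_cong) (simp add: ennreal_minus ennreal_max_0)
    also have "\<dots> \<le> (\<integral>\<^sup>+t. ennreal ((H1_norm ?S (u t))\<^sup>2) \<partial>lebesgue_on {0<..<T})"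
      by (rule nn_integral_mono_AE[OF b])
    finally show "(\<integral>\<^sup>+t. ennreal (norm (max 0 (\<bar>2 * y t\<bar> - c\<^sup>2))) \<partial>lebesgue_on {0<..<T}) < \<infinity>"
      using fin by (rule le_less_trans)
  qed
  moreover have "integrable (lebesgue_on {0<..<T}) (\<lambda>t. c\<^sup>2)"
    by (rule integrable_bounded_Ioo[where B = "c\<^sup>2"]) auto
  ultimately have "integrable (lebesgue_on {0<..<T}) (\<lambda>t. max 0 (\<bar>2 * y t\<bar> - c\<^sup>2) + c\<^sup>2)"
    by (rule Bochner_Integration.integrable_add)
  then have "integrable (lebesgue_on {0<..<T}) y"
  proof (rule Bochner_Integration.integrable_bound[OF _ ym], intro AE_I2)
    fix x
    have "\<bar>y x\<bar> \<le> \<bar>2 * y x\<bar>" "\<bar>2 * y x\<bar> - c\<^sup>2 \<le> max 0 (\<bar>2 * y x\<bar> - c\<^sup>2)"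
      by (simp add: abs_mult, rule max.cobounded2)
    then show "norm (y x) \<le> norm (max 0 (\<bar>2 * y x\<bar> - c\<^sup>2) + c\<^sup>2)"
      unfolding real_norm_def using abs_ge_self[of "max 0 (\<bar>2 * y x\<bar> - c\<^sup>2) + c\<^sup>2"] by linarith
  qed
  then show ?thesis by (simp add: y_def[abs_def])
qed

text \<open>Tested with a mode, the equation reads \<open>w s \<phi> = - (\<kappa> * y s)\<close>,
  and evaluating \<open>u - u0 = J\<^sup>\<alpha> w\<close> at the same mode gives a scalar Volterra
  equation. Only here is the vector-valued fractional derivative unfolded.\<close>

lemma sine_coefficient_volterra:
  fixes n :: nat
  assumes "0 < \<alpha>" and pq: "p < q" and sol: "weak_solution \<alpha> T {p<..<q} a u0 u"
    and u0: "u0 \<in> L2 {p<..<q}"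
    and cont: "continuous_on ({0<..<T} \<times> {p..q}) (\<lambda>(t, x). u t x)"
  defines "y \<equiv> \<lambda>t. sine_coeff p q (u t) n"
    and "c0 \<equiv> sine_coeff p q u0 n"
    and "\<kappa> \<equiv> a * sine_eigenvalue p q n"
  shows "AE t in lebesgue_on {0<..<T}. integrable (lebesgue_on {0<..<t}) (\<lambda>s. (t - s) powr (\<alpha> - 1) / Gamma \<alpha> * (\<kappa> * y s)) \<and>
    y t = c0 - (LINT s|lebesgue_on {0<..<t}. (t - s) powr (\<alpha> - 1) / Gamma \<alpha> * (\<kappa> * y s))"
proof -
  let ?S = "{p<..<q}"
  let ?\<phi> = "sine_mode p q n"
  have uH: "AE t in lebesgue_on {0<..<T}. u t \<in> H10 ?S"
    using sol by (auto simp: weak_solution_def L2_time_def strongly_measurable_def)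
  obtain w where cap: "is_caputo_deriv \<alpha> T (Hm1 ?S) (Hm1_norm ?S) (\<lambda>t. L2_into_Hm1 ?S (\<lambda>x. u t x - u0 x)) w"
    and eq: "AE t in lebesgue_on {0<..<T}. \<forall>\<Phi>\<in>H10 ?S.
           w t \<Phi> + a * (LINT x|lebesgue_on ?S. weak_deriv ?S (u t) x * weak_deriv ?S \<Phi> x) = 0"
    using sol unfolding weak_solution_def by blast
  have fr: "AE t in lebesgue_on {0<..<T}.
     bochner_integral_is {0<..<t} (Hm1 ?S) (Hm1_norm ?S) (\<lambda>s d. (t - s) powr (\<alpha> - 1) / Gamma \<alpha> * w s d)
      (L2_into_Hm1 ?S (\<lambda>x. u t x - u0 x))"
    using cap by (simp add: is_caputo_deriv_def is_frac_integral_def)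
  have wy: "AE s in lebesgue_on {0<..<T}. w s ?\<phi> = - (\<kappa> * y s)"
    using eq uH
  proof eventually_elim
    case (elim s)
    from elim(1)[rule_format, OF sine_mode_H10[OF pq, of n]] show ?case
      unfolding sine_mode_eigen[OF pq elim(2)] by (simp add: \<kappa>_def y_def mult.assoc eq_neg_iff_add_eq_0)
  qed
  have yc: "continuous_on {0<..<T} y"
    unfolding y_def by (rule continuous_on_sine_coefficient[OF cont])
  have G: "Gamma \<alpha> \<noteq> 0" using Gamma_real_pos[OF assms(1)] by linarith
  have mL: "?\<phi> \<in> L2 ?S"
    by (intro L2_continuous smooth_alg_continuous sine_mode_smooth_alg)
  show ?thesis
    using fr AE_space
  proof eventually_elim
    case (elim t)
    then have t: "t \<in> {0<..<T}" by simp
    let ?k = "\<lambda>s. (t - s) powr (\<alpha> - 1) / Gamma \<alpha>"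
    have sub: "{0<..<t} \<subseteq> {0<..<T}" using t by auto
    have wy': "AE s in lebesgue_on {0<..<t}. ?k s * w s ?\<phi> = - (?k s * (\<kappa> * y s))"
    proof -
      have "AE s in lebesgue. s \<in> {0<..<T} \<longrightarrow> w s ?\<phi> = - (\<kappa> * y s)"
        using wy by (simp add: AE_restrict_space_iff)
      then have "AE s in lebesgue. s \<in> {0<..<t} \<longrightarrow> ?k s * w s ?\<phi> = - (?k s * (\<kappa> * y s))"
        by eventually_elim (use sub in auto)
      then show ?thesis by (simp add: AE_restrict_space_iff)
    qed
    have km: "(\<lambda>s. ?k s * (\<kappa> * y s)) \<in> borel_measurable (lebesgue_on {0<..<t})"
      by (rule continuous_imp_measurable_on_sets_lebesgue)
         (auto intro!: continuous_intros continuous_on_subset[OF yc sub] simp: G)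
    \<comment> \<open>Scalar measurability of \<open>w\<close> is inherited from the continuous
      function on the other side of the equation, by completeness of Lebesgue measure.\<close>
    have wm: "(\<lambda>s. ?k s * w s ?\<phi>) \<in> borel_measurable (lebesgue_on {0<..<t})"
    proof (rule measurable_lebesgue_on_AE[where f = "\<lambda>s. - (?k s * (\<kappa> * y s))"])
      show "(\<lambda>s. - (?k s * (\<kappa> * y s))) \<in> borel_measurable (lebesgue_on {0<..<t})"
        by (rule borel_measurable_uminus[OF km])
      show "AE s in lebesgue_on {0<..<t}. - (?k s * (\<kappa> * y s)) = ?k s * w s ?\<phi>"
        using wy' by eventually_elim (simp only:)
    qed simp
    note ev = bochner_integral_eval[where F = "?\<phi>", OF pq sine_mode_smooth_alg sine_mode_endpoints[OF pq] elim(1), OF wm]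
    have i: "integrable (lebesgue_on {0<..<t}) (\<lambda>s. - (?k s * (\<kappa> * y s)))"
      by (rule integrable_cong_AE_imp[OF ev(1) borel_measurable_uminus[OF km] wy'])
    have "(LINT s|lebesgue_on {0<..<t}. ?k s * w s ?\<phi>) = (LINT s|lebesgue_on {0<..<t}. - (?k s * (\<kappa> * y s)))"
      by (rule integral_cong_AE[OF wm borel_measurable_uminus[OF km] wy'])
    moreover have "L2_into_Hm1 ?S (\<lambda>x. u t x - u0 x) ?\<phi> = y t - c0"
    proof -
      have "u t \<in> L2 ?S" by (rule L2_continuous[OF continuous_on_slice[OF cont t]])
      then show ?thesis
        using u0 mL by (simp add: L2_into_Hm1_def y_def c0_def left_diff_distrib L2_mult_integrable)
    qed
    ultimately have "y t = c0 - (LINT s|lebesgue_on {0<..<t}. ?k s * (\<kappa> * y s))"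
      using ev(2) by simp
    then show ?case using i by simp
  qed
qed

text \<open>The coefficient and the Mittag-Leffler function solve the same linear Volterra equation,
  so their difference satisfies the homogeneous inequality of \<open>volterra_zero\<close> and
  vanishes almost everywhere; continuity in time then gives every \<open>t\<close>.\<close>

lemma sine_coefficient_mittag_leffler:
  assumes "0 < \<alpha>" "\<alpha> \<le> 1" "0 < a" "p < q" and sol: "weak_solution \<alpha> T {p<..<q} a u0 u"
    and u0: "u0 \<in> L2 {p<..<q}"
    and cont: "continuous_on ({0<..<T} \<times> {p..q}) (\<lambda>(t, x). u t x)"
    and t: "t \<in> {0<..<T}"
  shows "sine_coeff p q (u t) n =
    (sine_coeff p q u0 n) * mittag_leffler \<alpha> (- (a * sine_eigenvalue p q n) * t powr \<alpha>)"
proof -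
  define y where "y t = (sine_coeff p q (u t) n)" for t
  define c0 where "c0 = (sine_coeff p q u0 n)"
  define \<kappa> where "\<kappa> = a * sine_eigenvalue p q n"
  define e where "e t = c0 * mittag_leffler \<alpha> (- \<kappa> * t powr \<alpha>)" for t
  have \<kappa>: "0 < \<kappa>" using assms sine_eigenvalue_pos by (simp add: \<kappa>_def)
  have yc: "continuous_on {0<..<T} y"
    unfolding y_def by (rule continuous_on_sine_coefficient[OF cont])
  have ec: "continuous_on {0<..<T} e"
    unfolding e_def
    by (intro continuous_intros continuous_on_compose2[OF continuous_mittag_leffler[OF assms(1)]]) auto
  have yi: "integrable (lebesgue_on {0<..<T}) y"
    using sol yc unfolding y_def by (intro sine_coefficient_integrable assms(4)) (auto simp: weak_solution_def)
  have eb: "\<bar>e t\<bar> \<le> \<bar>c0\<bar>" for t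
    using mittag_leffler_bounds[OF assms(1,2), of "\<kappa> * t powr \<alpha>"] \<kappa>
    by (auto simp: e_def abs_mult intro!: mult_right_le_one_le)
  have ei: "integrable (lebesgue_on {0<..<T}) e"
    by (rule integrable_bounded_Ioo[OF continuous_imp_measurable_on_sets_lebesgue[OF ec] eb]) auto
  \<comment> \<open>Extended by zero to the line: a continuous function cut off to an open interval
    is Borel, as \<open>volterra_zero\<close> requires.\<close>
  define z where "z t = indicator {0<..<T} t * (y t - e t)" for t
  have zb: "z \<in> borel_measurable borel"
    unfolding z_def using borel_measurable_continuous_on_indicator[OF _ continuous_on_diff[OF yc ec]] by simp
  have zi: "integrable lborel z"
  proof -
    have "integrable (lebesgue_on {0<..<T}) (\<lambda>t. y t - e t)"
      using yi ei by (rule Bochner_Integration.integrable_diff)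
    then have "integrable lebesgue z"
      unfolding z_def by (simp add: integrable_restrict_space)
    then show ?thesis using zb by (simp add: integrable_completion)
  qed
  have "AE t in lborel. z t = 0"
  proof (rule volterra_zero[OF assms(1) \<kappa> zb zi])
    show "z t = 0" if "t \<le> 0" for t using that by (simp add: z_def)
    have "AE t in lebesgue_on {0<..<T}. ennreal \<bar>z t\<bar> \<le> ennreal \<kappa> * (\<integral>\<^sup>+ s. ennreal (frac_kernel \<alpha> (t - s) * \<bar>z s\<bar>) \<partial>lborel)"
      using sine_coefficient_volterra[OF assms(1,4) sol u0 cont, of n] AE_space
      unfolding y_def[symmetric] c0_def[symmetric] \<kappa>_def[symmetric]
    proof eventually_elim
      case (elim t)
      then have t: "0 < t" "t < T" by auto
      define k where "k s = (t - s) powr (\<alpha> - 1) / Gamma \<alpha>" for s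
      note E = mittag_leffler_volterra[OF assms(1) \<kappa> t(1), folded k_def]
      note Y = elim(1)[folded k_def]
      have ke: "k s * (\<kappa> * e s) = (\<kappa> * c0) * (k s * mittag_leffler \<alpha> (- \<kappa> * s powr \<alpha>))" for s
        by (simp add: e_def)
      have kei: "integrable (lebesgue_on {0<..<t}) (\<lambda>s. k s * (\<kappa> * e s))"
        unfolding ke by (intro integrable_mult_right E(1))
      have "e t = c0 * (1 - \<kappa> * (LINT s|lebesgue_on {0<..<t}. k s * mittag_leffler \<alpha> (- \<kappa> * s powr \<alpha>)))"
        unfolding e_def E(2) ..
      also have "\<dots> = c0 - (LINT s|lebesgue_on {0<..<t}. k s * (\<kappa> * e s))"
        unfolding ke integral_mult_right_zero by (simp add: algebra_simps)
      finally have "y t - e t = - ((LINT s|lebesgue_on {0<..<t}. k s * (\<kappa> * y s)) - (LINT s|lebesgue_on {0<..<t}. k s * (\<kappa> * e s)))"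
        using Y by simp
      also have "(LINT s|lebesgue_on {0<..<t}. k s * (\<kappa> * y s)) - (LINT s|lebesgue_on {0<..<t}. k s * (\<kappa> * e s)) =
          (LINT s|lebesgue_on {0<..<t}. k s * (\<kappa> * y s) - k s * (\<kappa> * e s))"
        using Y kei by simp
      finally have ze: "\<bar>z t\<bar> = \<bar>LINT s|lebesgue_on {0<..<t}. k s * (\<kappa> * y s) - k s * (\<kappa> * e s)\<bar>"
        using t by (simp add: z_def)
      have "integrable (lebesgue_on {0<..<t}) (\<lambda>s. k s * (\<kappa> * y s) - k s * (\<kappa> * e s))"
        using Y kei by (intro Bochner_Integration.integrable_diff) auto
      then have "ennreal (norm (LINT s|lebesgue_on {0<..<t}. k s * (\<kappa> * y s) - k s * (\<kappa> * e s)))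
          \<le> (\<integral>\<^sup>+ s. ennreal (norm (k s * (\<kappa> * y s) - k s * (\<kappa> * e s))) \<partial>lebesgue_on {0<..<t})"
        by (rule integral_norm_bound_ennreal)
      then have "ennreal \<bar>z t\<bar> \<le> (\<integral>\<^sup>+ s. ennreal (norm (k s * (\<kappa> * y s) - k s * (\<kappa> * e s))) \<partial>lebesgue_on {0<..<t})"
        unfolding ze real_norm_def[of "integral\<^sup>L _ _"] .
      also have "\<dots> = (\<integral>\<^sup>+ s. ennreal (norm (k s * (\<kappa> * y s) - k s * (\<kappa> * e s))) * indicator {0<..<t} s \<partial>lebesgue)"
        by (rule nn_integral_restrict_space) simp
      also have "\<dots> \<le> (\<integral>\<^sup>+ s. ennreal \<kappa> * ennreal (frac_kernel \<alpha> (t - s) * \<bar>z s\<bar>) \<partial>lebesgue)"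
      proof (rule nn_integral_mono)
        fix s
        show "ennreal (norm (k s * (\<kappa> * y s) - k s * (\<kappa> * e s))) * indicator {0<..<t} s \<le> ennreal \<kappa> * ennreal (frac_kernel \<alpha> (t - s) * \<bar>z s\<bar>)"
        proof (cases "s \<in> {0<..<t}")
          case True
          then have f: "frac_kernel \<alpha> (t - s) = k s" and zs: "z s = y s - e s"
            using t by (auto simp: frac_kernel_def z_def k_def)
          have k0: "0 \<le> k s" using frac_kernel_nonneg[OF assms(1), of "t - s"] f by simp
          have "k s * (\<kappa> * y s) - k s * (\<kappa> * e s) = \<kappa> * (k s * z s)"
            by (simp add: zs algebra_simps)
          then have "norm (k s * (\<kappa> * y s) - k s * (\<kappa> * e s)) = \<kappa> * (k s * \<bar>z s\<bar>)"
            using \<kappa> k0 by (simp only: real_norm_def abs_mult abs_of_nonneg[OF k0] abs_of_pos)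
          then show ?thesis
            using True ennreal_mult[of \<kappa> "k s * \<bar>z s\<bar>"] \<kappa> k0 by (simp add: f)
        qed simp
      qed
      also have "\<dots> = (\<integral>\<^sup>+ s. ennreal \<kappa> * ennreal (frac_kernel \<alpha> (t - s) * \<bar>z s\<bar>) \<partial>lborel)"
        by (rule nn_integral_completion)
      also have "\<dots> = ennreal \<kappa> * (\<integral>\<^sup>+ s. ennreal (frac_kernel \<alpha> (t - s) * \<bar>z s\<bar>) \<partial>lborel)"
        using zb by (intro nn_integral_cmult) measurable
      finally show ?case .
    qed
    then have "AE t in lebesgue. t \<in> {0<..<T} \<longrightarrow> ennreal \<bar>z t\<bar> \<le> ennreal \<kappa> * (\<integral>\<^sup>+ s. ennreal (frac_kernel \<alpha> (t - s) * \<bar>z s\<bar>) \<partial>lborel)"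
      by (simp add: AE_restrict_space_iff)
    then have "AE t in lborel. t \<in> {0<..<T} \<longrightarrow> ennreal \<bar>z t\<bar> \<le> ennreal \<kappa> * (\<integral>\<^sup>+ s. ennreal (frac_kernel \<alpha> (t - s) * \<bar>z s\<bar>) \<partial>lborel)"
      by (simp only: AE_completion_iff)
    then show "AE t in lborel. ennreal \<bar>z t\<bar> \<le> ennreal \<kappa> * (\<integral>\<^sup>+ s. ennreal (frac_kernel \<alpha> (t - s) * \<bar>z s\<bar>) \<partial>lborel)"
    proof eventually_elim
      case (elim t)
      then show ?case by (cases "t \<in> {0<..<T}") (auto simp: z_def)
    qed
  qed
  then have "AE t in lebesgue. z t = 0" by (rule AE_completion)
  then have "AE t in lebesgue. t \<in> {0<..<T} \<longrightarrow> y t - e t = 0"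
    by eventually_elim (auto simp: z_def)
  then have "AE t in lebesgue_on {0<..<T}. y t - e t = 0"
    by (simp add: AE_restrict_space_iff)
  then have "y t - e t = 0"
    by (rule continuous_AE_zero[OF continuous_on_diff[OF yc ec] _ t])
  then show ?thesis by (simp add: y_def e_def c0_def \<kappa>_def)
qed

section \<open>Dependence on the diffusion coefficient\<close>

lemma sine_mode_pos:
  assumes "x \<in> {p<..<q}"
  shows "0 < sine_mode p q 0 x"
proof -
  have "(x - p) / (q - p) < 1" "0 < (x - p) / (q - p)" using assms by auto
  then have "pi * ((x - p) / (q - p)) < pi * 1" "0 < pi * ((x - p) / (q - p))"
    by (intro mult_strict_left_mono mult_pos_pos; simp)+
  then show ?thesis by (simp add: sine_mode_def sin_gt_zero)
qed

lemma abs_sine_mode_le: "\<bar>sine_mode p q n x\<bar> \<le> 1"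
  by (simp add: sine_mode_def)

lemma sine_mode_L2: "sine_mode p q n \<in> L2 {p<..<q}"
  by (intro L2_continuous smooth_alg_continuous sine_mode_smooth_alg)

lemma sine_eigenvalue_eq: "sine_eigenvalue p q n = real ((Suc n)\<^sup>2) * sine_eigenvalue p q 0"
  by (simp add: sine_eigenvalue_def power_mult_distrib power_divide)

text \<open>Green's formula: moving the outer derivative uses that the mode vanishes at the
  endpoints, moving the inner one uses that \<open>u0\<close> does.\<close>

lemma sine_coefficient_weak_deriv2:
  assumes "p < q" "u0 \<in> H2 {p<..<q}" "u0 \<in> H10 {p<..<q}"
  shows "(LINT x|lebesgue_on {p<..<q}. weak_deriv {p<..<q} (weak_deriv {p<..<q} u0) x * sine_mode p q n x) =
    - sine_eigenvalue p q n * (sine_coeff p q u0 n)"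
proof -
  have "weak_deriv {p<..<q} u0 \<in> H1 {p<..<q}" using assms(2) by (simp add: H2_def)
  then have "is_weak_deriv {p<..<q} (weak_deriv {p<..<q} u0) (weak_deriv {p<..<q} (weak_deriv {p<..<q} u0))"
    by (rule H1_is_weak_deriv)
  from weak_deriv_H10[OF assms(1) this sine_mode_H10[OF assms(1), of n]]
  show ?thesis unfolding sine_mode_eigen[OF assms(1,3)] by simp
qed

lemma abs_sine_coefficient_le:
  assumes "f \<in> L2 {p<..<q}"
  shows "\<bar>sine_coeff p q f n\<bar> \<le> (LINT x|lebesgue_on {p<..<q}. \<bar>f x\<bar>)"
proof -
  have "\<bar>sine_coeff p q f n\<bar> \<le> (LINT x|lebesgue_on {p<..<q}. \<bar>f x * sine_mode p q n x\<bar>)"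
    by (rule integral_abs_bound)
  also have "\<dots> \<le> (LINT x|lebesgue_on {p<..<q}. \<bar>f x\<bar>)"
  proof (rule integral_mono)
    show "integrable (lebesgue_on {p<..<q}) (\<lambda>x. \<bar>f x * sine_mode p q n x\<bar>)"
      by (intro integrable_abs L2_mult_integrable assms sine_mode_L2)
    show "integrable (lebesgue_on {p<..<q}) (\<lambda>x. \<bar>f x\<bar>)"
      by (intro integrable_abs L2_integrable assms)
    show "\<bar>f x * sine_mode p q n x\<bar> \<le> \<bar>f x\<bar>" for x
      using abs_sine_mode_le[of p q n x] by (simp add: abs_mult mult_left_le)
  qed
  finally show ?thesis .
qed

text \<open>A lower bound for the Dirichlet heat kernel by the product of the first eigenfunctions, integrated
  against \<open>f \<ge> 0\<close>; here \<open>r = exp (- \<lambda>\<^sub>1 s)\<close> at time \<open>s\<close>.\<close>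

lemma heat_series_lower_bound:
  assumes "p < q" and f: "f \<in> L2 {p<..<q}" "AE x in lebesgue_on {p<..<q}. 0 \<le> f x"
    and x: "x \<in> {p<..<q}" and q1: "0 \<le> q1" "q1 < 1"
  defines "b \<equiv> \<lambda>n. sine_coeff p q f n"
  shows "\<exists>K>0. \<forall>r. 0 \<le> r \<longrightarrow> r \<le> q1 \<longrightarrow>
    K * r * (sine_mode p q 0 x * b 0) \<le> (\<Sum>n. r ^ (Suc n)\<^sup>2 * (b n * sine_mode p q n x))"
proof -
  let ?S = "{p<..<q}"
  define \<theta> where "\<theta> y = pi / (q - p) * (y - p)" for y
  have sm: "sine_mode p q n y = sin (real (Suc n) * \<theta> y)" for n y by (simp add: sine_mode_def \<theta>_def)
  have sm0: "sin (\<theta> y) = sine_mode p q 0 y" for y by (simp add: sm)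
  obtain K where K: "0 < K" and bound: "\<And>r N \<xi> \<eta>. 0 \<le> r \<Longrightarrow> r \<le> q1 \<Longrightarrow> 0 < N \<Longrightarrow> 0 \<le> sin \<xi> * sin \<eta> \<Longrightarrow>
    K * r * (sin \<xi> * sin \<eta>) \<le>
      (\<Sum>j<N. qratio r N (Suc j) * r ^ (Suc j)\<^sup>2 * (sin (real (Suc j) * \<xi>) * sin (real (Suc j) * \<eta>)))"
    using sine_kernel_bound[OF q1] by blast
  define F where "F = (LINT x|lebesgue_on ?S. \<bar>f x\<bar>)"
  have bF: "\<bar>b n\<bar> \<le> F" for n unfolding b_def F_def by (rule abs_sine_coefficient_le[OF f(1)])
  have F0: "0 \<le> F" by (simp add: F_def)
  have fin: "K * r * (sine_mode p q 0 x * b 0) \<le> (\<Sum>j<N. qratio r N (Suc j) * r ^ (Suc j)\<^sup>2 * (b j * sine_mode p q j x))"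
    if r: "0 \<le> r" "r \<le> q1" and N: "0 < N" for r N
  proof -
    have i: "integrable (lebesgue_on ?S) (\<lambda>y. f y * sine_mode p q j y)" for j
      by (intro L2_mult_integrable f sine_mode_L2)
    have "K * r * (sine_mode p q 0 x * b 0) = (LINT y|lebesgue_on ?S. (K * r * sine_mode p q 0 x) * (f y * sine_mode p q 0 y))"
      by (simp add: b_def)
    also have "\<dots> \<le> (LINT y|lebesgue_on ?S. (\<Sum>j<N. (qratio r N (Suc j) * r ^ (Suc j)\<^sup>2 * sine_mode p q j x) * (f y * sine_mode p q j y)))"
    proof (rule integral_mono_AE)
      show "AE y in lebesgue_on ?S. (K * r * sine_mode p q 0 x) * (f y * sine_mode p q 0 y)
         \<le> (\<Sum>j<N. (qratio r N (Suc j) * r ^ (Suc j)\<^sup>2 * sine_mode p q j x) * (f y * sine_mode p q j y))"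
        using f(2) AE_space
      proof eventually_elim
        case (elim y)
        then have y: "y \<in> ?S" and fy: "0 \<le> f y" by simp_all
        have "0 \<le> sin (\<theta> x) * sin (\<theta> y)"
          unfolding sm0 using sine_mode_pos[OF x] sine_mode_pos[OF y] by simp
        from mult_left_mono[OF bound[OF r N this] fy] show ?case
          unfolding sm[symmetric] sm0 by (simp add: sum_distrib_left mult_ac)
      qed
    qed (intro integrable_mult_right Bochner_Integration.integrable_sum i)+
    also have "\<dots> = (\<Sum>j<N. (qratio r N (Suc j) * r ^ (Suc j)\<^sup>2 * sine_mode p q j x) * b j)"
      unfolding b_def by (subst Bochner_Integration.integral_sum) (auto intro!: i)
    finally show ?thesis by (simp add: mult_ac)
  qed
  have "K * r * (sine_mode p q 0 x * b 0) \<le> (\<Sum>n. r ^ (Suc n)\<^sup>2 * (b n * sine_mode p q n x))"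
    if r: "0 \<le> r" "r \<le> q1" for r
  proof -
    have r1: "r < 1" using r q1 by simp
    let ?a = "\<lambda>j N. qratio r N (Suc j) * (r ^ (Suc j)\<^sup>2 * (b j * sine_mode p q j x))"
    have le: "\<bar>r ^ (Suc j)\<^sup>2 * (b j * sine_mode p q j x)\<bar> \<le> r ^ j * F" for j
    proof -
      have "r ^ (Suc j)\<^sup>2 \<le> r ^ j"
        using r r1 by (intro power_decreasing) (auto simp: power2_eq_square)
      moreover have "\<bar>b j\<bar> * \<bar>sine_mode p q j x\<bar> \<le> F * 1"
        using bF abs_sine_mode_le F0 by (intro mult_mono) auto
      ultimately show ?thesis
        using r F0 by (simp add: abs_mult mult_mono)
    qed
    \<comment> \<open>Tannery's theorem with the majorant \<open>r ^ j * F\<close>, independent of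
      the truncation, replaces \<open>qratio\<close> by its limit 1. Since \<open>qratio\<close>
      vanishes beyond \<open>N\<close>, the finite sums can be read as series.\<close>
    have lim: "((\<lambda>N. \<Sum>j. ?a j N) \<longlongrightarrow> (\<Sum>j. 1 * (r ^ (Suc j)\<^sup>2 * (b j * sine_mode p q j x)))) sequentially"
    proof (rule tannerys_theorem[THEN conjunct2, THEN conjunct2])
      show "((\<lambda>N. ?a j N) \<longlongrightarrow> 1 * (r ^ (Suc j)\<^sup>2 * (b j * sine_mode p q j x))) sequentially" for j
        by (intro tendsto_mult tendsto_const qratio_tendsto r r1)
      have "norm (?a j N) \<le> r ^ j * F" for j N
      proof -
        have "\<bar>qratio r N (Suc j)\<bar> \<le> 1" using qratio_bounds[OF r(1) r1] by (simp add: abs_le_iff order_trans[of _ 0])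
        from mult_mono[OF this le] show ?thesis by (simp add: abs_mult[of "qratio r N (Suc j)"])
      qed
      then show "\<forall>\<^sub>F (j, N) in sequentially \<times>\<^sub>F sequentially. norm (?a j N) \<le> r ^ j * F"
        by (intro always_eventually) auto
      show "summable (\<lambda>j. r ^ j * F)" using r r1 by (intro summable_mult2 summable_geometric) auto
    qed simp
    have fs: "(\<Sum>j. ?a j N) = (\<Sum>j<N. ?a j N)" for N
      by (rule suminf_finite) (auto simp: qratio_eq_0)
    have "eventually (\<lambda>N. K * r * (sine_mode p q 0 x * b 0) \<le> (\<Sum>j. ?a j N)) sequentially"
      using eventually_gt_at_top[of 0]
    proof eventually_elim
      case (elim N)
      show ?case unfolding fs using fin[OF r elim] by (simp only: mult.assoc)
    qed
    from tendsto_lowerbound[OF lim this] show ?thesis by simp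
  qed
  with K show ?thesis by blast
qed

section \<open>Time monotonicity of the heat solution and of its fractional average\<close>

definition heat_value :: "real \<Rightarrow> real \<Rightarrow> (nat \<Rightarrow> real) \<Rightarrow> real \<Rightarrow> real \<Rightarrow> real" where
  "heat_value p q c x s = (\<Sum>n. c n * sine_mode p q n x * exp (- sine_eigenvalue p q n * s))"

lemma summable_inverse_sine_eigenvalue:
  assumes "p < q"
  shows "summable (\<lambda>n. F / sine_eigenvalue p q n)"
proof -
  have "summable (\<lambda>n. (F / sine_eigenvalue p q 0) * (1 / real (Suc n) ^ 2))"
    using inverse_power_summable[of 2, where 'a = real]
    by (intro summable_mult iffD2[OF summable_Suc_iff[of "\<lambda>n. 1 / real n ^ 2"]]) (simp add: inverse_eq_divide)
  then show ?thesis
    by (subst sine_eigenvalue_eq) (simp add: field_simps)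
qed

text \<open>Differentiating the series produces the factors
  \<open>- \<lambda>\<^sub>n c\<^sub>n\<close>, the sine coefficients of \<open>f\<close>. So the
  derivative is, up to normalisation, the heat solution started from \<open>f \<ge> 0\<close>, which
  \<open>heat_series_lower_bound\<close> controls.\<close>

lemma heat_value_mono:
  assumes "p < q" and x: "x \<in> {p<..<q}" and f: "f \<in> L2 {p<..<q}" "AE x in lebesgue_on {p<..<q}. 0 \<le> f x"
    and b: "\<And>n. sine_coeff p q f n = - sine_eigenvalue p q n * c n"
    and S: "0 < S0" "S0 \<le> S1"
  shows "\<exists>K>0. \<forall>s1 s2. S0 \<le> s2 \<longrightarrow> s2 \<le> s1 \<longrightarrow> s1 \<le> S1 \<longrightarrow>
    K * (- c 0) * (s1 - s2) \<le> heat_value p q c x s1 - heat_value p q c x s2"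
proof -
  define l where "l = sine_eigenvalue p q"
  define g where "g n s = c n * sine_mode p q n x * exp (- l n * s)" for n s
  define g' where "g' n s = - l n * c n * sine_mode p q n x * exp (- l n * s)" for n s
  define F where "F = (LINT x|lebesgue_on {p<..<q}. \<bar>f x\<bar>)"
  have l: "0 < l n" for n using assms(1) by (simp add: l_def sine_eigenvalue_pos)
  have lc: "\<bar>l n * c n\<bar> \<le> F" for n
    using abs_sine_coefficient_le[OF f(1), of n] unfolding b F_def l_def by simp
  have F0: "0 \<le> F" by (simp add: F_def)
  \<comment> \<open>The eigenvalues are \<open>(n + 1)\<^sup>2\<close> times the first one, so all
    exponentials are powers of this number, the \<open>r\<close> of the theta series.\<close>
  define rr where "rr s = exp (- l 0 * s)" for s
  have er: "exp (- l n * s) = rr s ^ (Suc n)\<^sup>2" for n s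
    unfolding rr_def exp_of_nat_mult[symmetric] l_def sine_eigenvalue_eq[of p q n] by (simp add: mult_ac)
  have rr: "0 \<le> rr s" for s by (simp add: rr_def)
  have rr1: "rr s < 1" if "0 < s" for s using that l[of 0] by (simp add: rr_def)
  have rr_anti: "rr s \<le> rr t" if "t \<le> s" for s t using that l[of 0] by (simp add: rr_def)
  obtain K where K: "0 < K" "\<And>r. 0 \<le> r \<Longrightarrow> r \<le> rr S0 \<Longrightarrow>
     K * r * (sine_mode p q 0 x * (- l 0 * c 0)) \<le> (\<Sum>n. r ^ (Suc n)\<^sup>2 * (- l n * c n * sine_mode p q n x))"
    using heat_series_lower_bound[OF assms(1) f x rr rr1[OF S(1)]] unfolding b l_def by blast
  have c0: "0 \<le> - c 0"
  proof -
    have "0 \<le> (sine_coeff p q f 0)"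
    proof (rule integral_nonneg_AE)
      show "AE x in lebesgue_on {p<..<q}. 0 \<le> f x * sine_mode p q 0 x"
        using f(2) AE_space
      proof eventually_elim
        case (elim y)
        then show ?case using sine_mode_pos[of y p q] by simp
      qed
    qed
    then show ?thesis using l[of 0] unfolding b l_def[symmetric] by (simp add: mult_le_0_iff)
  qed
  have deriv: "(heat_value p q c x has_real_derivative (\<Sum>n. g' n s)) (at s)" if s: "S0 \<le> s" for s
  proof -
    \<comment> \<open>Termwise differentiation takes place on \<open>{S0/2<..}\<close>, an open set
      on which the derivatives have a geometric majorant.\<close>
    have M: "\<bar>g' n t\<bar> \<le> F * rr (S0 / 2) ^ n" if "S0 / 2 < t" for n t
    proof -
      have "\<bar>g' n t\<bar> = \<bar>l n * c n\<bar> * \<bar>sine_mode p q n x\<bar> * rr t ^ (Suc n)\<^sup>2"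
        unfolding g'_def er using rr by (simp add: abs_mult)
      also have "\<dots> \<le> F * 1 * rr (S0 / 2) ^ n"
      proof (intro mult_mono)
        have "rr t ^ (Suc n)\<^sup>2 \<le> rr t ^ n"
          using rr rr1[of t] that S(1) by (intro power_decreasing) (auto simp: power2_eq_square)
        also have "\<dots> \<le> rr (S0 / 2) ^ n" using rr that rr_anti by (intro power_mono) auto
        finally show "rr t ^ (Suc n)\<^sup>2 \<le> rr (S0 / 2) ^ n" .
      qed (use lc abs_sine_mode_le F0 rr in auto)
      finally show ?thesis by simp
    qed
    have "((\<lambda>s. \<Sum>n. g n s) has_real_derivative (\<Sum>n. g' n s)) (at s)"
    proof (rule has_field_derivative_series'(2)[where S = "{S0/2<..}" and x0 = s])
      show "(g n has_real_derivative g' n t) (at t within {S0/2<..})" for n t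
        unfolding g_def g'_def by (auto intro!: derivative_eq_intros)
      show "uniformly_convergent_on {S0/2<..} (\<lambda>n t. \<Sum>i<n. g' i t)"
        using M rr1[of "S0 / 2"] rr S(1)
        by (intro Weierstrass_m_test'[where M = "\<lambda>n. F * rr (S0 / 2) ^ n"] summable_mult summable_geometric) auto
      show "summable (\<lambda>n. g n s)"
      proof (rule summable_comparison_test'[OF summable_inverse_sine_eigenvalue[OF assms(1), of F]])
        fix n
        have "\<bar>c n\<bar> \<le> F / l n" using lc[of n] l[of n] by (simp add: abs_mult field_simps)
        moreover have "rr s ^ (Suc n)\<^sup>2 \<le> 1"
          using rr rr1[of s] s S(1) by (intro power_le_one) (auto intro: less_imp_le)
        ultimately have "\<bar>c n\<bar> * \<bar>sine_mode p q n x\<bar> * rr s ^ (Suc n)\<^sup>2 \<le> F / l n * 1 * 1"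
          using abs_sine_mode_le F0 l[of n] rr by (intro mult_mono) (auto intro: less_imp_le)
        then show "norm (g n s) \<le> F / sine_eigenvalue p q n"
          unfolding g_def er using rr by (simp add: abs_mult l_def)
      qed
    qed (use s S(1) in \<open>auto simp: interior_open\<close>)
    then show ?thesis unfolding heat_value_def[abs_def] g_def l_def .
  qed
  \<comment> \<open>\<open>rr\<close> decreases in time, so its value at \<open>S1\<close> is the
    worst on the interval; this is where the upper end of the time range enters.\<close>
  define \<kappa> where "\<kappa> = K * rr S1 * sine_mode p q 0 x * l 0"
  have \<kappa>: "0 < \<kappa>" using K(1) l sine_mode_pos[OF x] by (simp add: \<kappa>_def rr_def)
  have lower: "\<kappa> * (- c 0) \<le> (\<Sum>n. g' n s)" if s: "S0 \<le> s" "s \<le> S1" for s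
  proof -
    have "\<kappa> * (- c 0) = K * rr S1 * (sine_mode p q 0 x * (- l 0 * c 0))" by (simp add: \<kappa>_def)
    also have "\<dots> \<le> K * rr s * (sine_mode p q 0 x * (- l 0 * c 0))"
    proof (intro mult_right_mono mult_left_mono)
      have "0 \<le> l 0 * (- c 0)" using l[of 0] c0 by (intro mult_nonneg_nonneg) auto
      then have "0 \<le> - l 0 * c 0" by simp
      then show "0 \<le> sine_mode p q 0 x * (- l 0 * c 0)"
        by (rule mult_nonneg_nonneg[OF less_imp_le[OF sine_mode_pos[OF x]]])
    qed (use K(1) rr_anti s in auto)
    also have "\<dots> \<le> (\<Sum>n. rr s ^ (Suc n)\<^sup>2 * (- l n * c n * sine_mode p q n x))"
      using s by (intro K(2) rr rr_anti)
    also have "\<dots> = (\<Sum>n. g' n s)"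
      unfolding g'_def er by (simp add: mult_ac)
    finally show ?thesis .
  qed
  have "\<kappa> * (- c 0) * (s1 - s2) \<le> heat_value p q c x s1 - heat_value p q c x s2"
    if s: "S0 \<le> s2" "s2 \<le> s1" "s1 \<le> S1" for s1 s2
  proof -
    have "heat_value p q c x s2 - \<kappa> * (- c 0) * s2 \<le> heat_value p q c x s1 - \<kappa> * (- c 0) * s1"
    proof (rule DERIV_nonneg_imp_nondecreasing[OF s(2)])
      fix s assume "s2 \<le> s" "s \<le> s1"
      then have s': "S0 \<le> s" "s \<le> S1" using s by auto
      have "((\<lambda>s. heat_value p q c x s - \<kappa> * (- c 0) * s) has_real_derivative (\<Sum>n. g' n s) - \<kappa> * (- c 0) * 1) (at s)"
        by (intro DERIV_diff deriv s' DERIV_cmult DERIV_ident)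
      then show "\<exists>y. ((\<lambda>s. heat_value p q c x s - \<kappa> * (- c 0) * s) has_real_derivative y) (at s) \<and> 0 \<le> y"
        using lower[OF s'] by (intro exI conjI) auto
    qed
    then show ?thesis by (simp add: algebra_simps)
  qed
  with \<kappa> show ?thesis by blast
qed

lemma sine_mode_orthogonal:
  assumes "p < q"
  shows "(LINT x|lebesgue_on {p<..<q}. sine_mode p q n x * sine_mode p q m x) = (if n = m then (q - p) / 2 else 0)"
proof (cases "n = m")
  case False
  let ?I = "\<lambda>n m. LINT x|lebesgue_on {p<..<q}. sine_mode p q n x * sine_mode p q m x"
  have e: "(LINT x|lebesgue_on {p<..<q}. weak_deriv {p<..<q} (sine_mode p q n) x * weak_deriv {p<..<q} (sine_mode p q m) x) =
    sine_eigenvalue p q m * ?I n m" for n m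
    by (rule sine_mode_eigen[OF assms sine_mode_H10[OF assms]])
  have "sine_eigenvalue p q m * ?I n m = sine_eigenvalue p q n * ?I m n"
    unfolding e[symmetric] by (simp add: mult.commute)
  also have "?I m n = ?I n m" by (simp add: mult.commute)
  finally have "(sine_eigenvalue p q m - sine_eigenvalue p q n) * ?I n m = 0" by (simp add: algebra_simps)
  moreover have "sine_eigenvalue p q m \<noteq> sine_eigenvalue p q n"
  proof -
    have "(Suc m)\<^sup>2 \<noteq> (Suc n)\<^sup>2" using False power_eq_iff_eq_base[of 2 "Suc m" "Suc n"] by auto
    then have "real ((Suc m)\<^sup>2) \<noteq> real ((Suc n)\<^sup>2)" by (simp only: of_nat_eq_iff not_False_eq_True)
    then show ?thesis
      using sine_eigenvalue_pos[OF assms, of 0] unfolding sine_eigenvalue_eq[of p q m] sine_eigenvalue_eq[of p q n] by simp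
  qed
  ultimately show ?thesis using False by simp
next
  case True
  define w where "w = real (Suc n) * (pi / (q - p))"
  have w: "0 < w" using assms by (simp add: w_def)
  have s: "sine_mode p q n x = sin (w * (x - p))" for x by (simp only: sine_mode_def w_def mult.assoc)
  have c: "continuous_on {p..q} (\<lambda>x. sine_mode p q n x * sine_mode p q n x)"
    by (intro continuous_on_mult smooth_alg_continuous sine_mode_smooth_alg)
  have "((\<lambda>x. sine_mode p q n x * sine_mode p q n x) has_integral
     (q / 2 - sin (2 * (w * (q - p))) / (4 * w)) - (p / 2 - sin (2 * (w * (p - p))) / (4 * w))) {p..q}"
  proof (rule fundamental_theorem_of_calculus)
    fix x
    have "((\<lambda>x. x / 2 - sin (2 * (w * (x - p))) / (4 * w)) has_real_derivative 1 / 2 - cos (2 * (w * (x - p))) * (2 * w) / (4 * w)) (at x within {p..q})"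
      using w by (auto intro!: derivative_eq_intros)
    also have "1 / 2 - cos (2 * (w * (x - p))) * (2 * w) / (4 * w) = sine_mode p q n x * sine_mode p q n x"
      using w unfolding s cos_double_sin by (simp add: field_simps power2_eq_square)
    finally show "((\<lambda>x. x / 2 - sin (2 * (w * (x - p))) / (4 * w)) has_vector_derivative sine_mode p q n x * sine_mode p q n x) (at x within {p..q})"
      unfolding has_real_derivative_iff_has_vector_derivative[symmetric] .
  qed (use assms in simp)
  moreover have "2 * (w * (q - p)) = real (2 * Suc n) * pi" using assms by (simp add: w_def)
  then have "sin (2 * (w * (q - p))) = 0" by (simp only: sin_npi)
  ultimately have "((\<lambda>x. sine_mode p q n x * sine_mode p q n x) has_integral (q - p) / 2) {p..q}"
    by (simp add: diff_divide_distrib)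
  then show ?thesis
    using True integral_Ioo_continuous[OF c] by (simp add: integral_unique)
qed

text \<open>The uniform limit \<open>w\<close> of the series is continuous and, by orthogonality,
  has the coefficients \<open>d n * ((q - p) / 2)\<close>. Subtracting
  \<open>2 / (q - p) * w\<close> from \<open>v\<close> leaves a continuous function orthogonal to
  all modes, which vanishes by completeness.\<close>

lemma sine_series_unique:
  assumes "p < q" and v: "continuous_on {p..q} v" and d: "summable (\<lambda>n. \<bar>d n\<bar>)"
    and coeff: "\<And>n. sine_coeff p q v n = d n"
    and x: "x \<in> {p<..<q}"
  shows "v x = 2 / (q - p) * (\<Sum>n. d n * sine_mode p q n x)"
proof -
  let ?S = "{p<..<q}"
  have bd: "\<bar>d n * sine_mode p q n x\<bar> \<le> \<bar>d n\<bar>" for n x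
    using abs_sine_mode_le[of p q n x] by (simp add: abs_mult mult_left_le)
  have sc: "continuous_on A (sine_mode p q n)" for A n by (rule smooth_alg_continuous[OF sine_mode_smooth_alg])
  define w where "w x = (\<Sum>n. d n * sine_mode p q n x)" for x
  have ul: "uniform_limit {p..q} (\<lambda>n x. \<Sum>i<n. d i * sine_mode p q i x) w sequentially"
    unfolding w_def by (rule Weierstrass_m_test[OF _ d]) (simp only: real_norm_def bd)
  have wc: "continuous_on {p..q} w"
    by (rule uniform_limit_theorem[OF _ ul])
       (auto intro!: always_eventually continuous_on_sum continuous_on_mult continuous_on_const sc)
  have wcoeff: "(LINT x|lebesgue_on ?S. w x * sine_mode p q m x) = d m * ((q - p) / 2)" for m
  proof -
    have i: "integrable (lebesgue_on ?S) (\<lambda>x. d n * sine_mode p q n x * sine_mode p q m x)" for n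
      unfolding mult.assoc by (intro integrable_mult_right L2_mult_integrable sine_mode_L2)
    have le: "norm (d n * sine_mode p q n x * sine_mode p q m x) \<le> \<bar>d n\<bar>" for n x
    proof -
      have "\<bar>d n * sine_mode p q n x\<bar> * \<bar>sine_mode p q m x\<bar> \<le> \<bar>d n\<bar> * 1"
        by (intro mult_mono bd abs_sine_mode_le) auto
      then show ?thesis by (simp only: real_norm_def abs_mult[of "_ * _" "sine_mode p q m x"] mult_1_right)
    qed
    have sn: "summable (\<lambda>n. norm (d n * sine_mode p q n x * sine_mode p q m x))" for x
      by (rule summable_comparison_test'[OF d]) (use le in simp)
    have si: "summable (\<lambda>n. LINT x|lebesgue_on ?S. norm (d n * sine_mode p q n x * sine_mode p q m x))"
    proof (rule summable_comparison_test'[OF summable_mult[OF d, of "measure (lebesgue_on ?S) ?S"]])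
      fix n
      have "(LINT x|lebesgue_on ?S. norm (d n * sine_mode p q n x * sine_mode p q m x)) \<le> (LINT x|lebesgue_on ?S. \<bar>d n\<bar>)"
        using i le by (intro integral_mono integrable_norm) (auto intro: integrable_bounded_Ioo)
      then show "norm (LINT x|lebesgue_on ?S. norm (d n * sine_mode p q n x * sine_mode p q m x)) \<le> measure (lebesgue_on ?S) ?S * \<bar>d n\<bar>"
        by simp
    qed
    have ws: "w x * sine_mode p q m x = (\<Sum>n. d n * sine_mode p q n x * sine_mode p q m x)" for x
      unfolding w_def by (rule suminf_mult2, rule summable_comparison_test'[OF d]) (simp only: real_norm_def bd)
    have "(LINT x|lebesgue_on ?S. w x * sine_mode p q m x) = (\<Sum>n. LINT x|lebesgue_on ?S. d n * sine_mode p q n x * sine_mode p q m x)"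
      unfolding ws by (rule integral_suminf[OF i AE_I2[OF sn] si])
    also have "\<dots> = (\<Sum>n. if n = m then d n * ((q - p) / 2) else 0)"
      using sine_mode_orthogonal[OF assms(1)] by (intro suminf_cong) (simp add: mult.assoc)
    also have "\<dots> = d m * ((q - p) / 2)"
      by (subst suminf_finite[of "{m}"]) auto
    finally show ?thesis .
  qed
  have wL: "w \<in> L2 ?S" and vL: "v \<in> L2 ?S" by (intro L2_continuous wc v)+
  have "v x - 2 / (q - p) * w x = 0"
  proof (rule sine_complete_continuous[OF assms(1) _ _ x])
    show "continuous_on {p..q} (\<lambda>x. v x - 2 / (q - p) * w x)"
      by (intro continuous_on_diff continuous_on_mult continuous_on_const v wc)
    fix n
    have "(LINT x|lebesgue_on ?S. (v x - 2 / (q - p) * w x) * sine_mode p q n x) =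
      (LINT x|lebesgue_on ?S. v x * sine_mode p q n x - 2 / (q - p) * (w x * sine_mode p q n x))"
      by (simp only: left_diff_distrib mult.assoc)
    also have "\<dots> = d n - 2 / (q - p) * (d n * ((q - p) / 2))"
      using wL vL by (simp add: L2_mult_integrable sine_mode_L2 coeff wcoeff)
    also have "\<dots> = 0" using assms(1) by simp
    finally show "(LINT x|lebesgue_on ?S. (v x - 2 / (q - p) * w x) * sin (real (Suc n) * (pi / (q - p) * (x - p)))) = 0"
      by (simp only: sine_mode_def)
  qed
  then show ?thesis by (simp add: w_def)
qed

definition frac_heat_value :: "real \<Rightarrow> real \<Rightarrow> real \<Rightarrow> (nat \<Rightarrow> real) \<Rightarrow> real \<Rightarrow> real \<Rightarrow> real" where
  "frac_heat_value \<alpha> p q c x s = (\<Sum>n. c n * sine_mode p q n x * mittag_leffler \<alpha> (- (sine_eigenvalue p q n * s)))"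

text \<open>Subordination: the fractional solution is a limit of averages of the heat solution over the random
  times \<open>s (j + 1) N powr (- \<alpha>)\<close>.\<close>

lemma frac_heat_value_limit:
  assumes "p < q" "0 < \<alpha>" "\<alpha> \<le> 1" "0 \<le> s" and c: "\<And>n. \<bar>c n\<bar> \<le> F / sine_eigenvalue p q n"
  shows "(\<lambda>N. \<Sum>j\<le>N. chain_prob \<alpha> N j * heat_value p q c x (s * (real (Suc j) * real N powr (- \<alpha>))))
    \<longlonglongrightarrow> frac_heat_value \<alpha> p q c x s"
proof -
  define l where "l = sine_eigenvalue p q"
  have l: "0 < l n" for n using assms(1) by (simp add: l_def sine_eigenvalue_pos)
  define g where "g n = c n * sine_mode p q n x" for n
  have g: "\<bar>g n\<bar> \<le> F / l n" for n
  proof -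
    have "\<bar>c n\<bar> * \<bar>sine_mode p q n x\<bar> \<le> \<bar>c n\<bar> * 1" using abs_sine_mode_le by (intro mult_left_mono) auto
    then show ?thesis using c[of n] by (simp add: g_def abs_mult l_def)
  qed
  have sF: "summable (\<lambda>n. F / l n)" unfolding l_def by (rule summable_inverse_sine_eigenvalue[OF assms(1)])
  have "(\<lambda>N. \<Sum>n. g n * chain_laplace \<alpha> N (l n * s)) \<longlonglongrightarrow> (\<Sum>n. g n * mittag_leffler \<alpha> (- (l n * s)))"
  proof (rule tannerys_theorem[THEN conjunct2, THEN conjunct2])
    show "(\<lambda>N. g n * chain_laplace \<alpha> N (l n * s)) \<longlonglongrightarrow> g n * mittag_leffler \<alpha> (- (l n * s))" for n
      using l[of n] assms by (intro tendsto_mult tendsto_const chain_laplace_tendsto) auto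
    have "norm (g n * chain_laplace \<alpha> N (l n * s)) \<le> F / l n" for n N
    proof -
      have "\<bar>chain_laplace \<alpha> N (l n * s)\<bar> \<le> 1"
        using chain_laplace_bounds[OF assms(2,3), of "l n * s" N] l[of n] assms(4) by simp
      from mult_mono[OF g this] show ?thesis using order_trans[OF abs_ge_zero g] by (simp add: abs_mult)
    qed
    then show "\<forall>\<^sub>F (n, N) in sequentially \<times>\<^sub>F sequentially. norm (g n * chain_laplace \<alpha> N (l n * s)) \<le> F / l n"
      by (intro always_eventually) auto
  qed (use sF in auto)
  moreover have "(\<Sum>n. g n * chain_laplace \<alpha> N (l n * s)) =
      (\<Sum>j\<le>N. chain_prob \<alpha> N j * heat_value p q c x (s * (real (Suc j) * real N powr (- \<alpha>))))" for N
  proof -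
    have sm: "summable (\<lambda>n. g n * exp (- l n * t))" if "0 \<le> t" for t
    proof (rule summable_comparison_test'[OF sF])
      fix n
      have "exp (- l n * t) \<le> 1" using l[of n] that by simp
      then have "\<bar>g n\<bar> * exp (- l n * t) \<le> F / l n * 1"
        using g[of n] order_trans[OF abs_ge_zero g[of n]] by (intro mult_mono) auto
      then show "norm (g n * exp (- l n * t)) \<le> F / l n" by (simp add: abs_mult)
    qed
    define \<Theta> where "\<Theta> j = s * (real (Suc j) * real N powr (- \<alpha>))" for j
    have \<Theta>: "0 \<le> \<Theta> j" for j using assms(4) by (simp add: \<Theta>_def)
    have "g n * chain_laplace \<alpha> N (l n * s) = (\<Sum>j\<le>N. chain_prob \<alpha> N j * (g n * exp (- l n * \<Theta> j)))" for n
      unfolding chain_laplace_def sum_distrib_left \<Theta>_def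
      by (intro sum.cong refl) (simp only: mult_ac mult_minus_left mult_minus_right)
    then have "(\<Sum>n. g n * chain_laplace \<alpha> N (l n * s)) = (\<Sum>n. \<Sum>j\<le>N. chain_prob \<alpha> N j * (g n * exp (- l n * \<Theta> j)))"
      by (simp only:)
    also have "\<dots> = (\<Sum>j\<le>N. \<Sum>n. chain_prob \<alpha> N j * (g n * exp (- l n * \<Theta> j)))"
      by (intro suminf_sum summable_mult sm \<Theta>)
    also have "\<dots> = (\<Sum>j\<le>N. chain_prob \<alpha> N j * heat_value p q c x (\<Theta> j))"
      unfolding heat_value_def g_def[symmetric] l_def[symmetric]
      by (intro sum.cong refl suminf_mult sm \<Theta>)
    finally show ?thesis by (simp only: \<Theta>_def)
  qed
  ultimately show ?thesis
    unfolding frac_heat_value_def g_def l_def by simp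
qed

text \<open>A positive time factor \<Theta> preserves the order of the arguments, so every term of
  the average is nonnegative. Terms with \<Theta> in \<open>[A, B]\<close> evaluate the heat
  solution between \<open>S0 * A\<close> and \<open>S1 * B'\<close>, where one rate \<open>K\<close>
  is valid; their total mass is at least \<open>C\<close>, and \<open>\<Theta> \<ge> A\<close> gives
  the factor \<open>A\<close>.\<close>

lemma frac_heat_value_diff:
  assumes "p < q" "0 < \<alpha>" "\<alpha> \<le> 1" and x: "x \<in> {p<..<q}"
    and f: "f \<in> L2 {p<..<q}" "AE x in lebesgue_on {p<..<q}. 0 \<le> f x"
    and b: "\<And>n. sine_coeff p q f n = - sine_eigenvalue p q n * c n"
    and c0: "c 0 < 0" and S: "0 < S0" "S0 \<le> S1"
  shows "\<exists>K>0. \<forall>s1 s2. S0 \<le> s2 \<longrightarrow> s2 \<le> s1 \<longrightarrow> s1 \<le> S1 \<longrightarrow>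
    K * (s1 - s2) \<le> frac_heat_value \<alpha> p q c x s1 - frac_heat_value \<alpha> p q c x s2"
proof -
  define F where "F = (LINT x|lebesgue_on {p<..<q}. \<bar>f x\<bar>)"
  have cF: "\<bar>c n\<bar> \<le> F / sine_eigenvalue p q n" for n
    using abs_sine_coefficient_le[OF f(1), of n] sine_eigenvalue_pos[OF assms(1), of n]
    unfolding b F_def by (simp add: abs_mult field_simps)
  obtain A B C where ABC: "0 < A" "0 < B" "0 < C"
    and conc: "eventually (\<lambda>n. C \<le> (\<Sum>j | j \<le> n \<and> A \<le> real (Suc j) * real n powr (- \<alpha>) \<and>
     real (Suc j) * real n powr (- \<alpha>) \<le> B. chain_prob \<alpha> n j)) sequentially"
    using chain_prob_concentration[OF assms(2,3)] by blast
  \<comment> \<open>\<open>A \<le> B\<close> is not part of the concentration statement; the maximum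
    makes sure that the time range is nonempty.\<close>
  define B' where "B' = max A B"
  have B': "A \<le> B'" "B \<le> B'" by (auto simp: B'_def)
  have "S0 * A \<le> S1 * B'" using S ABC B' by (intro mult_mono) auto
  then obtain K where K: "0 < K" "\<And>s1 s2. S0 * A \<le> s2 \<Longrightarrow> s2 \<le> s1 \<Longrightarrow> s1 \<le> S1 * B' \<Longrightarrow>
    K * (- c 0) * (s1 - s2) \<le> heat_value p q c x s1 - heat_value p q c x s2"
    using heat_value_mono[OF assms(1) x f b, of "S0 * A" "S1 * B'"] S ABC by auto
  \<comment> \<open>Here the time range is \<open>[s2, s1]\<close> itself, so the rate depends on
    it; only its sign is used.\<close>
  have mono: "heat_value p q c x s2 \<le> heat_value p q c x s1" if s: "0 < s2" "s2 \<le> s1" for s1 s2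
  proof -
    obtain K' where "0 < K'" "K' * (- c 0) * (s1 - s2) \<le> heat_value p q c x s1 - heat_value p q c x s2"
      using heat_value_mono[OF assms(1) x f b s] s by auto
    moreover have "0 \<le> K' * (- c 0) * (s1 - s2)"
      using \<open>0 < K'\<close> c0 s by (intro mult_nonneg_nonneg) auto
    ultimately show ?thesis by linarith
  qed
  have "C * (K * (- c 0) * A) * (s1 - s2) \<le> frac_heat_value \<alpha> p q c x s1 - frac_heat_value \<alpha> p q c x s2"
    if s: "S0 \<le> s2" "s2 \<le> s1" "s1 \<le> S1" for s1 s2
  proof -
    have s0: "0 \<le> s1" "0 \<le> s2" "0 < s2" using s S by auto
    have lim: "(\<lambda>N. (\<Sum>j\<le>N. chain_prob \<alpha> N j * heat_value p q c x (s1 * (real (Suc j) * real N powr (- \<alpha>)))) -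
       (\<Sum>j\<le>N. chain_prob \<alpha> N j * heat_value p q c x (s2 * (real (Suc j) * real N powr (- \<alpha>)))))
      \<longlonglongrightarrow> frac_heat_value \<alpha> p q c x s1 - frac_heat_value \<alpha> p q c x s2"
      by (intro tendsto_diff frac_heat_value_limit[OF assms(1-3) _ cF] s0)
    show ?thesis
    proof (rule tendsto_lowerbound[OF lim])
      show "eventually (\<lambda>N. C * (K * (- c 0) * A) * (s1 - s2) \<le>
         (\<Sum>j\<le>N. chain_prob \<alpha> N j * heat_value p q c x (s1 * (real (Suc j) * real N powr (- \<alpha>)))) -
         (\<Sum>j\<le>N. chain_prob \<alpha> N j * heat_value p q c x (s2 * (real (Suc j) * real N powr (- \<alpha>))))) sequentially"
        using conc eventually_gt_at_top[of 0]
      proof eventually_elim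
        case (elim N)
        define \<Theta> where "\<Theta> j = real (Suc j) * real N powr (- \<alpha>)" for j
        define J where "J = {j. j \<le> N \<and> A \<le> \<Theta> j \<and> \<Theta> j \<le> B}"
        define h where "h j = heat_value p q c x (s1 * \<Theta> j) - heat_value p q c x (s2 * \<Theta> j)" for j
        have \<Theta>: "0 < \<Theta> j" for j using elim(2) by (simp add: \<Theta>_def)
        have P: "0 \<le> chain_prob \<alpha> N j" for j using assms by (simp add: chain_prob_nonneg)
        have h0: "0 \<le> h j" for j
          unfolding h_def using mono[of "s2 * \<Theta> j" "s1 * \<Theta> j"] \<Theta>[of j] s0 s by (simp add: mult_right_mono)
        have hJ: "(K * (- c 0) * A) * (s1 - s2) \<le> h j" if "j \<in> J" for j
        proof -
          have j: "A \<le> \<Theta> j" "\<Theta> j \<le> B" using that by (auto simp: J_def)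
          have "K * (- c 0) * (s1 - s2) * A \<le> K * (- c 0) * (s1 - s2) * \<Theta> j"
            using K(1) c0 s j by (intro mult_left_mono mult_nonneg_nonneg) auto
          also have "\<dots> = K * (- c 0) * (s1 * \<Theta> j - s2 * \<Theta> j)" by (simp add: algebra_simps)
          also have "\<dots> \<le> h j"
            unfolding h_def
          proof (rule K(2))
            show "S0 * A \<le> s2 * \<Theta> j" using s S j ABC by (intro mult_mono) auto
            show "s2 * \<Theta> j \<le> s1 * \<Theta> j" using s \<Theta>[of j] by (intro mult_right_mono) auto
            show "s1 * \<Theta> j \<le> S1 * B'" using s S j B' ABC \<Theta>[of j] by (intro mult_mono) auto
          qed
          finally show ?thesis by (simp add: mult_ac)
        qed
        have M0: "0 \<le> (K * (- c 0) * A) * (s1 - s2)"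
          using K(1) c0 ABC s by (intro mult_nonneg_nonneg) auto
        have "C * ((K * (- c 0) * A) * (s1 - s2)) \<le> (\<Sum>j\<in>J. chain_prob \<alpha> N j) * ((K * (- c 0) * A) * (s1 - s2))"
          using elim(1) M0 unfolding J_def \<Theta>_def by (intro mult_right_mono) auto
        also have "\<dots> \<le> (\<Sum>j\<in>J. chain_prob \<alpha> N j * h j)"
          unfolding sum_distrib_right by (intro sum_mono mult_left_mono hJ P)
        also have "\<dots> \<le> (\<Sum>j\<le>N. chain_prob \<alpha> N j * h j)"
          by (intro sum_mono2) (auto simp: J_def intro!: mult_nonneg_nonneg P h0)
        finally show ?case
          by (simp only: h_def \<Theta>_def right_diff_distrib sum_subtractf mult.assoc)
      qed
    qed simp
  qed
  moreover have "0 < C * (K * (- c 0) * A)"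
    using K(1) ABC c0 by (intro mult_pos_pos) auto
  ultimately show ?thesis by blast
qed

text \<open>The decay of the coefficients of \<open>u0\<close> like the inverse eigenvalues makes
  the series absolutely summable, with the Mittag-Leffler factor bounded merely by 1.\<close>

lemma weak_solution_value:
  assumes "0 < \<alpha>" "\<alpha> \<le> 1" "0 < a" "p < q" and sol: "weak_solution \<alpha> T {p<..<q} a u0 u"
    and u0: "u0 \<in> L2 {p<..<q}"
    and cont: "continuous_on ({0<..<T} \<times> {p..q}) (\<lambda>(t, x). u t x)"
    and t: "t \<in> {0<..<T}" and x: "x \<in> {p<..<q}"
    and c: "\<And>n. \<bar>sine_coeff p q u0 n\<bar> \<le> F / sine_eigenvalue p q n"
  shows "u t x = 2 / (q - p) *
    frac_heat_value \<alpha> p q (\<lambda>n. sine_coeff p q u0 n) x (a * t powr \<alpha>)"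
proof -
  define c where "c n = (sine_coeff p q u0 n)" for n
  define d where "d n = c n * mittag_leffler \<alpha> (- (sine_eigenvalue p q n * (a * t powr \<alpha>)))" for n
  have ml: "\<bar>mittag_leffler \<alpha> (- (sine_eigenvalue p q n * (a * t powr \<alpha>)))\<bar> \<le> 1" for n
    using mittag_leffler_bounds[OF assms(1,2), of "sine_eigenvalue p q n * (a * t powr \<alpha>)"]
      sine_eigenvalue_pos[OF assms(4), of n] assms(3) by simp
  have sd: "summable (\<lambda>n. \<bar>d n\<bar>)"
  proof (rule summable_comparison_test'[OF summable_inverse_sine_eigenvalue[OF assms(4), of F]])
    fix n
    have "\<bar>c n\<bar> * \<bar>mittag_leffler \<alpha> (- (sine_eigenvalue p q n * (a * t powr \<alpha>)))\<bar> \<le> \<bar>c n\<bar> * 1"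
      using ml by (intro mult_left_mono) auto
    then show "norm \<bar>d n\<bar> \<le> F / sine_eigenvalue p q n"
      using c[of n] by (simp add: d_def c_def abs_mult)
  qed
  have cd: "sine_coeff p q (u t) n = d n" for n
    unfolding sine_coefficient_mittag_leffler[OF assms(1-4) sol u0 cont t] d_def c_def
    by (simp add: mult_ac)
  have "u t x = 2 / (q - p) * (\<Sum>n. d n * sine_mode p q n x)"
    by (rule sine_series_unique[OF assms(4) continuous_on_slice[OF cont t] sd cd x])
  then show ?thesis
    unfolding frac_heat_value_def d_def c_def by (simp add: mult_ac)
qed

section \<open>Harmonic means of ordered coefficients\<close>

lemma homogenized_coeff_bounds:
  assumes "0 < l" "0 < \<nu>" and m: "a \<in> borel_measurable (lebesgue_on {0<..<l})"
    and bd: "AE y in lebesgue_on {0<..<l}. \<nu> \<le> a y \<and> a y \<le> \<mu>"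
  shows "integrable (lebesgue_on {0<..<l}) (\<lambda>y. 1 / a y)"
    and "0 < (LINT y|lebesgue_on {0<..<l}. 1 / a y)"
    and "(LINT y|lebesgue_on {0<..<l}. 1 / a y) \<le> l / \<nu>"
    and "homogenized_coeff {0<..<l} a = l / (LINT y|lebesgue_on {0<..<l}. 1 / a y)"
    and "\<nu> \<le> homogenized_coeff {0<..<l} a" "homogenized_coeff {0<..<l} a \<le> \<mu>"
proof -
  let ?Y = "{0<..<l}"
  have ml: "measure lebesgue ?Y = l" using assms(1) by simp
  have ms: "measure (lebesgue_on ?Y) ?Y = l" using assms(1) by (simp add: measure_restrict_space)
  \<comment> \<open>\<open>\<nu> \<le> \<mu>\<close> is derived: otherwise the bounds on
    \<open>a\<close> would be contradictory almost everywhere on an interval of positive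
    length.\<close>
  have "\<not> (AE y in lebesgue_on ?Y. False)"
  proof
    assume "AE y in lebesgue_on ?Y. False"
    then have "(1::real) = 0" using continuous_AE_zero[of 0 l "\<lambda>_. 1" "l / 2"] assms(1) by simp
    then show False by simp
  qed
  moreover have "AE y in lebesgue_on ?Y. False" if "\<mu> < \<nu>"
    using bd by eventually_elim (use that in auto)
  ultimately have \<mu>: "\<nu> \<le> \<mu>" by (auto simp: not_less[symmetric])
  have mm: "(\<lambda>y. 1 / a y) \<in> borel_measurable (lebesgue_on ?Y)" using m by measurable
  have ab: "AE y in lebesgue_on ?Y. 1 / \<mu> \<le> 1 / a y \<and> 1 / a y \<le> 1 / \<nu>"
    using bd by eventually_elim (use assms(2) in \<open>auto intro!: divide_left_mono mult_pos_pos\<close>)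
  show i: "integrable (lebesgue_on ?Y) (\<lambda>y. 1 / a y)"
  proof (rule finite_measure.integrable_const_bound[OF finite_measure_Ioo _ mm])
    show "AE y in lebesgue_on ?Y. norm (1 / a y) \<le> 1 / \<nu>"
      using ab bd by eventually_elim (use assms(2) in auto)
  qed
  have ic: "integrable (lebesgue_on ?Y) (\<lambda>y. k)" for k :: real
    by (rule integrable_bounded_Ioo[where B = "\<bar>k\<bar>"]) auto
  have lo: "l / \<mu> \<le> (LINT y|lebesgue_on ?Y. 1 / a y)"
    using integral_mono_AE[OF ic[of "1 / \<mu>"] i] ab ms by (auto elim: eventually_mono)
  have "0 < l / \<mu>" using assms \<mu> by simp
  with lo show pos: "0 < (LINT y|lebesgue_on ?Y. 1 / a y)" by linarith
  show hi: "(LINT y|lebesgue_on ?Y. 1 / a y) \<le> l / \<nu>"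
    using integral_mono_AE[OF i ic[of "1 / \<nu>"]] ab ms by (auto elim: eventually_mono)
  show e: "homogenized_coeff ?Y a = l / (LINT y|lebesgue_on ?Y. 1 / a y)"
    by (simp add: homogenized_coeff_def mean_def ml)
  show "\<nu> \<le> homogenized_coeff ?Y a" "homogenized_coeff ?Y a \<le> \<mu>"
    unfolding e using lo hi pos assms \<mu> by (auto simp: field_simps)
qed

text \<open>\<open>1 / a2 - 1 / a1\<close> equals \<open>(a1 - a2) / (a1 * a2)\<close>, at least
  \<open>(a1 - a2) / \<mu>\<^sup>2\<close>, and the harmonic means differ by
  \<open>l * (I2 - I1) / (I1 * I2)\<close> with both integrals at most \<open>l / \<nu>\<close>. The
  order of the coefficients excludes cancellation in \<open>I2 - I1\<close>.\<close>

lemma homogenized_coeff_diff: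
  assumes "0 < l" "0 < \<nu>" and m: "a1 \<in> borel_measurable (lebesgue_on {0<..<l})" "a2 \<in> borel_measurable (lebesgue_on {0<..<l})"
    and bd: "AE y in lebesgue_on {0<..<l}. \<nu> \<le> a1 y \<and> a1 y \<le> \<mu>" "AE y in lebesgue_on {0<..<l}. \<nu> \<le> a2 y \<and> a2 y \<le> \<mu>"
    and le: "AE y in lebesgue_on {0<..<l}. a2 y \<le> a1 y"
  shows "\<nu>\<^sup>2 / (l * \<mu>\<^sup>2) * (LINT y|lebesgue_on {0<..<l}. \<bar>a1 y - a2 y\<bar>) \<le>
    homogenized_coeff {0<..<l} a1 - homogenized_coeff {0<..<l} a2"
proof -
  let ?Y = "{0<..<l}"
  note h1 = homogenized_coeff_bounds[OF assms(1,2) m(1) bd(1)]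
  note h2 = homogenized_coeff_bounds[OF assms(1,2) m(2) bd(2)]
  define I1 where "I1 = (LINT y|lebesgue_on ?Y. 1 / a1 y)"
  define I2 where "I2 = (LINT y|lebesgue_on ?Y. 1 / a2 y)"
  define D where "D = (LINT y|lebesgue_on ?Y. \<bar>a1 y - a2 y\<bar>)"
  have \<mu>: "0 < \<mu>" using h1(5,6) assms(2) by linarith
  have "D / \<mu>\<^sup>2 = (LINT y|lebesgue_on ?Y. \<bar>a1 y - a2 y\<bar> / \<mu>\<^sup>2)" by (simp add: D_def)
  also have "\<dots> \<le> (LINT y|lebesgue_on ?Y. 1 / a2 y - 1 / a1 y)"
  proof (rule integral_mono_AE)
    have "integrable (lebesgue_on ?Y) (\<lambda>y. \<bar>a1 y - a2 y\<bar>)"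
    proof (rule finite_measure.integrable_const_bound[OF finite_measure_Ioo])
      show "AE y in lebesgue_on ?Y. norm \<bar>a1 y - a2 y\<bar> \<le> \<mu>"
        using bd by eventually_elim (use assms(2) in auto)
    qed (use m in measurable)
    then show "integrable (lebesgue_on ?Y) (\<lambda>y. \<bar>a1 y - a2 y\<bar> / \<mu>\<^sup>2)" by simp
    show "AE y in lebesgue_on ?Y. \<bar>a1 y - a2 y\<bar> / \<mu>\<^sup>2 \<le> 1 / a2 y - 1 / a1 y"
      using bd le
    proof eventually_elim
      case (elim y)
      then have p: "0 < a1 y" "0 < a2 y" using assms(2) by auto
      have "a1 y * a2 y \<le> \<mu>\<^sup>2" unfolding power2_eq_square using elim p by (intro mult_mono) auto
      then have "(a1 y - a2 y) / \<mu>\<^sup>2 \<le> (a1 y - a2 y) / (a1 y * a2 y)"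
        using elim p \<mu> by (intro divide_left_mono) auto
      also have "\<dots> = 1 / a2 y - 1 / a1 y" using p by (simp add: field_simps)
      finally show ?case using elim by simp
    qed
  qed (intro Bochner_Integration.integrable_diff h1(1) h2(1))
  also have "\<dots> = I2 - I1" using h1(1) h2(1) by (simp add: I1_def I2_def)
  finally have D: "D / \<mu>\<^sup>2 \<le> I2 - I1" .
  have I: "0 < I1" "0 < I2" "I1 \<le> l / \<nu>" "I2 \<le> l / \<nu>" using h1(2,3) h2(2,3) by (auto simp: I1_def I2_def)
  have D0: "0 \<le> D" by (simp add: D_def)
  have d0: "0 \<le> D / \<mu>\<^sup>2" using D0 by simp
  have "I1 * I2 \<le> (l / \<nu>) * (l / \<nu>)" using I assms by (intro mult_mono) auto
  then have "l * (D / \<mu>\<^sup>2) / ((l / \<nu>) * (l / \<nu>)) \<le> l * (D / \<mu>\<^sup>2) / (I1 * I2)"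
    using I assms d0 by (intro divide_left_mono mult_nonneg_nonneg mult_pos_pos) auto
  also have "\<dots> \<le> l * (I2 - I1) / (I1 * I2)"
    using D I assms by (intro divide_right_mono mult_left_mono) auto
  also have "\<dots> = l / I1 - l / I2" using I by (simp add: field_simps)
  also have "l * (D / \<mu>\<^sup>2) / ((l / \<nu>) * (l / \<nu>)) = \<nu>\<^sup>2 / (l * \<mu>\<^sup>2) * D"
    using assms(1,2) by (simp add: power2_eq_square mult_ac)
  finally show ?thesis unfolding h1(4) h2(4) I1_def I2_def D_def .
qed


text \<open>Were it zero, the nonnegative \<open>u0''\<close> times the positive first mode would
  integrate to zero; then \<open>u0'' = 0\<close>, all sine coefficients of \<open>u0\<close>
  vanish, and so does \<open>u0\<close> by completeness. The strict sign makes the rate in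
  \<open>frac_heat_value_diff\<close> positive.\<close>

lemma first_sine_coefficient_neg:
  assumes "p < q" and u0: "u0 \<in> H2 {p<..<q}" "u0 \<in> H10 {p<..<q}"
    and nz: "\<not> (AE x in lebesgue_on {p<..<q}. u0 x = 0)"
    and conv: "AE x in lebesgue_on {p<..<q}. 0 \<le> weak_deriv {p<..<q} (weak_deriv {p<..<q} u0) x"
  shows "sine_coeff p q u0 0 < 0"
proof -
  let ?S = "{p<..<q}"
  define f where "f = weak_deriv ?S (weak_deriv ?S u0)"
  have fL: "f \<in> L2 ?S"
    unfolding f_def using u0(1) by (intro is_weak_deriv_L2(2)[OF H1_is_weak_deriv]) (simp add: H2_def)
  have uL: "u0 \<in> L2 ?S"
    using u0(2) by (intro is_weak_deriv_L2(1)[OF H1_is_weak_deriv]) (simp add: H10_def)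
  have b: "(LINT x|lebesgue_on ?S. f x * sine_mode p q n x) = - sine_eigenvalue p q n * (LINT x|lebesgue_on ?S. u0 x * sine_mode p q n x)" for n
    unfolding f_def by (rule sine_coefficient_weak_deriv2[OF assms(1) u0])
  have i: "integrable (lebesgue_on ?S) (\<lambda>x. f x * sine_mode p q 0 x)"
    by (intro L2_mult_integrable fL sine_mode_L2)
  have nn: "AE x in lebesgue_on ?S. 0 \<le> f x * sine_mode p q 0 x"
    using conv AE_space
  proof eventually_elim
    case (elim x)
    then show ?case using sine_mode_pos[of x p q] by (simp add: f_def)
  qed
  have "(LINT x|lebesgue_on ?S. f x * sine_mode p q 0 x) \<noteq> 0"
  proof
    assume "(LINT x|lebesgue_on ?S. f x * sine_mode p q 0 x) = 0"
    then have "AE x in lebesgue_on ?S. f x * sine_mode p q 0 x = 0"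
      using integral_nonneg_eq_0_iff_AE[OF i nn] by simp
    then have f0: "AE x in lebesgue_on ?S. f x = 0"
      using AE_space
    proof eventually_elim
      case (elim x)
      then show ?case using sine_mode_pos[of x p q] by simp
    qed
    have "(LINT x|lebesgue_on ?S. u0 x * sine_mode p q n x) = 0" for n
    proof -
      have "AE x in lebesgue_on ?S. f x * sine_mode p q n x = 0"
        using f0 by eventually_elim simp
      then have "(LINT x|lebesgue_on ?S. f x * sine_mode p q n x) = 0"
        by (rule integral_eq_zero_AE)
      then show ?thesis using sine_eigenvalue_pos[OF assms(1), of n] unfolding b by simp
    qed
    then have "AE x in lebesgue_on ?S. u0 x = 0"
      unfolding sine_mode_def by (rule sine_complete[OF assms(1) L2_integrable[OF uL]])
    with nz show False ..
  qed
  moreover have "0 \<le> (LINT x|lebesgue_on ?S. f x * sine_mode p q 0 x)"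
    by (rule integral_nonneg_AE[OF nn])
  ultimately have "0 < - sine_eigenvalue p q 0 * (LINT x|lebesgue_on ?S. u0 x * sine_mode p q 0 x)"
    unfolding b by linarith
  then show ?thesis using sine_eigenvalue_pos[OF assms(1), of 0] by (simp add: mult_less_0_iff)
qed

text \<open>Point values are meaningful because the solutions enter as representatives that are
  jointly continuous up to the boundary for positive times. The conditions on the coefficients hold
  almost everywhere, as befits classes in \<open>Linfty\<close>.\<close>

theorem proposition3p14:
  fixes \<alpha> T \<nu> \<mu> l p q x0 t0 :: real and \<Omega> Y :: "real set" and u0 :: "real \<Rightarrow> real"
  assumes "0 < \<alpha>" and "\<alpha> < 1" and "0 < T" and "0 < \<nu>" and "\<nu> < \<mu>"
    and "0 < l" and "Y = {0<..<l}"
    and "p < q" and "\<Omega> = {p<..<q}"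
    and "x0 \<in> \<Omega>" and "t0 \<in> {0<..<T}"
    and "u0 \<in> H2 \<Omega> \<inter> H10 \<Omega>"
    and "\<not> (AE x in lebesgue_on \<Omega>. u0 x = 0)"
    and "AE x in lebesgue_on \<Omega>. weak_deriv \<Omega> (weak_deriv \<Omega> u0) x \<ge> 0"
  shows "\<exists>C>0. \<forall>a1 a2 u1 u2.
    a1 \<in> Linfty Y \<and> a2 \<in> Linfty Y \<and>
    (AE y in lebesgue. a1 (y + l) = a1 y) \<and> (AE y in lebesgue. a2 (y + l) = a2 y) \<and>
    (AE y in lebesgue_on (closure Y). \<nu> \<le> a1 y \<and> a1 y \<le> \<mu>) \<and>
    (AE y in lebesgue_on (closure Y). \<nu> \<le> a2 y \<and> a2 y \<le> \<mu>) \<and>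
    (AE y in lebesgue_on (closure Y). a1 y \<ge> a2 y) \<and>
    weak_solution \<alpha> T \<Omega> (homogenized_coeff Y a1) u0 u1 \<and>
    weak_solution \<alpha> T \<Omega> (homogenized_coeff Y a2) u0 u2 \<and>
    continuous_on ({0<..<T} \<times> closure \<Omega>) (\<lambda>(t, x). u1 t x) \<and>
    continuous_on ({0<..<T} \<times> closure \<Omega>) (\<lambda>(t, x). u2 t x)
    \<longrightarrow> (LINT y|lebesgue_on Y. \<bar>a1 y - a2 y\<bar>) \<le> C * \<bar>u1 t0 x0 - u2 t0 x0\<bar>"
proof -
  have \<alpha>: "\<alpha> \<le> 1" using assms(2) by simp
  have \<Omega>: "\<Omega> = {p<..<q}" and x0: "x0 \<in> {p<..<q}" and cl\<Omega>: "closure \<Omega> = {p..q}"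
    using assms(8-10) by simp_all
  have Y: "Y = {0<..<l}" and clY: "closure Y = {0..l}" using assms(6,7) by simp_all
  define f where "f = weak_deriv \<Omega> (weak_deriv \<Omega> u0)"
  define c where "c n = (sine_coeff p q u0 n)" for n
  have u0: "u0 \<in> H2 {p<..<q}" "u0 \<in> H10 {p<..<q}" using assms(12) unfolding \<Omega> by auto
  have fL: "f \<in> L2 {p<..<q}"
    unfolding f_def \<Omega> using u0(1) by (intro is_weak_deriv_L2(2)[OF H1_is_weak_deriv]) (simp add: H2_def)
  have uL: "u0 \<in> L2 {p<..<q}"
    using u0(2) by (intro is_weak_deriv_L2(1)[OF H1_is_weak_deriv]) (simp add: H10_def)
  have b: "sine_coeff p q f n = - sine_eigenvalue p q n * c n" for n
    unfolding f_def c_def \<Omega> by (rule sine_coefficient_weak_deriv2[OF assms(8) u0])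
  define F where "F = (LINT x|lebesgue_on {p<..<q}. \<bar>f x\<bar>)"
  have cF: "\<bar>c n\<bar> \<le> F / sine_eigenvalue p q n" for n
    using abs_sine_coefficient_le[OF fL, of n] sine_eigenvalue_pos[OF assms(8), of n]
    unfolding b F_def by (simp add: abs_mult field_simps)
  have f0: "AE x in lebesgue_on {p<..<q}. 0 \<le> f x" using assms(14) unfolding f_def \<Omega> .
  have c0: "c 0 < 0"
    unfolding c_def using first_sine_coefficient_neg[OF assms(8) u0] assms(13,14) unfolding \<Omega> by blast
  define \<tau> where "\<tau> = t0 powr \<alpha>"
  have \<tau>: "0 < \<tau>" using assms(11) by (simp add: \<tau>_def)
  \<comment> \<open>Harmonic means stay in \<open>[\<nu>, \<mu>]\<close>, so all arguments
    \<open>a * \<tau>\<close> lie in this fixed interval and \<open>K\<close> does not depend on the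
    coefficients.\<close>
  obtain K where K: "0 < K" and diff: "\<And>s1 s2. \<nu> * \<tau> \<le> s2 \<Longrightarrow> s2 \<le> s1 \<Longrightarrow> s1 \<le> \<mu> * \<tau> \<Longrightarrow>
    K * (s1 - s2) \<le> frac_heat_value \<alpha> p q c x0 s1 - frac_heat_value \<alpha> p q c x0 s2"
    using frac_heat_value_diff[OF assms(8,1) \<alpha> x0 fL f0 b c0, of "\<nu> * \<tau>" "\<mu> * \<tau>"] assms(4,5) \<tau> by auto
  \<comment> \<open>\<open>2 / (q - p)\<close> normalises the sine series, \<open>K * \<tau>\<close>
    is the rate in the variable \<open>a * \<tau>\<close> converted to the variable
    \<open>a\<close>, and the last factor comes from \<open>homogenized_coeff_diff\<close>. The
    constant of the theorem is \<open>1 / k\<close>.\<close>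
  define k where "k = 2 / (q - p) * (K * \<tau> * (\<nu>\<^sup>2 / (l * \<mu>\<^sup>2)))"
  have k: "0 < k" unfolding k_def using K \<tau> assms(4-6,8) by (intro mult_pos_pos divide_pos_pos) auto
  have "(LINT y|lebesgue_on Y. \<bar>a1 y - a2 y\<bar>) \<le> 1 / k * \<bar>u1 t0 x0 - u2 t0 x0\<bar>"
    if a: "a1 \<in> Linfty Y" "a2 \<in> Linfty Y"
      and bd: "AE y in lebesgue_on (closure Y). \<nu> \<le> a1 y \<and> a1 y \<le> \<mu>"
        "AE y in lebesgue_on (closure Y). \<nu> \<le> a2 y \<and> a2 y \<le> \<mu>"
        "AE y in lebesgue_on (closure Y). a1 y \<ge> a2 y"
      and sol: "weak_solution \<alpha> T \<Omega> (homogenized_coeff Y a1) u0 u1" "weak_solution \<alpha> T \<Omega> (homogenized_coeff Y a2) u0 u2"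
      and cont: "continuous_on ({0<..<T} \<times> closure \<Omega>) (\<lambda>(t, x). u1 t x)" "continuous_on ({0<..<T} \<times> closure \<Omega>) (\<lambda>(t, x). u2 t x)"
    for a1 a2 u1 u2
  proof -
    have restr: "AE y in lebesgue_on {0<..<l}. P y" if P: "AE y in lebesgue_on (closure Y). P y" for P
    proof -
      have "AE y in lebesgue. y \<in> {0..l} \<longrightarrow> P y"
        using P unfolding clY by (simp add: AE_restrict_space_iff)
      then have "AE y in lebesgue. y \<in> {0<..<l} \<longrightarrow> P y" by eventually_elim auto
      then show ?thesis by (simp add: AE_restrict_space_iff)
    qed
    have m: "a1 \<in> borel_measurable (lebesgue_on {0<..<l})" "a2 \<in> borel_measurable (lebesgue_on {0<..<l})"
      using a by (auto simp: Linfty_def Y)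
    define A1 where "A1 = homogenized_coeff {0<..<l} a1"
    define A2 where "A2 = homogenized_coeff {0<..<l} a2"
    define D where "D = (LINT y|lebesgue_on {0<..<l}. \<bar>a1 y - a2 y\<bar>)"
    have A: "\<nu> \<le> A1" "A1 \<le> \<mu>" "\<nu> \<le> A2" "A2 \<le> \<mu>"
      unfolding A1_def A2_def
      using homogenized_coeff_bounds(5,6)[OF assms(6,4) m(1) restr[OF bd(1)]]
        homogenized_coeff_bounds(5,6)[OF assms(6,4) m(2) restr[OF bd(2)]] by auto
    have AD: "\<nu>\<^sup>2 / (l * \<mu>\<^sup>2) * D \<le> A1 - A2"
      unfolding A1_def A2_def D_def
      by (rule homogenized_coeff_diff[OF assms(6,4) m restr[OF bd(1)] restr[OF bd(2)] restr[OF bd(3)]])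
    have D0: "0 \<le> \<nu>\<^sup>2 / (l * \<mu>\<^sup>2) * D" using assms(6) by (simp add: D_def)
    then have A21: "A2 \<le> A1" using AD by linarith
    have u: "u t0 x0 = 2 / (q - p) * frac_heat_value \<alpha> p q c x0 (a * \<tau>)"
      if "\<nu> \<le> a" "weak_solution \<alpha> T {p<..<q} a u0 u" "continuous_on ({0<..<T} \<times> {p..q}) (\<lambda>(t, x). u t x)" for a u
      unfolding \<tau>_def c_def
      using weak_solution_value[OF assms(1) \<alpha> _ assms(8) that(2) uL that(3) assms(11) x0 cF[unfolded c_def]] that(1) assms(4) by simp
    have u1: "u1 t0 x0 = 2 / (q - p) * frac_heat_value \<alpha> p q c x0 (A1 * \<tau>)"
      using u[OF A(1)] sol(1) cont(1) unfolding \<Omega> Y cl\<Omega>[unfolded \<Omega>] A1_def by simp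
    have u2: "u2 t0 x0 = 2 / (q - p) * frac_heat_value \<alpha> p q c x0 (A2 * \<tau>)"
      using u[OF A(3)] sol(2) cont(2) unfolding \<Omega> Y cl\<Omega>[unfolded \<Omega>] A2_def by simp
    have "k * D = 2 / (q - p) * (K * \<tau> * (\<nu>\<^sup>2 / (l * \<mu>\<^sup>2) * D))" by (simp add: k_def)
    also have "\<dots> \<le> 2 / (q - p) * (K * \<tau> * (A1 - A2))"
      using AD K \<tau> assms(8) by (intro mult_left_mono) auto
    also have "\<dots> = 2 / (q - p) * (K * (A1 * \<tau> - A2 * \<tau>))" by (simp add: algebra_simps)
    also have "\<dots> \<le> 2 / (q - p) * (frac_heat_value \<alpha> p q c x0 (A1 * \<tau>) - frac_heat_value \<alpha> p q c x0 (A2 * \<tau>))"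
      using A A21 \<tau> assms(8) by (intro mult_left_mono diff mult_right_mono) auto
    also have "\<dots> = u1 t0 x0 - u2 t0 x0" unfolding u1 u2 by (simp only: right_diff_distrib)
    also have "\<dots> \<le> \<bar>u1 t0 x0 - u2 t0 x0\<bar>" by (rule abs_ge_self)
    finally have "D \<le> \<bar>u1 t0 x0 - u2 t0 x0\<bar> / k" using k by (simp add: pos_le_divide_eq mult.commute)
    then show ?thesis unfolding D_def Y by simp
  qed
  then show ?thesis using k by (intro exI[of _ "1 / k"]) auto
qed

end
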